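(* Let $R=(e^1,\ldots,e^{n-1},r)\in\mathbb{Z}^{n\times n}$ be the matrix whose columns are the first $n-1$ standard unit vectors of $\mathbb{R}^n$ and a vector $r\in\mathbb{Z}^n$ with last coordinate $r_n=\Delta\geq 1$. Further, let $I\subseteq\{0,\ldots,\Delta-1\}$ be such that $r_i\in I$ for all $i\in\{1,\ldots,n-1\}$. If $|I\setminus\{0,\Delta-1\}|\leq 2$, then $$\operatorname{ICR}(\operatorname{pos}R)=n.$$
   Context: For a matrix $R$, $\operatorname{pos}R$ denotes the set of all non-negative real linear combinations of the columns of $R$. $\mathbb{N}$ denotes the non-negative integers. For a pointed rational cone $C\subseteq\mathbb{R}^n$, the Hilbert basis $\mathcal{H}(C)$ is the unique minimal set of vectors in $C\cap\mathbb{Z}^n$ such that every element of $C\cap\mathbb{Z}^n$ is a non-negative integral combination of elements of the set (it is finite). The integer Carathéodory rank of $C$ is $$\operatorname{ICR}(C):=\max_{z\in C\cap\mathbb{Z}^n}\min\Big\{k : z=\sum_{i=1}^k\lambda_i h^i\text{ with }\lambda_i\in\mathbb{N},\ h^i\in\mathcal{H}(C)\text{ for all }i\in\{1,\ldots,k\}\Big\}.$$ *)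

theory Defs
  imports Complex_Main "Jordan_Normal_Form.Matrix"
begin

definition pos :: "real mat \<Rightarrow> real vec set" where
  "pos R = {R *\<^sub>v x | x. x \<in> carrier_vec (dim_col R) \<and> (\<forall>i<dim_col R. 0 \<le> x $ i)}"

text \<open>The points of \<open>C \<inter> \<int>\<^sup>n\<close>, represented as integer vectors.\<close>
definition lattice_points :: "nat \<Rightarrow> real vec set \<Rightarrow> int vec set" where
  "lattice_points n C = {z \<in> carrier_vec n. map_vec real_of_int z \<in> C}"

text \<open>\<open>z\<close> is a combination of \<open>k\<close> elements of \<open>H\<close> with coefficients in \<open>\<nat>\<close>.
  Zero coefficients and repeated elements are allowed, and \<open>k = 0\<close> gives the zero vector.\<close>
definition nonneg_int_comb :: "nat \<Rightarrow> int vec set \<Rightarrow> nat \<Rightarrow> int vec \<Rightarrow> bool" where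
  "nonneg_int_comb n H k z \<longleftrightarrow>
     (\<exists>(c :: nat \<Rightarrow> nat) h. (\<forall>i\<in>{1..k}. h i \<in> H) \<and>
        z = finsum_vec TYPE(int) n (\<lambda>i. int (c i) \<cdot>\<^sub>v h i) {1..k})"

definition generates_lattice_points :: "nat \<Rightarrow> real vec set \<Rightarrow> int vec set \<Rightarrow> bool" where
  "generates_lattice_points n C H \<longleftrightarrow>
     H \<subseteq> lattice_points n C \<and> (\<forall>z\<in>lattice_points n C. \<exists>k. nonneg_int_comb n H k z)"

text \<open>Minimality is with respect to inclusion. For a pointed rational cone \<open>C\<close> the minimal
  set exists and is unique; for other \<open>C\<close> the value is unspecified.\<close>
definition hilbert_basis :: "nat \<Rightarrow> real vec set \<Rightarrow> int vec set" where
  "hilbert_basis n C =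
     (THE H. generates_lattice_points n C H \<and> (\<forall>H'. H' \<subset> H \<longrightarrow> \<not> generates_lattice_points n C H'))"

definition ICR :: "nat \<Rightarrow> real vec set \<Rightarrow> nat" where
  "ICR n C = Max ((\<lambda>z. LEAST k. nonneg_int_comb n (hilbert_basis n C) k z) ` lattice_points n C)"

end

theory Submission
  imports Defs "HOL-Analysis.Product_Vector"
begin

text \<open>
  Let \<open>C\<close> be the cone and call the last coordinate of a lattice point its height. A lattice point
  of height \<open>t\<close> has \<open>i\<close>-th coordinate at least \<open>\<lceil>t r\<^sub>i /
  \<Delta>\<rceil>\<close>; let \<open>g t\<close> be the lowest one. The monoid of lattice points of
  \<open>C\<close> has a unique minimal generating set, its indecomposable elements: the first \<open>n -
  1\<close> unit vectors and the points \<open>g s\<close> for certain heights \<open>s \<le> \<Delta>\<close>.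

  Lower bound: adding these unit vectors to \<open>g 1\<close> gives a point that needs all of these
  \<open>n\<close> summands, because heights and lowest coordinates leave no other choice
  (\<open>irr_comb_lower\<close>).

  Upper bound: coordinates with \<open>r\<^sub>i = 0\<close> never obstruct a decomposition of a height, and
  coordinates with \<open>r\<^sub>i = \<Delta> - 1\<close> do so, among heights up to \<open>\<Delta>\<close>,
  only at \<open>\<Delta>\<close>, since \<open>\<lceil>s (\<Delta> - 1) / \<Delta>\<rceil> = s\<close> for
  \<open>0 < s < \<Delta>\<close>. Equal coordinates obstruct equally. So only the at most two values \<open>a,
  b\<close> of \<open>r\<^sub>i\<close> outside \<open>{0, \<Delta> - 1}\<close> matter, and the question
  becomes one about the three-dimensional cone spanned by \<open>e\<^sub>1, e\<^sub>2, (a, b, \<Delta>)\<close>.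
  There Sebo's theorem (\<open>unimodular_hilbert_frame\<close>) writes every lattice point with at most three
  members of the Hilbert basis. In the lift to dimension \<open>n\<close> each summand \<open>g s\<close> is
  counted once, and each unused unit vector of the small cone frees one coordinate of the large one
  (\<open>lift_heights\<close>). If some coordinate with \<open>r\<^sub>i = \<Delta> - 1\<close> is below the
  height of the point, multiples of \<open>r\<close> are subtracted first until the lowest of these coordinates
  equals the height; this uses one more generator and makes one more coordinate tight
  (\<open>few_summands\<close>).

  Sebo's theorem is proved for an arbitrary simplicial cone and an additive subgroup of a real vector space. A
  linear programming argument (\<open>supporting_frame\<close>) puts the point into the cone of three lattice
  points whose triangle is empty and lies on the boundary of the convex hull of the non-zero lattice points. All
  non-zero points of the half-open parallelepiped of such a triple have coordinates that add up to less than 2,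
  while all non-zero lattice points of the cone have coordinate sum at least 1; so they are indecomposable. By
  White's theorem (\<open>white_width_one\<close>) two of their three coordinates, the same two for all of them,
  add up to 1. So the cone over the triangle is also a cone over a planar strip; inserting the parallelepiped
  points from the bottom of the strip upwards subdivides it into unimodular cones
  (\<open>strip_unimodular_cover\<close>).
\<close>

section \<open>Jumps of three floor sequences\<close>

lemma int_le_div_iff:
  fixes q i x :: int
  assumes "0 < q"
  shows "i \<le> x div q \<longleftrightarrow> i * q \<le> x"
proof
  have x: "x = (x div q) * q + x mod q" by simp
  have "0 \<le> x mod q" using assms by simp
  then show "i * q \<le> x" if "i \<le> x div q"
    using mult_right_mono[OF that, of q] assms x by linarith
  show "i \<le> x div q" if "i * q \<le> x"
    using zdiv_mono1[OF that assms] assms by simp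
qed

lemma ceiling_multiple:
  fixes N c :: int
  assumes "0 < c"
  obtains s where "(s - 1) * c < N" "N \<le> s * c"
proof
  define d where "d = (N - 1) div c"
  have "(N - 1) = d * c + (N - 1) mod c" unfolding d_def by (simp only: div_mult_mod_eq)
  moreover have "0 \<le> (N - 1) mod c" "(N - 1) mod c < c" using assms by simp_all
  ultimately show "((d + 1) - 1) * c < N" "N \<le> (d + 1) * c"
    unfolding distrib_right by simp_all
qed

text \<open>
  By the hypothesis on floors, at each step from 2 to \<open>q - 1\<close> exactly one of the three floor sequences jumps.
  The two slower ones therefore add up to \<open>\<lceil>k (b + c - 1) / q\<rceil> - 1\<close>. Let \<open>m\<close> be the first jump of \<open>c\<close>. It is also the
  first jump of that sum, whose jumps are hence at least \<open>m - 1\<close> apart, while consecutive jumps of \<open>c\<close> are at most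
  \<open>m\<close> apart. A jump of \<open>b\<close> lies between two consecutive jumps of \<open>c\<close>, so \<open>2 (m - 1) \<le> m\<close>. But at step 2
  \<open>c\<close> and \<open>d\<close> cannot both jump.
\<close>

lemma floor_jumps_impossible:
  fixes q b c d :: int
  assumes sum: "b + c + d = q + 1" and b: "2 \<le> b" and bc: "b \<le> c" and cd: "c \<le> d"
    and jump: "\<And>k. 0 < k \<Longrightarrow> k < q \<Longrightarrow> (k * b) div q + (k * c) div q + (k * d) div q = k - 1"
    and ndvd: "\<And>k. 0 < k \<Longrightarrow> k < q \<Longrightarrow> (k * c) mod q \<noteq> 0"
  shows False
proof -
  have q: "5 \<le> q" "b < q" "c < q" "2 * c \<le> q - 1" using assms(1-4) by auto
  have div_ge: "i \<le> x div q \<longleftrightarrow> i * q \<le> x" for i x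
    using q by (intro int_le_div_iff) simp
  have div_less: "x div q < i \<longleftrightarrow> x < i * q" for i x
    using div_ge[of i x] by linarith
  \<comment> \<open>The first jump of \<open>b\<close>. Below, \<open>s\<close> and \<open>s'\<close> are the jumps of \<open>c\<close> before and after it, and \<open>m\<close>
    is the first jump of \<open>c\<close>.\<close>
  obtain k where k: "(k - 1) * b < q" "q \<le> k * b"
    using ceiling_multiple[of b q] b by auto
  have k2: "2 \<le> k"
  proof (rule ccontr)
    assume "\<not> 2 \<le> k"
    then have "k * b \<le> 1 * b" using b by (intro mult_right_mono) auto
    then show False using k q by simp
  qed
  have kq: "k < q"
  proof (rule ccontr)
    assume "\<not> k < q"
    then have "(q - 1) * 2 \<le> (k - 1) * b" using b q by (intro mult_mono) auto
    then show False using k q by simp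
  qed
  define p where "p = (k * c) div q"
  have b0: "((k - 1) * b) div q = 0" using k b k2 by (intro div_pos_pos_trivial) auto
  have b1: "1 \<le> (k * b) div q" using k by (simp add: div_ge)
  have mono_c: "((k - 1) * c) div q \<le> (k * c) div q"
    using q b bc by (intro zdiv_mono1) (auto simp: algebra_simps)
  have mono_d: "((k - 1) * d) div q \<le> (k * d) div q"
    using q b bc cd by (intro zdiv_mono1) (auto simp: algebra_simps)
  have jk: "(k * b) div q + (k * c) div q + (k * d) div q = k - 1"
    "((k - 1) * b) div q + ((k - 1) * c) div q + ((k - 1) * d) div q = k - 2"
    using jump[of k] jump[of "k - 1"] k2 kq by auto
  have pk: "((k - 1) * c) div q = p" "(k * d) div q = k - 2 - p" "((k - 1) * d) div q = k - 2 - p"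
    using jk b0 b1 mono_c mono_d unfolding p_def by linarith+
  have p1: "1 \<le> p"
  proof -
    have "k * b \<le> k * c" using bc k2 by simp
    then show ?thesis unfolding p_def div_ge using k by simp
  qed
  \<comment> \<open>The reflection \<open>k \<mapsto> q + 1 - k\<close> preserves jumps, so \<open>c\<close> jumps after \<open>k\<close> because it jumps before \<open>q + 1 - k\<close>.\<close>
  have p2: "p \<le> c - 2"
  proof -
    have e: "(q + 1 - k) * c = q * c - (k - 1) * c" by (simp add: algebra_simps)
    have "(q + 1 - k) * b = q * b - (k - 1) * b" by (simp add: algebra_simps)
    moreover have "q * 2 \<le> q * b" using b q by (intro mult_left_mono) auto
    ultimately have "q \<le> (q + 1 - k) * b" using k by linarith
    also have "\<dots> \<le> (q + 1 - k) * c" using kq bc by (intro mult_left_mono) auto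
    finally have 1: "q \<le> q * c - (k - 1) * c" by (simp only: e)
    have "(k - 1) * c = p * q + ((k - 1) * c) mod q"
      using div_mult_mod_eq[of "(k - 1) * c" q] pk(1) by simp
    moreover have "((k - 1) * c) mod q > 0"
    proof -
      have "((k - 1) * c) mod q \<noteq> 0" using ndvd[of "k - 1"] k2 kq by simp
      moreover have "0 \<le> ((k - 1) * c) mod q" using q by (intro pos_mod_sign) simp
      ultimately show ?thesis by linarith
    qed
    ultimately have "p * q < (k - 1) * c" by linarith
    with 1 have "(p + 1) * q < c * q" by (simp add: algebra_simps)
    then show ?thesis using q by (simp add: mult_less_cancel_right)
  qed
  obtain s where s: "(s - 1) * c < p * q" "p * q \<le> s * c"
    using ceiling_multiple[of c "p * q"] b bc by auto
  obtain s' where s': "(s' - 1) * c < (p + 1) * q" "(p + 1) * q \<le> s' * c"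
    using ceiling_multiple[of c "(p + 1) * q"] b bc by auto
  obtain m where m: "(m - 1) * c < q" "q \<le> m * c"
    using ceiling_multiple[of c q] b bc by auto
  have c0: "0 < c" using b bc by simp
  have less_c: "x * c < y * c \<longleftrightarrow> x < y" for x y :: int using c0 by simp
  have ms: "m \<le> s"
  proof -
    have "1 * q \<le> p * q" using p1 q by (intro mult_right_mono) auto
    then have "(m - 1) * c < s * c" using m s by linarith
    then show ?thesis unfolding less_c by simp
  qed
  have m3: "3 \<le> m"
  proof (rule ccontr)
    assume "\<not> 3 \<le> m"
    then have "m * c \<le> 2 * c" using c0 by (intro mult_right_mono) auto
    then show False using m q by linarith
  qed
  have sk: "s \<le> k - 1"
  proof -
    have "p * q \<le> (k - 1) * c" using pk(1) div_ge[of p "(k - 1) * c"] by simp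
    with s(1) have "(s - 1) * c < (k - 1) * c" by linarith
    then show ?thesis unfolding less_c by simp
  qed
  have ks': "k < s'"
  proof -
    have "k * c < (p + 1) * q" using div_less[of "k * c" "p + 1"] unfolding p_def by simp
    with s'(2) have "k * c < s' * c" by linarith
    then show ?thesis unfolding less_c by simp
  qed
  have s'q: "s' < q"
  proof -
    have "(p + 2) * q \<le> c * q" using p2 q by (intro mult_right_mono) auto
    then have "(p + 1) * q \<le> (q - 1) * c" using q by (simp add: algebra_simps)
    with s'(1) have "(s' - 1) * c < (q - 1) * c" by linarith
    then show ?thesis unfolding less_c by simp
  qed
  have before_k: "(x * b) div q = 0" if "0 \<le> x" "x \<le> k - 1" for x
  proof -
    have "x * b \<le> (k - 1) * b" using that b by (intro mult_right_mono) auto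
    then have "x * b < q" using k by linarith
    then show ?thesis using that b by (intro div_pos_pos_trivial) auto
  qed
  have at_s: "(s - 1 - p) * q \<le> (s - 1) * d"
  proof -
    have "((s - 1) * c) div q < p" using s(1) by (simp add: div_less)
    then have "s - 1 - p \<le> ((s - 1) * d) div q"
      using jump[of "s - 1"] before_k[of "s - 1"] ms m3 sk kq by auto
    then show ?thesis by (simp add: div_ge)
  qed
  have at_k: "k * d < (k - 1 - p) * q" using pk(2) div_less[of "k * d" "k - 1 - p"] by simp
  have at_k1: "(k - 2 - p) * q \<le> (k - 1) * d" using pk(3) div_ge[of "k - 2 - p" "(k - 1) * d"] by simp
  have at_s': "s' * d < (s' - 2 - p) * q"
  proof -
    have "k * b \<le> s' * b" using ks' b by (intro mult_right_mono) auto
    then have "1 \<le> (s' * b) div q" using k by (simp add: div_ge)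
    moreover have "p + 1 \<le> (s' * c) div q" using s'(2) by (simp add: div_ge)
    ultimately have "(s' * d) div q < s' - 2 - p" using jump[of s'] ks' k2 s'q by auto
    then show ?thesis by (simp add: div_less)
  qed
  have at_m: "(m - 2) * q \<le> (m - 1) * d"
  proof -
    have "((m - 1) * c) div q = 0" using m m3 c0 by (intro div_pos_pos_trivial) auto
    then have "((m - 1) * d) div q = m - 2"
      using jump[of "m - 1"] before_k[of "m - 1"] ms m3 sk kq by auto
    then show ?thesis using div_ge[of "m - 2" "(m - 1) * d"] by simp
  qed
  \<comment> \<open>This is \<open>b + c - 1\<close>, the slope of the sum of the two slower sequences.\<close>
  define e where "e = q - d"
  have e0: "0 < e" using sum b bc unfolding e_def by simp
  have "(m - 1) * e \<le> q" using at_m unfolding e_def by (simp add: algebra_simps)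
  moreover have "q < (k - s + 1) * e" using at_s at_k unfolding e_def by (simp add: algebra_simps)
  moreover have "q < (s' - k + 1) * e" using at_s' at_k1 unfolding e_def by (simp add: algebra_simps)
  ultimately have "(m - 1) * e < (k - s + 1) * e" "(m - 1) * e < (s' - k + 1) * e" by linarith+
  then have "m - 1 < k - s + 1" "m - 1 < s' - k + 1" using e0 by (simp_all add: mult_less_cancel_right)
  moreover have "(s' - 1 - s) * c < m * c" using s(2) s'(1) m(2) by (simp add: algebra_simps)
  ultimately show False unfolding less_c using m3 by linarith
qed

text \<open>
  The numbers \<open>k / q\<close>, \<open>k b / q\<close>, \<open>k c / q\<close> are the coordinates of the multiples of a lattice point relative to an empty
  simplex. Since remainders of a number and of its negative add up to \<open>q\<close>, the hypotheses say that the
  three numbers \<open>q - b\<close>, \<open>q - c\<close>, \<open>1 + b + c - q\<close>, which add up to \<open>q + 1\<close>, have floor sums \<open>k - 1\<close>. So one of them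
  is 1.
\<close>

lemma white_arithmetic:
  fixes q b c :: int
  assumes b: "0 < b" "b < q" and c: "0 < c" "c < q"
    and ndvd: "\<And>k. 0 < k \<Longrightarrow> k < q \<Longrightarrow> (k * b) mod q \<noteq> 0 \<and> (k * c) mod q \<noteq> 0"
    and between: "\<And>k. 0 < k \<Longrightarrow> k < q \<Longrightarrow>
      q < k + (k * b) mod q + (k * c) mod q \<and> k + (k * b) mod q + (k * c) mod q < 2 * q"
  shows "b = q - 1 \<or> c = q - 1 \<or> b + c = q"
proof (rule ccontr)
  assume neg: "\<not> ?thesis"
  define b' c' d' where "b' = q - b" and "c' = q - c" and "d' = 1 + b + c - q"
  have sum: "b' + c' + d' = q + 1" unfolding b'_def c'_def d'_def by simp
  have "1 mod q = 1" using b by simp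
  then have "0 < d'" using between[of 1] b c unfolding d'_def by simp
  then have ge: "2 \<le> b'" "2 \<le> c'" "2 \<le> d'"
    using neg b c unfolding b'_def c'_def d'_def by auto
  have refl: "(k * (q - x)) div q = k - 1 - (k * x) div q" "(k * (q - x)) mod q \<noteq> 0"
    if "(k * x) mod q \<noteq> 0" for k x
  proof -
    have m: "0 < (k * x) mod q" "(k * x) mod q < q"
      using that b pos_mod_sign[of q "k * x"] pos_mod_bound[of q "k * x"] by linarith+
    have *: "k * (q - x) = q * (k - 1 - (k * x) div q) + (q - (k * x) mod q)"
      using div_mult_mod_eq[of "k * x" q] by (simp add: algebra_simps)
    then show "(k * (q - x)) div q = k - 1 - (k * x) div q" "(k * (q - x)) mod q \<noteq> 0"
      using m int_div_pos_eq[OF *] int_mod_pos_eq[OF *] by simp_all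
  qed
  have d'_div: "(k * d') div q = (k * b) div q + (k * c) div q - k + 1" "(k * d') mod q \<noteq> 0"
    if k: "0 < k" "k < q" for k
  proof -
    let ?r = "k + (k * b) mod q + (k * c) mod q - q"
    have r: "0 < ?r" "?r < q" using between[OF k] by auto
    have *: "k * d' = q * ((k * b) div q + (k * c) div q - k + 1) + ?r"
      using div_mult_mod_eq[of "k * b" q] div_mult_mod_eq[of "k * c" q]
      unfolding d'_def by (simp add: algebra_simps)
    then show "(k * d') div q = (k * b) div q + (k * c) div q - k + 1" "(k * d') mod q \<noteq> 0"
      using r int_div_pos_eq[OF *] int_mod_pos_eq[OF *] by simp_all
  qed
  have jump: "(k * b') div q + (k * c') div q + (k * d') div q = k - 1"
    and nd: "(k * b') mod q \<noteq> 0" "(k * c') mod q \<noteq> 0" "(k * d') mod q \<noteq> 0"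
    if k: "0 < k" "k < q" for k
    using refl[of k b] refl[of k c] d'_div[OF k] ndvd[OF k] unfolding b'_def c'_def by auto
  have imp: False if "x + y + z = q + 1" "2 \<le> x" "x \<le> y" "y \<le> z"
    "{x, y, z} = {b', c', d'}" "\<And>k. (k * x) div q + (k * y) div q + (k * z) div q
      = (k * b') div q + (k * c') div q + (k * d') div q" for x y z
  proof (rule floor_jumps_impossible[of x y z q])
    fix k assume k: "0 < k" "k < q"
    show "(k * x) div q + (k * y) div q + (k * z) div q = k - 1" using that(6)[of k] jump[OF k] by simp
    have "y \<in> {b', c', d'}" using that(5) by auto
    then show "(k * y) mod q \<noteq> 0" using nd[OF k] by auto
  qed (use that in auto)
  consider "b' \<le> c'" "c' \<le> d'" | "b' \<le> d'" "d' \<le> c'" | "c' \<le> b'" "b' \<le> d'"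
    | "c' \<le> d'" "d' \<le> b'" | "d' \<le> b'" "b' \<le> c'" | "d' \<le> c'" "c' \<le> b'" by linarith
  then show False
    using imp[of b' c' d'] imp[of b' d' c'] imp[of c' b' d'] imp[of c' d' b'] imp[of d' b' c']
      imp[of d' c' b'] sum ge by cases (simp_all add: insert_commute)
qed

lemma frac_div_eq:
  fixes a q :: int
  assumes "0 < q"
  shows "frac (real_of_int a / real_of_int q) = real_of_int (a mod q) / real_of_int q"
proof -
  have "real_of_int a = real_of_int (a div q) * real_of_int q + real_of_int (a mod q)"
    by (metis div_mult_mod_eq of_int_add of_int_mult)
  then show ?thesis
    using assms unfolding frac_def floor_divide_of_int_eq by (simp add: field_simps)
qed


section \<open>Bases with their coordinate functionals\<close>

text \<open>
  The functionals express both that the three vectors span and that they are independent, and they make the exchange of a basis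
  vector an explicit formula.
\<close>

definition dual_basis :: "'v::real_vector \<Rightarrow> 'v \<Rightarrow> 'v \<Rightarrow> ('v \<Rightarrow> real) \<Rightarrow> ('v \<Rightarrow> real) \<Rightarrow> ('v \<Rightarrow> real) \<Rightarrow> bool"
  where "dual_basis u v w \<alpha> \<beta> \<gamma> \<longleftrightarrow> linear \<alpha> \<and> linear \<beta> \<and> linear \<gamma>
    \<and> \<alpha> u = 1 \<and> \<alpha> v = 0 \<and> \<alpha> w = 0 \<and> \<beta> u = 0 \<and> \<beta> v = 1 \<and> \<beta> w = 0
    \<and> \<gamma> u = 0 \<and> \<gamma> v = 0 \<and> \<gamma> w = 1 \<and> (\<forall>y. y = \<alpha> y *\<^sub>R u + \<beta> y *\<^sub>R v + \<gamma> y *\<^sub>R w)"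

lemma dual_basis_linear:
  assumes "dual_basis u v w \<alpha> \<beta> \<gamma>"
  shows "linear \<alpha>" "linear \<beta>" "linear \<gamma>"
  using assms unfolding dual_basis_def by auto

lemma dual_basis_values:
  assumes "dual_basis u v w \<alpha> \<beta> \<gamma>"
  shows "\<alpha> u = 1" "\<alpha> v = 0" "\<alpha> w = 0" "\<beta> u = 0" "\<beta> v = 1" "\<beta> w = 0"
    "\<gamma> u = 0" "\<gamma> v = 0" "\<gamma> w = 1"
  using assms unfolding dual_basis_def by auto

lemma dual_basis_expand:
  assumes "dual_basis u v w \<alpha> \<beta> \<gamma>"
  shows "y = \<alpha> y *\<^sub>R u + \<beta> y *\<^sub>R v + \<gamma> y *\<^sub>R w"
  using assms unfolding dual_basis_def by blast

lemma dual_basis_rotate: "dual_basis u v w \<alpha> \<beta> \<gamma> \<Longrightarrow> dual_basis v w u \<beta> \<gamma> \<alpha>"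
  unfolding dual_basis_def by (auto simp: add.commute add.left_commute)

lemma dual_basis_swap: "dual_basis u v w \<alpha> \<beta> \<gamma> \<Longrightarrow> dual_basis v u w \<beta> \<alpha> \<gamma>"
  unfolding dual_basis_def by (auto simp: add.commute add.left_commute)

lemma linear_dual_basis:
  assumes "dual_basis u v w \<alpha> \<beta> \<gamma>" "linear f"
  shows "f y = \<alpha> y *\<^sub>R f u + \<beta> y *\<^sub>R f v + \<gamma> y *\<^sub>R f w"
  by (subst dual_basis_expand[OF assms(1), of y]) (simp add: assms(2) linear_add linear_scale)

lemma dual_basis_unique:
  assumes "dual_basis u v w \<alpha> \<beta> \<gamma>" "dual_basis u v w \<alpha>' \<beta>' \<gamma>'"
  shows "\<alpha>' = \<alpha>" "\<beta>' = \<beta>" "\<gamma>' = \<gamma>"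
  using linear_dual_basis[OF assms(1) dual_basis_linear(1)[OF assms(2)]]
    linear_dual_basis[OF assms(1) dual_basis_linear(2)[OF assms(2)]]
    linear_dual_basis[OF assms(1) dual_basis_linear(3)[OF assms(2)]]
  by (auto simp: dual_basis_values[OF assms(2)])

lemma dual_basis_exchange:
  assumes db: "dual_basis u v w \<alpha> \<beta> \<gamma>" and x: "\<gamma> x \<noteq> 0"
  shows "dual_basis u v x (\<lambda>y. \<alpha> y - \<gamma> y / \<gamma> x * \<alpha> x) (\<lambda>y. \<beta> y - \<gamma> y / \<gamma> x * \<beta> x) (\<lambda>y. \<gamma> y / \<gamma> x)"
proof -
  note lin = dual_basis_linear[OF db] and vals = dual_basis_values[OF db]
  have "y = (\<alpha> y - \<gamma> y / \<gamma> x * \<alpha> x) *\<^sub>R u + (\<beta> y - \<gamma> y / \<gamma> x * \<beta> x) *\<^sub>R v + (\<gamma> y / \<gamma> x) *\<^sub>R x" for y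
  proof -
    have "(\<gamma> y / \<gamma> x) *\<^sub>R x = (\<gamma> y / \<gamma> x) *\<^sub>R (\<alpha> x *\<^sub>R u + \<beta> x *\<^sub>R v + \<gamma> x *\<^sub>R w)"
      using dual_basis_expand[OF db, of x] by simp
    also have "\<dots> = (\<gamma> y / \<gamma> x * \<alpha> x) *\<^sub>R u + (\<gamma> y / \<gamma> x * \<beta> x) *\<^sub>R v + \<gamma> y *\<^sub>R w"
      using x by (simp add: scaleR_right_distrib)
    finally have "(\<alpha> y - \<gamma> y / \<gamma> x * \<alpha> x) *\<^sub>R u + (\<beta> y - \<gamma> y / \<gamma> x * \<beta> x) *\<^sub>R v + (\<gamma> y / \<gamma> x) *\<^sub>R x
      = \<alpha> y *\<^sub>R u + \<beta> y *\<^sub>R v + \<gamma> y *\<^sub>R w"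
      by (simp add: scaleR_left_diff_distrib)
    then show ?thesis using dual_basis_expand[OF db, of y] by simp
  qed
  moreover have "linear (\<lambda>y. f y - \<gamma> y / \<gamma> x * f x)" if "linear f" for f :: "'a \<Rightarrow> real"
    using x by (intro linearI) (simp_all add: that lin linear_add linear_scale field_simps)
  moreover have "linear (\<lambda>y. \<gamma> y / \<gamma> x)"
    by (intro linearI) (simp_all add: lin linear_add linear_scale add_divide_distrib)
  ultimately show ?thesis
    unfolding dual_basis_def using x by (simp add: lin vals)
qed

text \<open>
  Moving from \<open>(p, q, s)\<close> in the direction \<open>- (a, b, c)\<close>, the coordinate that reaches zero first does so while the other
  two are still nonnegative.
\<close>

lemma ratio_test:
  fixes p q s a b c :: real
  assumes "0 \<le> p" "0 \<le> q" "0 \<le> s" and "0 < a \<or> 0 < b \<or> 0 < c"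
  shows "0 < a \<and> p / a * b \<le> q \<and> p / a * c \<le> s \<or>
         0 < b \<and> q / b * c \<le> s \<and> q / b * a \<le> p \<or>
         0 < c \<and> s / c * a \<le> p \<and> s / c * b \<le> q"
proof -
  have key: "r * y \<le> x" if "0 \<le> r" "0 \<le> x" "0 < y \<Longrightarrow> r \<le> x / y" for r x y :: real
  proof (cases "0 < y")
    case True
    then show ?thesis using that(3)[OF True] by (simp add: field_simps)
  next
    case False
    then have "r * y \<le> 0" using that(1) by (intro mult_nonneg_nonpos) auto
    then show ?thesis using that(2) by linarith
  qed
  define m where "m = Min ({p / a |_::unit. 0 < a} \<union> {q / b |_::unit. 0 < b} \<union> {s / c |_::unit. 0 < c})"
  let ?S = "{p / a |_::unit. 0 < a} \<union> {q / b |_::unit. 0 < b} \<union> {s / c |_::unit. 0 < c}"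
  have fin: "finite ?S" by simp
  have ne: "?S \<noteq> {}" using assms(4) by auto
  have le: "0 < a \<Longrightarrow> m \<le> p / a" "0 < b \<Longrightarrow> m \<le> q / b" "0 < c \<Longrightarrow> m \<le> s / c"
    unfolding m_def using fin by (auto intro!: Min_le)
  have "m \<in> ?S" unfolding m_def using fin ne by (rule Min_in)
  then consider "0 < a" "m = p / a" | "0 < b" "m = q / b" | "0 < c" "m = s / c" by auto
  then show ?thesis
  proof cases
    case 1
    then show ?thesis using key[of m q b] key[of m s c] le assms by auto
  next
    case 2
    then show ?thesis using key[of m s c] key[of m p a] le assms by auto
  next
    case 3
    then show ?thesis using key[of m p a] key[of m q b] le assms by auto
  qed
qed

lemma exchange_choice:
  assumes db: "dual_basis u v w \<alpha> \<beta> \<gamma>" and z: "0 \<le> \<alpha> z" "0 \<le> \<beta> z" "0 \<le> \<gamma> z"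
    and x: "0 < \<alpha> x \<or> 0 < \<beta> x \<or> 0 < \<gamma> x"
  obtains u' v' w' \<alpha>' \<beta>' \<gamma>' where "dual_basis u' v' w' \<alpha>' \<beta>' \<gamma>'"
    "(u', v', w', \<alpha>', \<beta>', \<gamma>') \<in> {(u, v, w, \<alpha>, \<beta>, \<gamma>), (v, w, u, \<beta>, \<gamma>, \<alpha>), (w, u, v, \<gamma>, \<alpha>, \<beta>)}"
    "0 < \<gamma>' x" "\<gamma>' z / \<gamma>' x * \<alpha>' x \<le> \<alpha>' z" "\<gamma>' z / \<gamma>' x * \<beta>' x \<le> \<beta>' z"
proof -
  note db' = dual_basis_rotate[OF db]
  note db'' = dual_basis_rotate[OF db']
  from ratio_test[OF z x] consider
    "0 < \<alpha> x" "\<alpha> z / \<alpha> x * \<beta> x \<le> \<beta> z" "\<alpha> z / \<alpha> x * \<gamma> x \<le> \<gamma> z"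
    | "0 < \<beta> x" "\<beta> z / \<beta> x * \<gamma> x \<le> \<gamma> z" "\<beta> z / \<beta> x * \<alpha> x \<le> \<alpha> z"
    | "0 < \<gamma> x" "\<gamma> z / \<gamma> x * \<alpha> x \<le> \<alpha> z" "\<gamma> z / \<gamma> x * \<beta> x \<le> \<beta> z" by blast
  then show thesis
  proof cases
    case 1 show thesis by (rule that[OF db']) (use 1 in auto)
  next
    case 2 show thesis by (rule that[OF db'']) (use 2 in auto)
  next
    case 3 show thesis by (rule that[OF db]) (use 3 in auto)
  qed
qed

definition indecomposable :: "'v::monoid_add set \<Rightarrow> 'v \<Rightarrow> bool"
  where "indecomposable M y \<longleftrightarrow> y \<in> M \<and> y \<noteq> 0 \<and> (\<forall>p\<in>M. \<forall>q\<in>M. y = p + q \<longrightarrow> p = 0 \<or> q = 0)"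

text \<open>
  For a basis in \<open>\<Lambda>\<close> this holds one representative of each class of \<open>\<Lambda>\<close> modulo the subgroup that the basis generates.
\<close>

definition fundamental_box :: "'v set \<Rightarrow> ('v \<Rightarrow> real) \<Rightarrow> ('v \<Rightarrow> real) \<Rightarrow> ('v \<Rightarrow> real) \<Rightarrow> 'v set"
  where "fundamental_box \<Lambda> \<alpha> \<beta> \<gamma> = {y \<in> \<Lambda>. 0 \<le> \<alpha> y \<and> \<alpha> y < 1 \<and> 0 \<le> \<beta> y \<and> \<beta> y < 1 \<and> 0 \<le> \<gamma> y \<and> \<gamma> y < 1}"

lemma box_rotate: "fundamental_box \<Lambda> \<beta> \<gamma> \<alpha> = fundamental_box \<Lambda> \<alpha> \<beta> \<gamma>"
  unfolding fundamental_box_def by auto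

lemma box_swap: "fundamental_box \<Lambda> \<beta> \<alpha> \<gamma> = fundamental_box \<Lambda> \<alpha> \<beta> \<gamma>"
  unfolding fundamental_box_def by auto

locale additive_subgroup =
  fixes \<Lambda> :: "'v::real_vector set"
  assumes zero_mem: "0 \<in> \<Lambda>" and diff_mem: "x \<in> \<Lambda> \<Longrightarrow> y \<in> \<Lambda> \<Longrightarrow> x - y \<in> \<Lambda>"
begin

lemma add_mem: "x \<in> \<Lambda> \<Longrightarrow> y \<in> \<Lambda> \<Longrightarrow> x + y \<in> \<Lambda>"
  using diff_mem[of x "0 - y"] diff_mem[of 0 y] zero_mem by simp

lemma scale_mem: "x \<in> \<Lambda> \<Longrightarrow> of_int k *\<^sub>R x \<in> \<Lambda>"
proof -
  assume x: "x \<in> \<Lambda>"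
  have "of_nat n *\<^sub>R x \<in> \<Lambda>" for n
    by (induction n) (auto simp: zero_mem scaleR_left_distrib intro: add_mem x)
  from this[of "nat k"] diff_mem[OF zero_mem this[of "nat (- k)"]]
  show ?thesis by (cases "0 \<le> k") auto
qed

lemma box_reduce:
  assumes db: "dual_basis u v w \<alpha> \<beta> \<gamma>" and mem: "u \<in> \<Lambda>" "v \<in> \<Lambda>" "w \<in> \<Lambda>" and y: "y \<in> \<Lambda>"
  obtains r where "r \<in> fundamental_box \<Lambda> \<alpha> \<beta> \<gamma>"
    "\<alpha> r = frac (\<alpha> y)" "\<beta> r = frac (\<beta> y)" "\<gamma> r = frac (\<gamma> y)"
    "y = of_int \<lfloor>\<alpha> y\<rfloor> *\<^sub>R u + of_int \<lfloor>\<beta> y\<rfloor> *\<^sub>R v + of_int \<lfloor>\<gamma> y\<rfloor> *\<^sub>R w + r"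
proof -
  define r where "r = y - (of_int \<lfloor>\<alpha> y\<rfloor> *\<^sub>R u + of_int \<lfloor>\<beta> y\<rfloor> *\<^sub>R v + of_int \<lfloor>\<gamma> y\<rfloor> *\<^sub>R w)"
  note lin = dual_basis_linear[OF db] and vals = dual_basis_values[OF db]
  have "\<alpha> r = frac (\<alpha> y)" "\<beta> r = frac (\<beta> y)" "\<gamma> r = frac (\<gamma> y)"
    unfolding r_def frac_def by (simp_all add: lin linear_diff linear_add linear_scale vals)
  moreover have "r \<in> \<Lambda>"
    unfolding r_def by (intro diff_mem add_mem scale_mem mem y)
  ultimately show thesis
    by (intro that[of r]) (auto simp: fundamental_box_def frac_ge_0 frac_lt_1 r_def)
qed

lemma box_zero_iff:
  assumes db: "dual_basis u v w \<alpha> \<beta> \<gamma>"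
  shows "y = 0 \<longleftrightarrow> \<alpha> y = 0 \<and> \<beta> y = 0 \<and> \<gamma> y = 0"
  using dual_basis_expand[OF db, of y] dual_basis_linear[OF db] by (auto simp: linear_0)

end

section \<open>A frame that supports the lattice points of a cone\<close>

text \<open>
  One step of Horner's scheme: for small \<open>x > 0\<close> the sign of \<open>c + x g x\<close> is that of \<open>c\<close>, unless \<open>c = 0\<close>, when it is
  that of \<open>g x\<close>. Applied three times it treats cubic polynomials.
\<close>

lemma eventually_horner:
  fixes g :: "real \<Rightarrow> real"
  assumes lim: "(g \<longlongrightarrow> l) (at_right 0)"
    and ne: "c \<noteq> 0 \<or> eventually (\<lambda>x. g x \<noteq> 0) (at_right 0)"
  shows "eventually (\<lambda>x. c + x * g x \<noteq> 0 \<and> (0 < c + x * g x \<longrightarrow> 0 \<le> c)) (at_right 0)"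
proof -
  have pos: "eventually (\<lambda>x::real. 0 < x) (at_right 0)" by (rule eventually_at_right_less)
  have "((\<lambda>x. c + x * g x) \<longlongrightarrow> c + 0 * l) (at_right 0)"
    by (intro tendsto_intros lim)
  then have t: "((\<lambda>x. c + x * g x) \<longlongrightarrow> c) (at_right 0)" by simp
  consider "c < 0" | "0 < c" | "c = 0" by linarith
  then show ?thesis
  proof cases
    case 1
    show ?thesis using order_tendstoD(2)[OF t 1] by eventually_elim auto
  next
    case 2
    show ?thesis using order_tendstoD(1)[OF t 2] by eventually_elim (use 2 in auto)
  next
    case 3
    then have "eventually (\<lambda>x. g x \<noteq> 0) (at_right 0)" using ne by simp
    then show ?thesis using pos by eventually_elim (use 3 in auto)
  qed
qed

locale lattice_cone = additive_subgroup \<Lambda> for \<Lambda> :: "'v::real_vector set" +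
  fixes e1 e2 e3 :: 'v and a1 a2 a3 :: "'v \<Rightarrow> real"
  assumes basis: "dual_basis e1 e2 e3 a1 a2 a3"
    and gens: "e1 \<in> \<Lambda>" "e2 \<in> \<Lambda>" "e3 \<in> \<Lambda>"
    and finite_box: "finite (fundamental_box \<Lambda> a1 a2 a3)"
begin

definition M :: "'v set"
  where "M = {y \<in> \<Lambda>. 0 \<le> a1 y \<and> 0 \<le> a2 y \<and> 0 \<le> a3 y}"

text \<open>
  Every point of the cone is a sum of multiples of the generators and one point of the fundamental box, so this finite set
  generates \<open>M\<close> and contains its indecomposable elements.
\<close>

definition H :: "'v set"
  where "H = {e1, e2, e3} \<union> (fundamental_box \<Lambda> a1 a2 a3 - {0})"

lemmas a_linear = dual_basis_linear[OF basis]
lemmas a_values = dual_basis_values[OF basis]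

lemma finite_H: "finite H"
  unfolding H_def using finite_box by simp

lemma gens_nonzero: "e1 \<noteq> 0" "e2 \<noteq> 0" "e3 \<noteq> 0"
  using box_zero_iff[OF basis] a_values by auto

lemma gens_M: "e1 \<in> M" "e2 \<in> M" "e3 \<in> M"
  unfolding M_def by (simp_all add: gens a_values)

lemma H_M: "y \<in> H \<Longrightarrow> y \<in> M \<and> y \<noteq> 0"
  unfolding H_def using gens_M gens_nonzero by (auto simp: M_def fundamental_box_def)

lemma M_I:
  assumes "dual_basis u v w \<alpha> \<beta> \<gamma>" "u \<in> M" "v \<in> M" "w \<in> M" "y \<in> \<Lambda>" "0 \<le> \<alpha> y" "0 \<le> \<beta> y" "0 \<le> \<gamma> y"
  shows "y \<in> M"
proof -
  have "0 \<le> a y" if "linear a" "0 \<le> a u" "0 \<le> a v" "0 \<le> a w" for a :: "'v \<Rightarrow> real"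
    unfolding linear_dual_basis[OF assms(1) that(1), of y] using assms that by simp
  then show ?thesis using assms a_linear unfolding M_def by auto
qed

lemma M_weight_pos:
  assumes "y \<in> M" "y \<noteq> 0"
  shows "0 < a1 y + a2 y + a3 y"
  using assms box_zero_iff[OF basis, of y] unfolding M_def by force

lemma M_induct_H:
  assumes d: "linear d" and H: "\<And>h. h \<in> H \<Longrightarrow> (1::real) \<le> d h" and y: "y \<in> M" "y \<noteq> 0"
  shows "1 \<le> d y"
proof -
  have yL: "y \<in> \<Lambda>" and nn: "0 \<le> a1 y" "0 \<le> a2 y" "0 \<le> a3 y" using y unfolding M_def by auto
  obtain r where r: "r \<in> fundamental_box \<Lambda> a1 a2 a3"
    "y = of_int \<lfloor>a1 y\<rfloor> *\<^sub>R e1 + of_int \<lfloor>a2 y\<rfloor> *\<^sub>R e2 + of_int \<lfloor>a3 y\<rfloor> *\<^sub>R e3 + r"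
    using box_reduce[OF basis gens yL] by metis
  have "d y = of_int \<lfloor>a1 y\<rfloor> * d e1 + of_int \<lfloor>a2 y\<rfloor> * d e2 + of_int \<lfloor>a3 y\<rfloor> * d e3 + d r"
    by (subst r(2)) (simp add: d linear_add linear_scale)
  moreover have e: "1 \<le> d e1" "1 \<le> d e2" "1 \<le> d e3" using H unfolding H_def by auto
  moreover have ge: "of_int k \<le> of_int k * d e" if "1 \<le> d e" "0 \<le> k" for k :: int and e
    using mult_left_mono[OF that(1), of "of_int k"] that(2) by simp
  moreover have "0 \<le> \<lfloor>a1 y\<rfloor>" "0 \<le> \<lfloor>a2 y\<rfloor>" "0 \<le> \<lfloor>a3 y\<rfloor>" using nn by auto
  ultimately have ge: "of_int \<lfloor>a1 y\<rfloor> + of_int \<lfloor>a2 y\<rfloor> + of_int \<lfloor>a3 y\<rfloor> + d r \<le> d y"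
    and fl: "0 \<le> \<lfloor>a1 y\<rfloor>" "0 \<le> \<lfloor>a2 y\<rfloor>" "0 \<le> \<lfloor>a3 y\<rfloor>"
    using ge[OF e(1), of "\<lfloor>a1 y\<rfloor>"] ge[OF e(2), of "\<lfloor>a2 y\<rfloor>"] ge[OF e(3), of "\<lfloor>a3 y\<rfloor>"] by linarith+
  then have ge: "of_int (\<lfloor>a1 y\<rfloor> + \<lfloor>a2 y\<rfloor> + \<lfloor>a3 y\<rfloor>) + d r \<le> d y" by simp
  show ?thesis
  proof (cases "r = 0")
    case True
    have "\<lfloor>a1 y\<rfloor> + \<lfloor>a2 y\<rfloor> + \<lfloor>a3 y\<rfloor> \<noteq> 0"
    proof
      assume "\<lfloor>a1 y\<rfloor> + \<lfloor>a2 y\<rfloor> + \<lfloor>a3 y\<rfloor> = 0"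
      then have "\<lfloor>a1 y\<rfloor> = 0" "\<lfloor>a2 y\<rfloor> = 0" "\<lfloor>a3 y\<rfloor> = 0" using fl by linarith+
      then show False using r(2) True y(2) by simp
    qed
    then have "1 \<le> \<lfloor>a1 y\<rfloor> + \<lfloor>a2 y\<rfloor> + \<lfloor>a3 y\<rfloor>" using fl by linarith
    then have "1 \<le> (of_int (\<lfloor>a1 y\<rfloor> + \<lfloor>a2 y\<rfloor> + \<lfloor>a3 y\<rfloor>) :: real)" by linarith
    then show ?thesis using ge True d by (simp add: linear_0)
  next
    case False
    then have "1 \<le> d r" using H r(1) unfolding H_def by auto
    moreover have "0 \<le> (of_int (\<lfloor>a1 y\<rfloor> + \<lfloor>a2 y\<rfloor> + \<lfloor>a3 y\<rfloor>) :: real)" using fl by linarith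
    ultimately show ?thesis using ge by linarith
  qed
qed

lemma indecomposable_in_H:
  assumes "indecomposable M y"
  shows "y \<in> H"
proof -
  have y: "y \<in> M" "y \<noteq> 0" using assms unfolding indecomposable_def by auto
  have sub: "y = e" if "e \<in> M" "e \<noteq> 0" "y - e \<in> M" for e
  proof -
    have "y = e + (y - e)" by simp
    then have "y - e = 0" using assms that unfolding indecomposable_def by blast
    then show ?thesis by simp
  qed
  have "y = e1" if "1 \<le> a1 y"
    using that y gens_nonzero gens_M by (intro sub) (auto simp: M_def diff_mem a_linear linear_diff a_values)
  moreover have "y = e2" if "1 \<le> a2 y"
    using that y gens_nonzero gens_M by (intro sub) (auto simp: M_def diff_mem a_linear linear_diff a_values)
  moreover have "y = e3" if "1 \<le> a3 y"
    using that y gens_nonzero gens_M by (intro sub) (auto simp: M_def diff_mem a_linear linear_diff a_values)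
  ultimately show ?thesis using y unfolding H_def by (force simp: M_def fundamental_box_def)
qed

lemma generic_perturbation:
  obtains z' where "\<And>u v w \<alpha> \<beta> \<gamma>. u \<in> H \<Longrightarrow> v \<in> H \<Longrightarrow> w \<in> H \<Longrightarrow> dual_basis u v w \<alpha> \<beta> \<gamma> \<Longrightarrow>
      \<alpha> z' \<noteq> 0 \<and> (0 < \<alpha> z' \<longrightarrow> 0 \<le> \<alpha> z)"
    "a1 z < a1 z'" "a2 z < a2 z'" "a3 z < a3 z'"
proof -
  \<comment> \<open>A functional that vanishes on \<open>e1\<close>, \<open>e2\<close> and \<open>e3\<close> is zero, so no coordinate functional is identically zero along this
    curve.\<close>
  define P where "P t = z + t *\<^sub>R (e1 + t *\<^sub>R (e2 + t *\<^sub>R e3))" for t :: real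
  have P: "\<alpha> (P t) = \<alpha> z + t * (\<alpha> e1 + t * (\<alpha> e2 + t * \<alpha> e3))" if "linear \<alpha>" for \<alpha> :: "'v \<Rightarrow> real" and t
    unfolding P_def using that by (simp add: linear_add linear_scale)
  have triple: "eventually (\<lambda>t. \<forall>\<alpha> \<beta> \<gamma>. dual_basis (fst T) (fst (snd T)) (snd (snd T)) \<alpha> \<beta> \<gamma> \<longrightarrow>
      \<alpha> (P t) \<noteq> 0 \<and> (0 < \<alpha> (P t) \<longrightarrow> 0 \<le> \<alpha> z)) (at_right 0)" for T
  proof (cases "\<exists>\<alpha> \<beta> \<gamma>. dual_basis (fst T) (fst (snd T)) (snd (snd T)) \<alpha> \<beta> \<gamma>")
    case True
    then obtain \<alpha> \<beta> \<gamma> where db: "dual_basis (fst T) (fst (snd T)) (snd (snd T)) \<alpha> \<beta> \<gamma>" by auto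
    have "linear \<alpha>" using dual_basis_linear[OF db] by simp
    have "\<alpha> e1 \<noteq> 0 \<or> \<alpha> e2 \<noteq> 0 \<or> \<alpha> e3 \<noteq> 0"
      using linear_dual_basis[OF basis \<open>linear \<alpha>\<close>, of "fst T"] dual_basis_values(1)[OF db] by auto
    then have e12: "\<alpha> e1 \<noteq> 0 \<or> eventually (\<lambda>t. \<alpha> e2 + t * \<alpha> e3 \<noteq> 0) (at_right 0)"
      using eventually_horner[OF tendsto_const, of "\<alpha> e2" "\<alpha> e3"] by (auto elim: eventually_mono)
    have "eventually (\<lambda>t. \<alpha> e1 + t * (\<alpha> e2 + t * \<alpha> e3) \<noteq> 0) (at_right 0)"
      by (rule eventually_mono[OF eventually_horner[OF _ e12, of "\<alpha> e2 + 0 * \<alpha> e3"]])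
        (intro tendsto_intros, simp)
    then have "eventually (\<lambda>t. \<alpha> z + t * (\<alpha> e1 + t * (\<alpha> e2 + t * \<alpha> e3)) \<noteq> 0 \<and>
        (0 < \<alpha> z + t * (\<alpha> e1 + t * (\<alpha> e2 + t * \<alpha> e3)) \<longrightarrow> 0 \<le> \<alpha> z)) (at_right 0)"
      by (intro eventually_horner[where l = "\<alpha> e1 + 0 * (\<alpha> e2 + 0 * \<alpha> e3)"] disjI2)
        (intro tendsto_intros)
    then show ?thesis
    proof eventually_elim
      case (elim t)
      then show ?case using dual_basis_unique[OF db] P[OF \<open>linear \<alpha>\<close>, of t] by auto
    qed
  next
    case False
    then show ?thesis by simp
  qed
  have "eventually (\<lambda>t. \<forall>T\<in>H \<times> H \<times> H. \<forall>\<alpha> \<beta> \<gamma>. dual_basis (fst T) (fst (snd T)) (snd (snd T)) \<alpha> \<beta> \<gamma> \<longrightarrow>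
      \<alpha> (P t) \<noteq> 0 \<and> (0 < \<alpha> (P t) \<longrightarrow> 0 \<le> \<alpha> z)) (at_right 0)"
    by (intro eventually_ball_finite finite_cartesian_product finite_H ballI triple)
  moreover have "eventually (\<lambda>t::real. 0 < t) (at_right 0)" by (rule eventually_at_right_less)
  ultimately have "eventually (\<lambda>t. 0 < t \<and> (\<forall>T\<in>H \<times> H \<times> H. \<forall>\<alpha> \<beta> \<gamma>.
      dual_basis (fst T) (fst (snd T)) (snd (snd T)) \<alpha> \<beta> \<gamma> \<longrightarrow>
      \<alpha> (P t) \<noteq> 0 \<and> (0 < \<alpha> (P t) \<longrightarrow> 0 \<le> \<alpha> z))) (at_right 0)"
    by eventually_elim blast
  then obtain t where "0 < t" and t: "\<forall>T\<in>H \<times> H \<times> H. \<forall>\<alpha> \<beta> \<gamma>.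
      dual_basis (fst T) (fst (snd T)) (snd (snd T)) \<alpha> \<beta> \<gamma> \<longrightarrow>
      \<alpha> (P t) \<noteq> 0 \<and> (0 < \<alpha> (P t) \<longrightarrow> 0 \<le> \<alpha> z)"
    using eventually_happens'[OF trivial_limit_at_right_real] by blast
  show thesis
  proof (rule that[of "P t"])
    fix u v w \<alpha> \<beta> \<gamma> assume "u \<in> H" "v \<in> H" "w \<in> H" "dual_basis u v w \<alpha> \<beta> \<gamma>"
    then show "\<alpha> (P t) \<noteq> 0 \<and> (0 < \<alpha> (P t) \<longrightarrow> 0 \<le> \<alpha> z)"
      using t[rule_format, of "(u, v, w)" \<alpha> \<beta> \<gamma>] by auto
  qed (use \<open>0 < t\<close> in \<open>auto simp: P a_linear a_values\<close>)
qed

text \<open>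
  The plane through \<open>u, v, w\<close>, where the coordinates add up to 1, bounds all non-zero points of \<open>M\<close> from below, and the
  triangle with these vertices contains no further point of \<open>M\<close>.
\<close>

definition supporting :: "'v \<Rightarrow> 'v \<Rightarrow> 'v \<Rightarrow> ('v \<Rightarrow> real) \<Rightarrow> ('v \<Rightarrow> real) \<Rightarrow> ('v \<Rightarrow> real) \<Rightarrow> bool"
  where "supporting u v w \<alpha> \<beta> \<gamma> \<longleftrightarrow> dual_basis u v w \<alpha> \<beta> \<gamma> \<and> u \<in> M \<and> v \<in> M \<and> w \<in> M
    \<and> (\<forall>y\<in>M - {0}. 1 \<le> \<alpha> y + \<beta> y + \<gamma> y)
    \<and> (\<forall>y\<in>M. 0 \<le> \<alpha> y \<longrightarrow> 0 \<le> \<beta> y \<longrightarrow> 0 \<le> \<gamma> y \<longrightarrow> \<alpha> y + \<beta> y + \<gamma> y = 1 \<longrightarrow> y \<in> {u, v, w})"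

text \<open>
  Each of two non-zero summands would contribute at least 1 to the sum of the coordinates.
\<close>

lemma indecomposable_supporting:
  assumes db: "dual_basis u v w \<alpha> \<beta> \<gamma>" and ge: "\<forall>y\<in>M - {0}. 1 \<le> \<alpha> y + \<beta> y + \<gamma> y"
    and y: "y \<in> M" "y \<noteq> 0" "\<alpha> y + \<beta> y + \<gamma> y < 2"
  shows "indecomposable M y"
  unfolding indecomposable_def
proof (intro conjI ballI impI y, rule ccontr)
  fix p q assume "p \<in> M" "q \<in> M" "y = p + q" "\<not> (p = 0 \<or> q = 0)"
  moreover from this have "1 \<le> \<alpha> p + \<beta> p + \<gamma> p" "1 \<le> \<alpha> q + \<beta> q + \<gamma> q" using ge by auto
  ultimately show False using y dual_basis_linear[OF db] by (simp add: linear_add)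
qed

text \<open>
  Replace \<open>z\<close> by a nearby point in general position. Among the bases from \<open>H\<close> whose cone contains that point choose one that
  maximises the sum of its coordinates and, second, has the fewest points of \<open>H\<close> in its cone. Exchanging some
  \<open>x \<in> H\<close> into the basis changes the sum by a positive multiple of \<open>1 - (\<alpha> x + \<beta> x + \<gamma> x)\<close>. So no \<open>x\<close> lies below the
  plane; and if \<open>x\<close> lies in the triangle, the exchange keeps the sum but shrinks the cone.
\<close>

lemma supporting_frame:
  assumes z: "z \<in> M"
  obtains u v w \<alpha> \<beta> \<gamma> where "supporting u v w \<alpha> \<beta> \<gamma>" "0 \<le> \<alpha> z" "0 \<le> \<beta> z" "0 \<le> \<gamma> z"
proof -
  obtain z' where gen: "\<And>u v w \<alpha> \<beta> \<gamma>. u \<in> H \<Longrightarrow> v \<in> H \<Longrightarrow> w \<in> H \<Longrightarrow> dual_basis u v w \<alpha> \<beta> \<gamma> \<Longrightarrow>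
      \<alpha> z' \<noteq> 0 \<and> (0 < \<alpha> z' \<longrightarrow> 0 \<le> \<alpha> z)"
    and z': "a1 z < a1 z'" "a2 z < a2 z'" "a3 z < a3 z'"
    using generic_perturbation[of z] by metis
  have gen3: "\<alpha> z' \<noteq> 0 \<and> \<beta> z' \<noteq> 0 \<and> \<gamma> z' \<noteq> 0"
    "0 < \<alpha> z' \<longrightarrow> 0 \<le> \<alpha> z" "0 < \<beta> z' \<longrightarrow> 0 \<le> \<beta> z" "0 < \<gamma> z' \<longrightarrow> 0 \<le> \<gamma> z"
    if "u \<in> H" "v \<in> H" "w \<in> H" "dual_basis u v w \<alpha> \<beta> \<gamma>" for u v w \<alpha> \<beta> \<gamma>
    using gen[OF that] gen[OF that(2,3,1) dual_basis_rotate[OF that(4)]]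
      gen[OF that(3,1,2) dual_basis_rotate[OF dual_basis_rotate[OF that(4)]]] by auto
  define K where "K = {(u, v, w, \<alpha>, \<beta>, \<gamma>). u \<in> H \<and> v \<in> H \<and> w \<in> H \<and> dual_basis u v w \<alpha> \<beta> \<gamma> \<and>
    0 < \<alpha> z' \<and> 0 < \<beta> z' \<and> 0 < \<gamma> z'}"
  define deg where "deg = (\<lambda>(u::'v, v::'v, w::'v, \<alpha>, \<beta>, \<gamma>). \<alpha> z' + \<beta> z' + \<gamma> z' :: real)"
  define cnt where "cnt = (\<lambda>(u::'v, v::'v, w::'v, \<alpha>, \<beta>, \<gamma>).
    card {h \<in> H. (0::real) \<le> \<alpha> h \<and> (0::real) \<le> \<beta> h \<and> (0::real) \<le> \<gamma> h})"
  have "finite K"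
  proof (rule finite_imageD)
    show "finite ((\<lambda>(u, v, w, \<alpha>, \<beta>, \<gamma>). (u, v, w)) ` K)"
      by (rule finite_subset[of _ "H \<times> H \<times> H"]) (auto simp: K_def finite_H)
    show "inj_on (\<lambda>(u, v, w, \<alpha>, \<beta>, \<gamma>). (u, v, w)) K"
      by (auto simp: inj_on_def K_def dest: dual_basis_unique)
  qed
  moreover have "(e1, e2, e3, a1, a2, a3) \<in> K"
    using z z' unfolding K_def M_def H_def by (simp add: basis)
  ultimately have fin: "finite (deg ` K)" "deg ` K \<noteq> {}" by auto
  obtain F0 where "F0 \<in> K" "deg F0 = Max (deg ` K)" using Max_in[OF fin] by force
  then have F0: "F0 \<in> K" "\<And>G. G \<in> K \<Longrightarrow> deg G \<le> deg F0" using Max_ge[OF fin(1)] by simp_all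
  obtain F where F: "F \<in> K \<and> deg F = deg F0" "\<And>G. G \<in> K \<and> deg G = deg F0 \<Longrightarrow> cnt F \<le> cnt G"
    using ex_has_least_nat[of "\<lambda>F. F \<in> K \<and> deg F = deg F0" F0 cnt] F0(1) by auto
  have max: "deg G < deg F \<or> deg G = deg F \<and> cnt F \<le> cnt G" if "G \<in> K" for G
  proof (cases "deg G = deg F0")
    case True
    then show ?thesis using F(1) F(2)[of G] that by simp
  next
    case False
    then show ?thesis using F(1) F0(2)[OF that] by simp
  qed
  obtain u v w \<alpha> \<beta> \<gamma> where Fe: "F = (u, v, w, \<alpha>, \<beta>, \<gamma>)" by (cases F) auto
  then have H: "u \<in> H" "v \<in> H" "w \<in> H" and db: "dual_basis u v w \<alpha> \<beta> \<gamma>"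
    and pos: "0 < \<alpha> z'" "0 < \<beta> z'" "0 < \<gamma> z'"
    using F(1) unfolding K_def by auto
  have exchange: "1 \<le> \<alpha> x + \<beta> x + \<gamma> x \<and> (\<alpha> x + \<beta> x + \<gamma> x = 1 \<longrightarrow> 0 \<le> \<alpha> x \<longrightarrow> 0 \<le> \<beta> x \<longrightarrow> 0 \<le> \<gamma> x \<longrightarrow> x \<in> {u, v, w})"
    if x: "x \<in> H" for x
  proof -
    have "0 < \<alpha> x \<or> 0 < \<beta> x \<or> 0 < \<gamma> x"
    proof (rule ccontr)
      assume "\<not> ?thesis"
      then have neg: "\<alpha> x \<le> 0" "\<beta> x \<le> 0" "\<gamma> x \<le> 0" by auto
      have "a x \<le> 0" if "linear a" "0 \<le> a u" "0 \<le> a v" "0 \<le> a w" for a :: "'v \<Rightarrow> real"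
        unfolding linear_dual_basis[OF db that(1), of x]
        using neg that by (auto intro!: add_nonpos_nonpos mult_nonpos_nonneg)
      then have "a1 x \<le> 0" "a2 x \<le> 0" "a3 x \<le> 0"
        using H[THEN H_M] a_linear unfolding M_def by auto
      then show False using M_weight_pos H_M[OF x] by fastforce
    qed
    from exchange_choice[OF db less_imp_le[OF pos(1)] less_imp_le[OF pos(2)] less_imp_le[OF pos(3)] this]
    obtain u' v' w' \<alpha>' \<beta>' \<gamma>' where db': "dual_basis u' v' w' \<alpha>' \<beta>' \<gamma>'"
      and rot: "(u', v', w', \<alpha>', \<beta>', \<gamma>') \<in> {(u, v, w, \<alpha>, \<beta>, \<gamma>), (v, w, u, \<beta>, \<gamma>, \<alpha>), (w, u, v, \<gamma>, \<alpha>, \<beta>)}"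
      and ex: "0 < \<gamma>' x" "\<gamma>' z' / \<gamma>' x * \<alpha>' x \<le> \<alpha>' z'" "\<gamma>' z' / \<gamma>' x * \<beta>' x \<le> \<beta>' z'" by metis
    have H': "u' \<in> H" "v' \<in> H" "w' \<in> H" and pos': "0 < \<gamma>' z'" using rot H pos by auto
    define \<alpha>'' \<beta>'' \<gamma>'' where "\<alpha>'' = (\<lambda>y. \<alpha>' y - \<gamma>' y / \<gamma>' x * \<alpha>' x)"
      and "\<beta>'' = (\<lambda>y. \<beta>' y - \<gamma>' y / \<gamma>' x * \<beta>' x)" and "\<gamma>'' = (\<lambda>y. \<gamma>' y / \<gamma>' x)"
    have db'': "dual_basis u' v' x \<alpha>'' \<beta>'' \<gamma>''"
      unfolding \<alpha>''_def \<beta>''_def \<gamma>''_def using dual_basis_exchange[OF db'] ex(1) by simp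
    have G: "(u', v', x, \<alpha>'', \<beta>'', \<gamma>'') \<in> K"
      using gen3(1)[OF H'(1,2) x db''] H' x db'' ex pos'
      unfolding K_def by (auto simp: \<alpha>''_def \<beta>''_def \<gamma>''_def)
    have sum: "\<alpha> y + \<beta> y + \<gamma> y = \<alpha>' y + \<beta>' y + \<gamma>' y" for y using rot by auto
    have degG: "deg (u', v', x, \<alpha>'', \<beta>'', \<gamma>'') = deg F + \<gamma>'' z' * (1 - (\<alpha> x + \<beta> x + \<gamma> x))"
    proof -
      define \<theta> where "\<theta> = \<gamma>' z' / \<gamma>' x"
      have "\<theta> * \<gamma>' x = \<gamma>' z'" using ex(1) unfolding \<theta>_def by simp
      moreover have "deg F = \<alpha>' z' + \<beta>' z' + \<gamma>' z'" unfolding deg_def Fe using sum[of z'] by simp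
      moreover have "deg (u', v', x, \<alpha>'', \<beta>'', \<gamma>'') = \<alpha>' z' - \<theta> * \<alpha>' x + (\<beta>' z' - \<theta> * \<beta>' x) + \<theta>"
        unfolding deg_def \<alpha>''_def \<beta>''_def \<gamma>''_def \<theta>_def by simp
      moreover have "\<gamma>'' z' = \<theta>" unfolding \<gamma>''_def \<theta>_def by simp
      ultimately show ?thesis unfolding sum by (simp add: algebra_simps)
    qed
    have "0 < \<gamma>'' z'" unfolding \<gamma>''_def using ex pos' by simp
    have le: "deg (u', v', x, \<alpha>'', \<beta>'', \<gamma>'') \<le> deg F" using max[OF G] by auto
    have "1 \<le> \<alpha> x + \<beta> x + \<gamma> x"
    proof (rule ccontr)
      assume "\<not> ?thesis"
      then have "0 < \<gamma>'' z' * (1 - (\<alpha> x + \<beta> x + \<gamma> x))" using \<open>0 < \<gamma>'' z'\<close> by simp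
      then show False using le degG by linarith
    qed
    moreover have "x \<in> {u, v, w}" if one: "\<alpha> x + \<beta> x + \<gamma> x = 1" and nn: "0 \<le> \<alpha> x" "0 \<le> \<beta> x" "0 \<le> \<gamma> x"
    proof -
      have nn': "0 \<le> \<alpha>' x" "0 \<le> \<beta>' x" using rot nn by auto
      have "cnt F \<le> cnt (u', v', x, \<alpha>'', \<beta>'', \<gamma>'')" using max[OF G] degG one by auto
      moreover have "cnt F = card {h \<in> H. 0 \<le> \<alpha>' h \<and> 0 \<le> \<beta>' h \<and> 0 \<le> \<gamma>' h}"
        unfolding cnt_def Fe using rot by (auto intro!: arg_cong[where f = card])
      ultimately have card: "card {h \<in> H. 0 \<le> \<alpha>' h \<and> 0 \<le> \<beta>' h \<and> 0 \<le> \<gamma>' h}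
        \<le> card {h \<in> H. 0 \<le> \<alpha>'' h \<and> 0 \<le> \<beta>'' h \<and> 0 \<le> \<gamma>'' h}" unfolding cnt_def by simp
      have sub: "{h \<in> H. 0 \<le> \<alpha>'' h \<and> 0 \<le> \<beta>'' h \<and> 0 \<le> \<gamma>'' h} \<subseteq> {h \<in> H. 0 \<le> \<alpha>' h \<and> 0 \<le> \<beta>' h \<and> 0 \<le> \<gamma>' h}"
      proof
        fix h assume h: "h \<in> {h \<in> H. 0 \<le> \<alpha>'' h \<and> 0 \<le> \<beta>'' h \<and> 0 \<le> \<gamma>'' h}"
        then have "0 \<le> \<gamma>'' h" by simp
        then have "0 \<le> \<gamma>'' h * \<alpha>' x" "0 \<le> \<gamma>'' h * \<beta>' x" "0 \<le> \<gamma>' h"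
          using nn' ex(1) by (auto simp: \<gamma>''_def zero_le_divide_iff)
        then show "h \<in> {h \<in> H. 0 \<le> \<alpha>' h \<and> 0 \<le> \<beta>' h \<and> 0 \<le> \<gamma>' h}"
          using h unfolding \<alpha>''_def \<beta>''_def \<gamma>''_def by auto
      qed
      \<comment> \<open>The cone of the new basis would contain the old vertex \<open>w'\<close>, which forces \<open>x = w'\<close>.\<close>
      have "w' \<in> {h \<in> H. 0 \<le> \<alpha>'' h \<and> 0 \<le> \<beta>'' h \<and> 0 \<le> \<gamma>'' h}"
      proof -
        have "finite {h \<in> H. 0 \<le> \<alpha>' h \<and> 0 \<le> \<beta>' h \<and> 0 \<le> \<gamma>' h}" using finite_H by simp
        from card_seteq[OF this sub card] show ?thesis using H' dual_basis_values[OF db'] by simp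
      qed
      then have "\<alpha>' x \<le> 0" "\<beta>' x \<le> 0"
        using ex(1) dual_basis_values[OF db'] unfolding \<alpha>''_def \<beta>''_def by (auto simp: divide_le_0_iff)
      then have "\<alpha>' x = 0" "\<beta>' x = 0" "\<gamma>' x = 1" using nn' one sum[of x] by auto
      then have "x = w'" using dual_basis_expand[OF db', of x] by simp
      then show ?thesis using rot by auto
    qed
    ultimately show ?thesis by blast
  qed
  have lin: "linear (\<lambda>y. \<alpha> y + \<beta> y + \<gamma> y)"
    using dual_basis_linear[OF db] by (intro linearI) (simp_all add: linear_add linear_scale distrib_left)
  have ge: "\<forall>y\<in>M - {0}. 1 \<le> \<alpha> y + \<beta> y + \<gamma> y"
    using M_induct_H[OF lin] exchange by auto
  have "supporting u v w \<alpha> \<beta> \<gamma>"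
    unfolding supporting_def
  proof (intro conjI db ge ballI impI)
    show "u \<in> M" "v \<in> M" "w \<in> M" using H H_M by auto
    fix y assume y: "y \<in> M" "0 \<le> \<alpha> y" "0 \<le> \<beta> y" "0 \<le> \<gamma> y" "\<alpha> y + \<beta> y + \<gamma> y = 1"
    have "y \<noteq> 0" using y(5) dual_basis_linear[OF db] by (auto simp: linear_0)
    then have "y \<in> H" using indecomposable_in_H indecomposable_supporting[OF db ge y(1)] y(5) by simp
    then show "y \<in> {u, v, w}" using exchange y by blast
  qed
  then show thesis using that gen3[OF H db] pos by blast
qed

end

section \<open>White's theorem on empty simplices\<close>

lemma finite_min_element:
  fixes f :: "'a \<Rightarrow> real"
  assumes "finite A" "A \<noteq> {}"
  shows "\<exists>x\<in>A. \<forall>y\<in>A. f x \<le> f y"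
proof -
  have "Min (f ` A) \<in> f ` A" using assms by simp
  then obtain x where "x \<in> A" "f x = Min (f ` A)" by auto
  then show ?thesis using assms by (intro bexI[of _ x]) simp_all
qed

context lattice_cone
begin

lemma supporting_rotate: "supporting u v w \<alpha> \<beta> \<gamma> \<Longrightarrow> supporting v w u \<beta> \<gamma> \<alpha>"
  unfolding supporting_def using dual_basis_rotate by (auto simp: algebra_simps)

lemma supporting_mem:
  assumes "supporting u v w \<alpha> \<beta> \<gamma>"
  shows "u \<in> \<Lambda>" "v \<in> \<Lambda>" "w \<in> \<Lambda>"
  using assms unfolding supporting_def M_def by auto

lemma supporting_box_M:
  assumes "supporting u v w \<alpha> \<beta> \<gamma>" "y \<in> fundamental_box \<Lambda> \<alpha> \<beta> \<gamma>"
  shows "y \<in> M"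
  using M_I[of u v w \<alpha> \<beta> \<gamma> y] assms unfolding supporting_def fundamental_box_def by auto

lemma supporting_box_gt1:
  assumes S: "supporting u v w \<alpha> \<beta> \<gamma>" and y: "y \<in> fundamental_box \<Lambda> \<alpha> \<beta> \<gamma>" "y \<noteq> 0"
  shows "1 < \<alpha> y + \<beta> y + \<gamma> y"
proof -
  have db: "dual_basis u v w \<alpha> \<beta> \<gamma>" using S unfolding supporting_def by simp
  have "1 \<le> \<alpha> y + \<beta> y + \<gamma> y" using S supporting_box_M[OF S y(1)] y(2) unfolding supporting_def by simp
  moreover have "y \<notin> {u, v, w}" using y(1) dual_basis_values[OF db] unfolding fundamental_box_def by auto
  then have "\<alpha> y + \<beta> y + \<gamma> y \<noteq> 1"
    using S supporting_box_M[OF S y(1)] y(1) unfolding supporting_def fundamental_box_def by auto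
  ultimately show ?thesis by linarith
qed

text \<open>
  If \<open>\<gamma> y = 0\<close>, then \<open>y\<close> and its mirror image \<open>u + v - y\<close> both have coordinate sum above 1, but the two sums add up
  to 2.
\<close>

lemma supporting_box_pos:
  assumes S: "supporting u v w \<alpha> \<beta> \<gamma>" and y: "y \<in> fundamental_box \<Lambda> \<alpha> \<beta> \<gamma>" "y \<noteq> 0"
  shows "0 < \<gamma> y"
proof (rule ccontr)
  assume "\<not> 0 < \<gamma> y"
  then have c: "\<gamma> y = 0" using y unfolding fundamental_box_def by auto
  have db: "dual_basis u v w \<alpha> \<beta> \<gamma>" using S unfolding supporting_def by simp
  note lin = dual_basis_linear[OF db] and vals = dual_basis_values[OF db]
  have gt: "1 < \<alpha> y + \<beta> y" using supporting_box_gt1[OF S y] c by simp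
  have y': "\<alpha> (u + v - y) = 1 - \<alpha> y" "\<beta> (u + v - y) = 1 - \<beta> y" "\<gamma> (u + v - y) = 0"
    by (simp_all add: lin linear_add linear_diff vals c)
  have "u + v - y \<in> fundamental_box \<Lambda> \<alpha> \<beta> \<gamma>"
    using y(1) gt supporting_mem[OF S] unfolding fundamental_box_def mem_Collect_eq y'
    by (auto intro!: diff_mem add_mem)
  moreover have "u + v - y \<noteq> 0" using y' y(1) lin(1) unfolding fundamental_box_def by (auto simp: linear_0)
  ultimately show False using supporting_box_gt1[OF S, of "u + v - y"] gt y' by simp
qed

text \<open>
  The upper bound 2 comes from the mirror image \<open>u + v + w - y\<close>, whose coordinate sum is \<open>3 - (\<alpha> y + \<beta> y + \<gamma> y)\<close> and exceeds 1.
\<close>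

lemma supporting_box:
  assumes S: "supporting u v w \<alpha> \<beta> \<gamma>" and y: "y \<in> fundamental_box \<Lambda> \<alpha> \<beta> \<gamma>" "y \<noteq> 0"
  shows "0 < \<alpha> y" "0 < \<beta> y" "0 < \<gamma> y" "1 < \<alpha> y + \<beta> y + \<gamma> y" "\<alpha> y + \<beta> y + \<gamma> y < 2"
proof -
  have db: "dual_basis u v w \<alpha> \<beta> \<gamma>" using S unfolding supporting_def by simp
  note lin = dual_basis_linear[OF db] and vals = dual_basis_values[OF db]
  show pos: "0 < \<alpha> y" "0 < \<beta> y" "0 < \<gamma> y"
    using supporting_box_pos[OF supporting_rotate[OF S], of y] supporting_box_pos[OF S y]
      supporting_box_pos[OF supporting_rotate[OF supporting_rotate[OF S]], of y] y
    by (simp_all add: box_rotate[of \<Lambda> \<beta> \<gamma> \<alpha>] box_rotate[of \<Lambda> \<gamma> \<alpha> \<beta>])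
  show "1 < \<alpha> y + \<beta> y + \<gamma> y" by (rule supporting_box_gt1[OF S y])
  have y': "\<alpha> (u + v + w - y) = 1 - \<alpha> y" "\<beta> (u + v + w - y) = 1 - \<beta> y" "\<gamma> (u + v + w - y) = 1 - \<gamma> y"
    by (simp_all add: lin linear_add linear_diff vals)
  have "u + v + w - y \<in> fundamental_box \<Lambda> \<alpha> \<beta> \<gamma>"
    using y(1) pos supporting_mem[OF S] unfolding fundamental_box_def mem_Collect_eq y'
    by (auto intro!: diff_mem add_mem)
  moreover have "u + v + w - y \<noteq> 0" using y' y(1) lin(1) unfolding fundamental_box_def by (auto simp: linear_0)
  ultimately show "\<alpha> y + \<beta> y + \<gamma> y < 2" using supporting_box_gt1[OF S, of "u + v + w - y"] y' by simp
qed

lemma supporting_box_indecomposable: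
  assumes S: "supporting u v w \<alpha> \<beta> \<gamma>" and y: "y \<in> fundamental_box \<Lambda> \<alpha> \<beta> \<gamma>" "y \<noteq> 0"
  shows "indecomposable M y"
  using indecomposable_supporting[of u v w \<alpha> \<beta> \<gamma> y] supporting_box[OF S y] supporting_box_M[OF S y(1)] S y(2)
  unfolding supporting_def by blast

lemma supporting_vertex_indecomposable:
  assumes S: "supporting u v w \<alpha> \<beta> \<gamma>" and y: "y \<in> {u, v, w}"
  shows "indecomposable M y"
proof -
  have db: "dual_basis u v w \<alpha> \<beta> \<gamma>" using S unfolding supporting_def by simp
  have one: "\<alpha> y + \<beta> y + \<gamma> y = 1" using y dual_basis_values[OF db] by auto
  then have "y \<noteq> 0" using dual_basis_linear[OF db] by (auto simp: linear_0)
  then show ?thesis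
    using indecomposable_supporting[OF db, of y] S y one unfolding supporting_def by auto
qed

lemma finite_supporting_box:
  assumes S: "supporting u v w \<alpha> \<beta> \<gamma>"
  shows "finite (fundamental_box \<Lambda> \<alpha> \<beta> \<gamma>)"
proof -
  have "fundamental_box \<Lambda> \<alpha> \<beta> \<gamma> \<subseteq> insert 0 H"
    using supporting_box_indecomposable[OF S] indecomposable_in_H by blast
  then show ?thesis using finite_H finite_subset by blast
qed

text \<open>
  All box points are multiples, modulo the basis, of the one with the least first coordinate, because a box point with a smaller first
  coordinate must be zero. That coordinate is \<open>1 / q\<close>, the others are fractions with denominator \<open>q\<close>, and the bounds of
  \<open>supporting_box\<close> for its multiples are the hypotheses of \<open>white_arithmetic\<close>.
\<close>

theorem white_width_one:
  assumes S: "supporting u v w \<alpha> \<beta> \<gamma>"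
  shows "(\<forall>y\<in>fundamental_box \<Lambda> \<alpha> \<beta> \<gamma> - {0}. \<alpha> y + \<beta> y = 1) \<or> (\<forall>y\<in>fundamental_box \<Lambda> \<alpha> \<beta> \<gamma> - {0}. \<beta> y + \<gamma> y = 1)
    \<or> (\<forall>y\<in>fundamental_box \<Lambda> \<alpha> \<beta> \<gamma> - {0}. \<gamma> y + \<alpha> y = 1)"
proof (cases "fundamental_box \<Lambda> \<alpha> \<beta> \<gamma> - {0} = {}")
  case False
  have db: "dual_basis u v w \<alpha> \<beta> \<gamma>" using S unfolding supporting_def by simp
  note lin = dual_basis_linear[OF db] and vals = dual_basis_values[OF db]
  have "finite (fundamental_box \<Lambda> \<alpha> \<beta> \<gamma> - {0})" using finite_supporting_box[OF S] by simp
  from finite_min_element[OF this False, of \<alpha>] obtain x where x: "x \<in> fundamental_box \<Lambda> \<alpha> \<beta> \<gamma>" "x \<noteq> 0"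
    and least: "\<And>y. y \<in> fundamental_box \<Lambda> \<alpha> \<beta> \<gamma> \<Longrightarrow> y \<noteq> 0 \<Longrightarrow> \<alpha> x \<le> \<alpha> y" by auto
  define g where "g = \<alpha> x"
  have g: "0 < g" "g < 1" using supporting_box[OF S x] x(1) unfolding g_def fundamental_box_def by auto
  have xL: "x \<in> \<Lambda>" using x(1) unfolding fundamental_box_def by simp
  \<comment> \<open>The multiple \<open>q x\<close> has first coordinate in \<open>[1, 1 + g)\<close>, hence reduces to a point with first coordinate below
    \<open>g\<close>, hence to zero. So \<open>q g = 1\<close>.\<close>
  define q where "q = \<lceil>1 / g\<rceil>"
  have "of_int q - 1 < 1 / g" "1 / g \<le> of_int q" unfolding q_def by linarith+
  then have qg: "(of_int q - 1) * g < 1" "1 \<le> of_int q * g" using g by (simp_all add: field_simps)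
  have small_zero: "frac (\<alpha> y) = 0 \<and> frac (\<beta> y) = 0 \<and> frac (\<gamma> y) = 0" if yL: "y \<in> \<Lambda>" and yg: "frac (\<alpha> y) < g" for y
  proof -
    obtain r where r: "r \<in> fundamental_box \<Lambda> \<alpha> \<beta> \<gamma>" "\<alpha> r = frac (\<alpha> y)" "\<beta> r = frac (\<beta> y)" "\<gamma> r = frac (\<gamma> y)"
      by (rule box_reduce[OF db supporting_mem[OF S] yL])
    then have "r = 0" using least[OF r(1)] yg unfolding g_def by force
    then show ?thesis using r lin by (simp add: linear_0)
  qed
  have frac_eq: "frac t = t - of_int k" if "of_int k \<le> t" "t < of_int k + 1" for t :: real and k
    using that floor_unique[of k t] unfolding frac_def by simp
  have qx: "of_int q *\<^sub>R x \<in> \<Lambda>" by (rule scale_mem[OF xL])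
  have f: "frac (\<alpha> (of_int q *\<^sub>R x)) = of_int q * g - 1"
    using frac_eq[of 1 "of_int q * g"] qg g lin unfolding g_def by (simp add: linear_scale left_diff_distrib)
  then have zero: "of_int q * g - 1 = 0" "frac (of_int q * \<beta> x) = 0" "frac (of_int q * \<gamma> x) = 0"
    using small_zero[OF qx] qg lin by (simp_all add: linear_scale left_diff_distrib)
  obtain b c where bc: "of_int q * \<beta> x = of_int b" "of_int q * \<gamma> x = of_int c"
    using zero(2,3) unfolding frac_eq_0_iff by (metis Ints_cases)
  have q0: "0 < q" 
  proof (rule ccontr)
    assume "\<not> 0 < q"
    then have "of_int q * g \<le> 0" using g by (intro mult_nonpos_nonneg) auto
    then show False using qg(2) by linarith
  qed
  then have eqs: "\<alpha> x = 1 / of_int q" "\<beta> x = of_int b / of_int q" "\<gamma> x = of_int c / of_int q"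
    using zero(1) bc unfolding g_def by (simp_all add: field_simps)
  have fr: "frac (of_int k * \<alpha> x) = of_int (k mod q) / of_int q"
    "frac (of_int k * \<beta> x) = of_int ((k * b) mod q) / of_int q"
    "frac (of_int k * \<gamma> x) = of_int ((k * c) mod q) / of_int q" for k
    using frac_div_eq[OF q0, of k] frac_div_eq[OF q0, of "k * b"] frac_div_eq[OF q0, of "k * c"]
    unfolding eqs by simp_all
  have multiple: "0 < (k * b) mod q" "0 < (k * c) mod q" "q < k + (k * b) mod q + (k * c) mod q"
    "k + (k * b) mod q + (k * c) mod q < 2 * q" if k: "0 < k" "k < q" for k
  proof -
    obtain r where r: "r \<in> fundamental_box \<Lambda> \<alpha> \<beta> \<gamma>" "\<alpha> r = frac (of_int k * \<alpha> x)" "\<beta> r = frac (of_int k * \<beta> x)"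
      "\<gamma> r = frac (of_int k * \<gamma> x)"
    proof (rule box_reduce[OF db supporting_mem[OF S] scale_mem[OF xL, of k]])
      fix r assume "r \<in> fundamental_box \<Lambda> \<alpha> \<beta> \<gamma>" "\<alpha> r = frac (\<alpha> (of_int k *\<^sub>R x))"
        "\<beta> r = frac (\<beta> (of_int k *\<^sub>R x))" "\<gamma> r = frac (\<gamma> (of_int k *\<^sub>R x))"
      then show thesis using that lin by (simp add: linear_scale)
    qed
    have r': "\<alpha> r = of_int k / of_int q" "\<beta> r = of_int ((k * b) mod q) / of_int q"
      "\<gamma> r = of_int ((k * c) mod q) / of_int q"
      using r k unfolding fr by simp_all
    then have "r \<noteq> 0" using k lin by (auto simp: linear_0)
    note sb = supporting_box[OF S r(1) this]
    show "0 < (k * b) mod q" "0 < (k * c) mod q" using sb(2,3) q0 unfolding r' by (simp_all add: zero_less_divide_iff)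
    have "\<alpha> r + \<beta> r + \<gamma> r = of_int (k + (k * b) mod q + (k * c) mod q) / of_int q"
      unfolding r' by (simp add: add_divide_distrib)
    then have sum: "1 < real_of_int (k + (k * b) mod q + (k * c) mod q) / of_int q"
      "real_of_int (k + (k * b) mod q + (k * c) mod q) / of_int q < 2"
      using sb(4,5) by (simp_all only:)
    have "q < N \<and> N < 2 * q"
      if "1 < real_of_int N / of_int q" "real_of_int N / of_int q < 2" for N
    proof -
      have "real_of_int q < of_int N" "real_of_int N < of_int (2 * q)"
        using that q0 by (simp_all add: field_simps)
      then show ?thesis by (simp only: of_int_less_iff)
    qed
    from this[OF sum] show "q < k + (k * b) mod q + (k * c) mod q" "k + (k * b) mod q + (k * c) mod q < 2 * q"
      by simp_all
  qed
  have xb: "0 < \<beta> x" "\<beta> x < 1" "0 < \<gamma> x" "\<gamma> x < 1"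
    using supporting_box[OF S x] x(1) unfolding fundamental_box_def by auto
  have "b = q - 1 \<or> c = q - 1 \<or> b + c = q"
  proof (rule white_arithmetic)
    show "0 < b" "b < q" "0 < c" "c < q"
      using xb q0 unfolding eqs by (simp_all add: zero_less_divide_iff)
  qed (use multiple in force)+
  then have split: "\<alpha> x + \<beta> x = 1 \<or> \<beta> x + \<gamma> x = 1 \<or> \<gamma> x + \<alpha> x = 1"
  proof -
    have "\<alpha> x + \<beta> x = of_int (1 + b) / of_int q" "\<beta> x + \<gamma> x = of_int (b + c) / of_int q"
      "\<gamma> x + \<alpha> x = of_int (c + 1) / of_int q"
      unfolding eqs by (simp_all add: add_divide_distrib)
    then show ?thesis using \<open>b = q - 1 \<or> c = q - 1 \<or> b + c = q\<close> q0 by auto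
  qed
  have all: "\<phi> y + \<psi> y = 1"
    if \<phi>: "\<phi> \<in> {\<alpha>, \<beta>, \<gamma>}" and \<psi>: "\<psi> \<in> {\<alpha>, \<beta>, \<gamma>}" and x1: "\<phi> x + \<psi> x = 1"
      and y: "y \<in> fundamental_box \<Lambda> \<alpha> \<beta> \<gamma> - {0}" for \<phi> \<psi> y
  proof -
    define k where "k = \<lfloor>\<alpha> y * of_int q\<rfloor>"
    have gq: "of_int q * g = 1" using zero by simp
    have "of_int k \<le> \<alpha> y * of_int q" "\<alpha> y * of_int q < of_int k + 1" unfolding k_def by linarith+
    moreover have eqy: "\<alpha> y * of_int q * g = \<alpha> y" using gq by (simp add: mult.assoc)
    ultimately have "of_int k * g \<le> \<alpha> y * of_int q * g" "\<alpha> y * of_int q * g < (of_int k + 1) * g"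
      using g by (intro mult_right_mono mult_strict_right_mono; simp)+
    then have "0 \<le> \<alpha> y - of_int k * g" "\<alpha> y - of_int k * g < g"
      by (simp_all add: eqy distrib_right)
    moreover have "\<alpha> (y - of_int k *\<^sub>R x) = \<alpha> y - of_int k * g"
      unfolding g_def using lin by (simp add: linear_diff linear_scale)
    ultimately have "frac (\<alpha> (y - of_int k *\<^sub>R x)) < g"
      using frac_eq[of 0 "\<alpha> (y - of_int k *\<^sub>R x)"] g by simp
    moreover have "y - of_int k *\<^sub>R x \<in> \<Lambda>" using y xL unfolding fundamental_box_def by (auto intro!: diff_mem scale_mem)
    ultimately have fz: "frac (\<alpha> (y - of_int k *\<^sub>R x)) = 0" "frac (\<beta> (y - of_int k *\<^sub>R x)) = 0"
      "frac (\<gamma> (y - of_int k *\<^sub>R x)) = 0"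
      using small_zero by blast+
    then have "\<phi> (y - of_int k *\<^sub>R x) \<in> \<int>" "\<psi> (y - of_int k *\<^sub>R x) \<in> \<int>"
      using \<phi> \<psi> by auto
    then have "\<phi> (y - of_int k *\<^sub>R x) + \<psi> (y - of_int k *\<^sub>R x) \<in> \<int>" by simp
    moreover have "linear \<phi>" "linear \<psi>" using \<phi> \<psi> lin by auto
    then have "\<phi> (y - of_int k *\<^sub>R x) + \<psi> (y - of_int k *\<^sub>R x) = \<phi> y + \<psi> y - of_int k * (\<phi> x + \<psi> x)"
      by (simp add: linear_diff linear_scale algebra_simps)
    ultimately have "\<phi> y + \<psi> y - of_int k \<in> \<int>" using x1 by simp
    then have "\<phi> y + \<psi> y \<in> \<int>" by (metis Ints_add Ints_of_int diff_add_cancel)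
    then obtain n where n: "\<phi> y + \<psi> y = of_int n" by (rule Ints_cases)
    have "0 < \<phi> y" "\<phi> y < 1" "0 < \<psi> y" "\<psi> y < 1"
      using supporting_box[OF S, of y] y \<phi> \<psi> unfolding fundamental_box_def by auto
    then have "0 < real_of_int n" "real_of_int n < 2" using n by linarith+
    then have "n = 1" by linarith
    then show ?thesis using n by simp
  qed
  from split show ?thesis
  proof (elim disjE)
    assume "\<alpha> x + \<beta> x = 1"
    then have "\<forall>y\<in>fundamental_box \<Lambda> \<alpha> \<beta> \<gamma> - {0}. \<alpha> y + \<beta> y = 1"
      using all[of \<alpha> \<beta>] by simp
    then show ?thesis by simp
  next
    assume "\<beta> x + \<gamma> x = 1"
    then have "\<forall>y\<in>fundamental_box \<Lambda> \<alpha> \<beta> \<gamma> - {0}. \<beta> y + \<gamma> y = 1"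
      using all[of \<beta> \<gamma>] by simp
    then show ?thesis by simp
  next
    assume "\<gamma> x + \<alpha> x = 1"
    then have "\<forall>y\<in>fundamental_box \<Lambda> \<alpha> \<beta> \<gamma> - {0}. \<gamma> y + \<alpha> y = 1"
      using all[of \<gamma> \<alpha>] by simp
    then show ?thesis by simp
  qed
next
  case True
  show ?thesis unfolding True by simp
qed

end

section \<open>Unimodular subdivision of a strip\<close>

context additive_subgroup
begin

text \<open>
  If \<open>\<alpha> + \<beta> = 1\<close> on the box, then \<open>\<alpha> + \<beta>\<close> is an integer on \<open>\<Lambda>\<close>, and the slice where it equals 1 is a strip that is unbounded in
  the direction \<open>w\<close>. For a lowest box point \<open>x\<close>, the part of the strip between \<open>u\<close> and \<open>x\<close> is again a strip, now with
  bottom edge from \<open>u\<close> to \<open>x\<close>. A point \<open>y\<close> of its box is a box point of the old strip: otherwise \<open>y - w\<close> would be one that is lower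
  than \<open>x\<close>.
\<close>

lemma strip_lower_half:
  assumes db: "dual_basis u v w \<alpha> \<beta> \<gamma>"
    and strip: "\<And>y. y \<in> fundamental_box \<Lambda> \<alpha> \<beta> \<gamma> \<Longrightarrow> y \<noteq> 0 \<Longrightarrow> \<alpha> y + \<beta> y = 1"
    and mem: "u \<in> \<Lambda>" "v \<in> \<Lambda>" "w \<in> \<Lambda>"
    and x: "x \<in> fundamental_box \<Lambda> \<alpha> \<beta> \<gamma>" "x \<noteq> 0" "0 < \<beta> x"
    and least: "\<And>y. y \<in> fundamental_box \<Lambda> \<alpha> \<beta> \<gamma> \<Longrightarrow> y \<noteq> 0 \<Longrightarrow> \<gamma> x \<le> \<gamma> y"
    and y: "y \<in> fundamental_box \<Lambda> (\<lambda>y. \<alpha> y - \<beta> y / \<beta> x * \<alpha> x) (\<lambda>y. \<beta> y / \<beta> x) (\<lambda>y. \<gamma> y - \<beta> y / \<beta> x * \<gamma> x)"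
      "y \<noteq> 0"
  shows "y \<in> fundamental_box \<Lambda> \<alpha> \<beta> \<gamma> - {x}" "\<alpha> y + \<beta> y = 1"
proof -
  note lin = dual_basis_linear[OF db] and vals = dual_basis_values[OF db]
  have x1: "\<alpha> x + \<beta> x = 1" "\<beta> x < 1" "0 \<le> \<gamma> x" "\<gamma> x < 1" using strip x unfolding fundamental_box_def by auto
  define s where "s = \<beta> y / \<beta> x"
  have ys: "y \<in> \<Lambda>" "0 \<le> s" "s < 1" "0 \<le> \<alpha> y - s * \<alpha> x" "\<alpha> y - s * \<alpha> x < 1"
    "0 \<le> \<gamma> y - s * \<gamma> x" "\<gamma> y - s * \<gamma> x < 1"
    using y(1) unfolding fundamental_box_def s_def by auto
  have ybeta: "\<beta> y = s * \<beta> x" using x(3) unfolding s_def by simp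
  have b01: "0 \<le> \<beta> y" "\<beta> y < 1"
    using ys x x1(2) unfolding ybeta by (auto intro: order.strict_trans2[OF mult_strict_right_mono])
  have sum: "\<alpha> y + \<beta> y = (\<alpha> y - s * \<alpha> x) + s"
    using x1(1) unfolding ybeta by (simp add: algebra_simps flip: distrib_left)
  have sg: "s * \<gamma> x \<le> \<gamma> x" "0 \<le> s * \<gamma> x" "0 \<le> s * \<alpha> x"
    using ys x1 by (auto intro: mult_left_le_one_le)
  obtain r where r: "r \<in> fundamental_box \<Lambda> \<alpha> \<beta> \<gamma>" "\<alpha> r = frac (\<alpha> y)" "\<beta> r = frac (\<beta> y)" "\<gamma> r = frac (\<gamma> y)"
    "y = of_int \<lfloor>\<alpha> y\<rfloor> *\<^sub>R u + of_int \<lfloor>\<beta> y\<rfloor> *\<^sub>R v + of_int \<lfloor>\<gamma> y\<rfloor> *\<^sub>R w + r"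
    using box_reduce[OF db mem ys(1)] by metis
  have "\<alpha> r + \<beta> r \<in> \<int>" using strip[OF r(1)] lin by (cases "r = 0") (auto simp: linear_0)
  then have "\<alpha> y + \<beta> y \<in> \<int>"
  proof -
    have "\<alpha> y + \<beta> y = \<alpha> r + \<beta> r + of_int (\<lfloor>\<alpha> y\<rfloor> + \<lfloor>\<beta> y\<rfloor>)"
      unfolding r(2,3) frac_def by simp
    then show ?thesis using \<open>\<alpha> r + \<beta> r \<in> \<int>\<close> by (metis Ints_add Ints_of_int)
  qed
  then obtain n where n: "\<alpha> y + \<beta> y = of_int n" by (rule Ints_cases)
  have "0 \<le> real_of_int n" "real_of_int n < 2" using n sum ys by linarith+
  then consider "n = 0" | "n = 1" by linarith
  then have one: "\<alpha> y + \<beta> y = 1"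
  proof cases
    case 1
    then have "s = 0" "\<alpha> y - s * \<alpha> x = 0" using sum n ys by auto
    then have z: "\<alpha> y = 0" "\<beta> y = 0" "s = 0" using ybeta by auto
    then have "y \<in> fundamental_box \<Lambda> \<alpha> \<beta> \<gamma>" using ys unfolding fundamental_box_def by auto
    then show ?thesis using strip y(2) by simp
  qed (use n in simp)
  have s0: "0 < s" using sum one ys by linarith
  have bpos: "0 < \<beta> y" unfolding ybeta using s0 x(3) by simp
  have gy: "\<gamma> y < 1"
  proof (rule ccontr)
    assume "\<not> \<gamma> y < 1"
    have d: "\<alpha> (y - w) = \<alpha> y" "\<beta> (y - w) = \<beta> y" "\<gamma> (y - w) = \<gamma> y - 1"
      by (simp_all add: lin linear_diff vals)
    have "y - w \<in> fundamental_box \<Lambda> \<alpha> \<beta> \<gamma>"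
      using \<open>\<not> \<gamma> y < 1\<close> ys(1,7) mem(3) b01 bpos one sg x1 ys(4) unfolding fundamental_box_def mem_Collect_eq d
      by (auto intro!: diff_mem)
    moreover have "y - w \<noteq> 0" using d bpos lin by (auto simp: linear_0)
    ultimately have "\<gamma> x \<le> \<gamma> y - 1" using least[of "y - w"] d by simp
    then show False using ys(7) sg by linarith
  qed
  have "y \<in> fundamental_box \<Lambda> \<alpha> \<beta> \<gamma>"
    using ys b01 bpos one sg gy unfolding fundamental_box_def by auto
  moreover have "y \<noteq> x" using ys(3) x(3) unfolding s_def by auto
  ultimately show "y \<in> fundamental_box \<Lambda> \<alpha> \<beta> \<gamma> - {x}" "\<alpha> y + \<beta> y = 1" using one by auto
qed

text \<open>
  The remaining triangle \<open>u, v, x\<close> contains no lattice point except its vertices, since \<open>x\<close> is lowest. A box point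
  of this basis has \<open>\<alpha> + \<beta>\<close> equal to 0, 1 or 2; the value 1 gives a point of the triangle, and the value 2 gives one after
  reflection.
\<close>

lemma strip_bottom:
  assumes db: "dual_basis u v w \<alpha> \<beta> \<gamma>"
    and strip: "\<And>y. y \<in> fundamental_box \<Lambda> \<alpha> \<beta> \<gamma> \<Longrightarrow> y \<noteq> 0 \<Longrightarrow> \<alpha> y + \<beta> y = 1"
    and mem: "u \<in> \<Lambda>" "v \<in> \<Lambda>" "w \<in> \<Lambda>"
    and x: "x \<in> fundamental_box \<Lambda> \<alpha> \<beta> \<gamma>" "x \<noteq> 0" "0 < \<gamma> x"
    and least: "\<And>y. y \<in> fundamental_box \<Lambda> \<alpha> \<beta> \<gamma> \<Longrightarrow> y \<noteq> 0 \<Longrightarrow> \<gamma> x \<le> \<gamma> y"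
    and y: "y \<in> fundamental_box \<Lambda> (\<lambda>y. \<alpha> y - \<gamma> y / \<gamma> x * \<alpha> x) (\<lambda>y. \<beta> y - \<gamma> y / \<gamma> x * \<beta> x) (\<lambda>y. \<gamma> y / \<gamma> x)"
  shows "y = 0"
proof (rule ccontr)
  assume "y \<noteq> 0"
  note lin = dual_basis_linear[OF db] and vals = dual_basis_values[OF db]
  define \<alpha>' \<beta>' \<gamma>' where "\<alpha>' = (\<lambda>y. \<alpha> y - \<gamma> y / \<gamma> x * \<alpha> x)"
    and "\<beta>' = (\<lambda>y. \<beta> y - \<gamma> y / \<gamma> x * \<beta> x)" and "\<gamma>' = (\<lambda>y. \<gamma> y / \<gamma> x)"
  note d = this
  have db': "dual_basis u v x \<alpha>' \<beta>' \<gamma>'" unfolding d using dual_basis_exchange[OF db] x(3) by simp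
  note lin' = dual_basis_linear[OF db'] and vals' = dual_basis_values[OF db']
  have xL: "x \<in> \<Lambda>" using x(1) unfolding fundamental_box_def by simp
  have x1: "\<alpha> x + \<beta> x = 1" "\<gamma> x < 1" "0 < \<alpha> x" "0 < \<beta> x" using strip[OF x(1,2)] x(1) unfolding fundamental_box_def by auto
  have coord: "\<alpha> t = \<alpha>' t + \<gamma>' t * \<alpha> x" "\<beta> t = \<beta>' t + \<gamma>' t * \<beta> x" "\<gamma> t = \<gamma>' t * \<gamma> x" for t
    unfolding d using x(3) by simp_all
  have sum: "\<alpha> t + \<beta> t = \<alpha>' t + \<beta>' t + \<gamma>' t" for t
  proof -
    have "\<gamma>' t * \<alpha> x + \<gamma>' t * \<beta> x = \<gamma>' t * (\<alpha> x + \<beta> x)" by (rule distrib_left[symmetric])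
    then have "\<gamma>' t * \<alpha> x + \<gamma>' t * \<beta> x = \<gamma>' t" by (simp add: x1(1))
    then show ?thesis unfolding coord[of t] by simp
  qed
  have not1: False if t: "t \<in> fundamental_box \<Lambda> \<alpha>' \<beta>' \<gamma>'" "t \<noteq> 0" and one: "\<alpha> t + \<beta> t = 1" for t
  proof -
    have tt: "t \<in> \<Lambda>" "0 \<le> \<alpha>' t" "\<alpha>' t < 1" "0 \<le> \<beta>' t" "\<beta>' t < 1" "0 \<le> \<gamma>' t" "\<gamma>' t < 1"
      using t(1) unfolding fundamental_box_def by auto
    have "0 \<le> \<gamma>' t * \<alpha> x" "0 \<le> \<gamma>' t * \<beta> x" using tt x1 by auto
    moreover have "0 < \<gamma>' t * \<alpha> x" "0 < \<gamma>' t * \<beta> x" if "0 < \<gamma>' t" using that x1 by auto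
    ultimately have "0 < \<alpha>' t + \<gamma>' t * \<alpha> x" "0 < \<beta>' t + \<gamma>' t * \<beta> x"
      using one tt sum[of t] by (cases "\<gamma>' t = 0", simp_all)+
    then have "0 < \<alpha> t" "0 < \<beta> t" unfolding coord[of t] .
    moreover have "0 \<le> \<gamma> t" "\<gamma> t < \<gamma> x" unfolding coord[of t] using tt x(3) by auto
    ultimately have "t \<in> fundamental_box \<Lambda> \<alpha> \<beta> \<gamma>" using tt(1) one x1 unfolding fundamental_box_def by auto
    then show False using least[OF _ t(2)] \<open>\<gamma> t < \<gamma> x\<close> by force
  qed
  have yb: "y \<in> fundamental_box \<Lambda> \<alpha>' \<beta>' \<gamma>'" using y unfolding d .
  have yy: "y \<in> \<Lambda>" "0 \<le> \<alpha>' y" "\<alpha>' y < 1" "0 \<le> \<beta>' y" "\<beta>' y < 1" "0 \<le> \<gamma>' y" "\<gamma>' y < 1"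
    using yb unfolding fundamental_box_def by auto
  obtain r where r: "r \<in> fundamental_box \<Lambda> \<alpha> \<beta> \<gamma>" "\<alpha> r = frac (\<alpha> y)" "\<beta> r = frac (\<beta> y)" "\<gamma> r = frac (\<gamma> y)"
    "y = of_int \<lfloor>\<alpha> y\<rfloor> *\<^sub>R u + of_int \<lfloor>\<beta> y\<rfloor> *\<^sub>R v + of_int \<lfloor>\<gamma> y\<rfloor> *\<^sub>R w + r"
    using box_reduce[OF db mem yy(1)] by metis
  have "\<alpha> r + \<beta> r \<in> \<int>" using strip[OF r(1)] lin by (cases "r = 0") (auto simp: linear_0)
  moreover have "\<alpha> y + \<beta> y = \<alpha> r + \<beta> r + of_int (\<lfloor>\<alpha> y\<rfloor> + \<lfloor>\<beta> y\<rfloor>)"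
    unfolding r(2,3) frac_def by simp
  ultimately have "\<alpha> y + \<beta> y \<in> \<int>" by (metis Ints_add Ints_of_int)
  then obtain n where n: "\<alpha> y + \<beta> y = of_int n" by (rule Ints_cases)
  then have "0 \<le> real_of_int n" "real_of_int n < 3" using sum[of y] yy by linarith+
  then consider "n = 0" | "n = 1" | "n = 2" by linarith
  then show False
  proof cases
    case 1
    then have "\<alpha>' y = 0 \<and> \<beta>' y = 0 \<and> \<gamma>' y = 0" using sum[of y] n yy by auto
    then show False using box_zero_iff[OF db', of y] \<open>y \<noteq> 0\<close> by blast
  next
    case 2
    then show False using not1[OF yb \<open>y \<noteq> 0\<close>] n by simp
  next
    case 3
    have t: "\<alpha>' (u + v + x - y) = 1 - \<alpha>' y" "\<beta>' (u + v + x - y) = 1 - \<beta>' y" "\<gamma>' (u + v + x - y) = 1 - \<gamma>' y"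
      by (simp_all add: lin' linear_add linear_diff vals')
    have "\<alpha>' y + \<beta>' y + \<gamma>' y = 2" using sum[of y] n 3 by simp
    then have "u + v + x - y \<in> fundamental_box \<Lambda> \<alpha>' \<beta>' \<gamma>'"
      using yy mem xL unfolding fundamental_box_def mem_Collect_eq t by (auto intro!: diff_mem add_mem)
    moreover have "u + v + x - y \<noteq> 0" using t yy lin' by (auto simp: linear_0)
    moreover have "\<alpha> (u + v + x - y) + \<beta> (u + v + x - y) = 1"
      unfolding sum t using \<open>\<alpha>' y + \<beta>' y + \<gamma>' y = 2\<close> by simp
    ultimately show False by (rule not1)
  qed
qed

lemma unimodular_integral:
  assumes db: "dual_basis u v w \<alpha> \<beta> \<gamma>" and mem: "u \<in> \<Lambda>" "v \<in> \<Lambda>" "w \<in> \<Lambda>" and z: "z \<in> \<Lambda>"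
    and box: "\<And>y. y \<in> fundamental_box \<Lambda> \<alpha> \<beta> \<gamma> \<Longrightarrow> y = 0"
  shows "\<alpha> z \<in> \<int>" "\<beta> z \<in> \<int>" "\<gamma> z \<in> \<int>"
proof -
  obtain r where r: "r \<in> fundamental_box \<Lambda> \<alpha> \<beta> \<gamma>" "\<alpha> r = frac (\<alpha> z)" "\<beta> r = frac (\<beta> z)" "\<gamma> r = frac (\<gamma> z)"
    using box_reduce[OF db mem z] by metis
  then have "frac (\<alpha> z) = 0" "frac (\<beta> z) = 0" "frac (\<gamma> z) = 0"
    using box[OF r(1)] dual_basis_linear[OF db] by (auto simp: linear_0)
  then show "\<alpha> z \<in> \<int>" "\<beta> z \<in> \<int>" "\<gamma> z \<in> \<int>" by auto
qed

text \<open>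
  Induction on the number of box points: the lowest one cuts the cone into a unimodular cone and two cones over narrower strips.
\<close>

theorem strip_unimodular_cover:
  assumes "dual_basis u v w \<alpha> \<beta> \<gamma>" "finite (fundamental_box \<Lambda> \<alpha> \<beta> \<gamma>)"
    and "\<And>y. y \<in> fundamental_box \<Lambda> \<alpha> \<beta> \<gamma> \<Longrightarrow> y \<noteq> 0 \<Longrightarrow> \<alpha> y + \<beta> y = 1"
    and "u \<in> \<Lambda>" "v \<in> \<Lambda>" "w \<in> \<Lambda>"
    and "z \<in> \<Lambda>" "0 \<le> \<alpha> z" "0 \<le> \<beta> z" "0 \<le> \<gamma> z"
  shows "\<exists>u' v' w' \<alpha>' \<beta>' \<gamma>'. dual_basis u' v' w' \<alpha>' \<beta>' \<gamma>' \<and>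
    {u', v', w'} \<subseteq> {u, v, w} \<union> (fundamental_box \<Lambda> \<alpha> \<beta> \<gamma> - {0}) \<and> \<alpha>' z \<in> \<nat> \<and> \<beta>' z \<in> \<nat> \<and> \<gamma>' z \<in> \<nat>"
  using assms
proof (induction "card (fundamental_box \<Lambda> \<alpha> \<beta> \<gamma>)" arbitrary: u v w \<alpha> \<beta> \<gamma> rule: less_induct)
  case less
  note db = less.prems(1) and fin = less.prems(2) and strip = less.prems(3) and mem = less.prems(4-6)
    and z = less.prems(7-10)
  show ?case
  proof (cases "fundamental_box \<Lambda> \<alpha> \<beta> \<gamma> - {0} = {}")
    case True
    then have "y = 0" if "y \<in> fundamental_box \<Lambda> \<alpha> \<beta> \<gamma>" for y using that by auto
    then have "\<alpha> z \<in> \<int>" "\<beta> z \<in> \<int>" "\<gamma> z \<in> \<int>"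
      using unimodular_integral[OF db mem z(1)] by simp_all
    then have "\<alpha> z \<in> \<nat>" "\<beta> z \<in> \<nat>" "\<gamma> z \<in> \<nat>" using z by (auto simp: Nats_altdef2)
    moreover have "{u, v, w} \<subseteq> {u, v, w} \<union> (fundamental_box \<Lambda> \<alpha> \<beta> \<gamma> - {0})" by blast
    ultimately show ?thesis using db by (intro exI conjI)
  next
    case False
    obtain x where x: "x \<in> fundamental_box \<Lambda> \<alpha> \<beta> \<gamma>" "x \<noteq> 0"
      and least: "\<And>y. y \<in> fundamental_box \<Lambda> \<alpha> \<beta> \<gamma> \<Longrightarrow> y \<noteq> 0 \<Longrightarrow> \<gamma> x \<le> \<gamma> y"
      using finite_min_element[OF finite_Diff[OF fin] False, of \<gamma>] by auto
    have xL: "x \<in> \<Lambda>" using x(1) unfolding fundamental_box_def by simp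
    have x1: "\<alpha> x + \<beta> x = 1" "0 < \<alpha> x" "0 < \<beta> x" using strip[OF x] x unfolding fundamental_box_def by auto
    from ratio_test[OF z(2,3,4), of "\<alpha> x" "\<beta> x" "\<gamma> x"] x1 consider
      (bottom) "0 < \<gamma> x" "\<gamma> z / \<gamma> x * \<alpha> x \<le> \<alpha> z" "\<gamma> z / \<gamma> x * \<beta> x \<le> \<beta> z"
      | (left) "\<beta> z / \<beta> x * \<gamma> x \<le> \<gamma> z" "\<beta> z / \<beta> x * \<alpha> x \<le> \<alpha> z"
      | (right) "\<alpha> z / \<alpha> x * \<beta> x \<le> \<beta> z" "\<alpha> z / \<alpha> x * \<gamma> x \<le> \<gamma> z" by blast
    then show ?thesis
    proof cases
      case bottom
      let ?a = "\<lambda>y. \<alpha> y - \<gamma> y / \<gamma> x * \<alpha> x" and ?b = "\<lambda>y. \<beta> y - \<gamma> y / \<gamma> x * \<beta> x" and ?c = "\<lambda>y. \<gamma> y / \<gamma> x"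
      have db': "dual_basis u v x ?a ?b ?c" using dual_basis_exchange[OF db] bottom by simp
      have "?a z \<in> \<int>" "?b z \<in> \<int>" "?c z \<in> \<int>"
        by (rule unimodular_integral[OF db' mem(1,2) xL z(1)],
          rule strip_bottom[OF db strip mem x bottom(1) least]; assumption)+
      then have "?a z \<in> \<nat>" "?b z \<in> \<nat>" "?c z \<in> \<nat>" using bottom z by (auto simp: Nats_altdef2)
      moreover have "{u, v, x} \<subseteq> {u, v, w} \<union> (fundamental_box \<Lambda> \<alpha> \<beta> \<gamma> - {0})" using x by blast
      ultimately show ?thesis using db' by (intro exI conjI)
    next
      case left
      let ?a = "\<lambda>y. \<alpha> y - \<beta> y / \<beta> x * \<alpha> x" and ?b = "\<lambda>y. \<beta> y / \<beta> x" and ?c = "\<lambda>y. \<gamma> y - \<beta> y / \<beta> x * \<gamma> x"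
      have db': "dual_basis u x w ?a ?b ?c"
        using dual_basis_rotate[OF dual_basis_exchange[OF dual_basis_rotate[OF dual_basis_rotate[OF db]], of x]] x1 by simp
      note half = strip_lower_half[OF db strip mem x x1(3) least]
      have sub: "fundamental_box \<Lambda> ?a ?b ?c \<subseteq> fundamental_box \<Lambda> \<alpha> \<beta> \<gamma> - {x}"
      proof
        fix y assume y: "y \<in> fundamental_box \<Lambda> ?a ?b ?c"
        show "y \<in> fundamental_box \<Lambda> \<alpha> \<beta> \<gamma> - {x}"
          using half(1)[OF _ _ _ _ y] y x(2) dual_basis_linear[OF db] zero_mem
          by (cases "y = 0") (auto simp: fundamental_box_def linear_0)
      qed
      have lt: "card (fundamental_box \<Lambda> ?a ?b ?c) < card (fundamental_box \<Lambda> \<alpha> \<beta> \<gamma>)"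
        by (rule psubset_card_mono[OF fin]) (use sub x in auto)
      have sumeq: "?a y + ?b y = \<alpha> y + \<beta> y" for y
      proof -
        have "?a y + ?b y = \<alpha> y + \<beta> y / \<beta> x * (1 - \<alpha> x)" by (simp add: right_diff_distrib)
        also have "1 - \<alpha> x = \<beta> x" using x1 by simp
        finally show ?thesis using x1 by simp
      qed
      have strip': "?a y + ?b y = 1" if "y \<in> fundamental_box \<Lambda> ?a ?b ?c" "y \<noteq> 0" for y
        unfolding sumeq by (rule half(2)[OF _ _ _ _ that])
      have "0 \<le> ?a z" "0 \<le> ?b z" "0 \<le> ?c z" using left z x1 by auto
      then have "\<exists>u' v' w' \<alpha>' \<beta>' \<gamma>'. dual_basis u' v' w' \<alpha>' \<beta>' \<gamma>' \<and>
          {u', v', w'} \<subseteq> {u, x, w} \<union> (fundamental_box \<Lambda> ?a ?b ?c - {0}) \<and> \<alpha>' z \<in> \<nat> \<and> \<beta>' z \<in> \<nat> \<and> \<gamma>' z \<in> \<nat>"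
        by (intro less.hyps[OF lt db' finite_subset[OF sub finite_Diff[OF fin]] _ mem(1) xL mem(3) z(1)] strip')
      then
      obtain u' v' w' \<alpha>' \<beta>' \<gamma>' where new: "dual_basis u' v' w' \<alpha>' \<beta>' \<gamma>'"
        "{u', v', w'} \<subseteq> {u, x, w} \<union> (fundamental_box \<Lambda> ?a ?b ?c - {0})"
        "\<alpha>' z \<in> \<nat>" "\<beta>' z \<in> \<nat>" "\<gamma>' z \<in> \<nat>"
        by (elim exE conjE) (rule that)
      have "{u, x, w} \<union> (fundamental_box \<Lambda> ?a ?b ?c - {0}) \<subseteq> {u, v, w} \<union> (fundamental_box \<Lambda> \<alpha> \<beta> \<gamma> - {0})"
        using sub x by auto
      from new(1) order_trans[OF new(2) this] new(3-5) show ?thesis by (intro exI conjI)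
    next
      case right
      let ?a = "\<lambda>y. \<alpha> y / \<alpha> x" and ?b = "\<lambda>y. \<beta> y - \<alpha> y / \<alpha> x * \<beta> x" and ?c = "\<lambda>y. \<gamma> y - \<alpha> y / \<alpha> x * \<gamma> x"
      have db': "dual_basis v x w ?b ?a ?c"
        using dual_basis_swap[OF dual_basis_rotate[OF dual_basis_rotate[OF dual_basis_exchange[OF dual_basis_rotate[OF db], of x]]]] x1 by simp
      have strip2: "\<beta> y + \<alpha> y = 1" if "y \<in> fundamental_box \<Lambda> \<beta> \<alpha> \<gamma>" "y \<noteq> 0" for y
        using strip[of y] that by (simp add: box_swap add.commute)
      have x2: "x \<in> fundamental_box \<Lambda> \<beta> \<alpha> \<gamma>" using x(1) by (simp add: box_swap)
      have least2: "\<gamma> x \<le> \<gamma> y" if "y \<in> fundamental_box \<Lambda> \<beta> \<alpha> \<gamma>" "y \<noteq> 0" for y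
        using least[of y] that by (simp add: box_swap)
      note half = strip_lower_half[OF dual_basis_swap[OF db] strip2 mem(2,1,3) x2 x(2) x1(2) least2]
      have sub: "fundamental_box \<Lambda> ?b ?a ?c \<subseteq> fundamental_box \<Lambda> \<beta> \<alpha> \<gamma> - {x}"
      proof
        fix y assume y: "y \<in> fundamental_box \<Lambda> ?b ?a ?c"
        show "y \<in> fundamental_box \<Lambda> \<beta> \<alpha> \<gamma> - {x}"
          using half(1)[OF _ _ _ _ y] y x(2) dual_basis_linear[OF db] zero_mem
          by (cases "y = 0") (auto simp: fundamental_box_def linear_0)
      qed
      then have sub: "fundamental_box \<Lambda> ?b ?a ?c \<subseteq> fundamental_box \<Lambda> \<alpha> \<beta> \<gamma> - {x}" by (simp add: box_swap[of \<Lambda> \<beta>])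
      have lt: "card (fundamental_box \<Lambda> ?b ?a ?c) < card (fundamental_box \<Lambda> \<alpha> \<beta> \<gamma>)"
        by (rule psubset_card_mono[OF fin]) (use sub x in auto)
      have sumeq: "?b y + ?a y = \<alpha> y + \<beta> y" for y
      proof -
        have "?b y + ?a y = \<beta> y + \<alpha> y / \<alpha> x * (1 - \<beta> x)" by (simp add: right_diff_distrib)
        also have "1 - \<beta> x = \<alpha> x" using x1 by simp
        finally show ?thesis using x1 by simp
      qed
      have strip': "?b y + ?a y = 1" if "y \<in> fundamental_box \<Lambda> ?b ?a ?c" "y \<noteq> 0" for y
        unfolding sumeq add.commute[of "\<alpha> y"] by (rule half(2)[OF _ _ _ _ that])
      have "0 \<le> ?b z" "0 \<le> ?a z" "0 \<le> ?c z" using right z x1 by auto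
      then have "\<exists>u' v' w' \<alpha>' \<beta>' \<gamma>'. dual_basis u' v' w' \<alpha>' \<beta>' \<gamma>' \<and>
          {u', v', w'} \<subseteq> {v, x, w} \<union> (fundamental_box \<Lambda> ?b ?a ?c - {0}) \<and> \<alpha>' z \<in> \<nat> \<and> \<beta>' z \<in> \<nat> \<and> \<gamma>' z \<in> \<nat>"
        by (intro less.hyps[OF lt db' finite_subset[OF sub finite_Diff[OF fin]] _ mem(2) xL mem(3) z(1)] strip')
      then
      obtain u' v' w' \<alpha>' \<beta>' \<gamma>' where new: "dual_basis u' v' w' \<alpha>' \<beta>' \<gamma>'"
        "{u', v', w'} \<subseteq> {v, x, w} \<union> (fundamental_box \<Lambda> ?b ?a ?c - {0})"
        "\<alpha>' z \<in> \<nat>" "\<beta>' z \<in> \<nat>" "\<gamma>' z \<in> \<nat>"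
        by (elim exE conjE) (rule that)
      have "{v, x, w} \<union> (fundamental_box \<Lambda> ?b ?a ?c - {0}) \<subseteq> {u, v, w} \<union> (fundamental_box \<Lambda> \<alpha> \<beta> \<gamma> - {0})"
        using sub x by auto
      from new(1) order_trans[OF new(2) this] new(3-5) show ?thesis by (intro exI conjI)
    qed
  qed
qed

end

context lattice_cone
begin

text \<open>
  Sebo's theorem for simplicial cones of dimension three. By White's theorem the cone of a supporting frame lies over a
  strip, up to a rotation of the frame, and the strip is cut into unimodular cones whose generators are vertices of the
  frame or points of its box, hence indecomposable.
\<close>

theorem unimodular_hilbert_frame:
  assumes z: "z \<in> M"
  obtains u v w \<alpha> \<beta> \<gamma> where "dual_basis u v w \<alpha> \<beta> \<gamma>"
    "indecomposable M u" "indecomposable M v" "indecomposable M w"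
    "\<alpha> z \<in> \<nat>" "\<beta> z \<in> \<nat>" "\<gamma> z \<in> \<nat>"
proof -
  note result = that
  obtain u v w \<alpha> \<beta> \<gamma> where S: "supporting u v w \<alpha> \<beta> \<gamma>" and nn: "0 \<le> \<alpha> z" "0 \<le> \<beta> z" "0 \<le> \<gamma> z"
    by (rule supporting_frame[OF z])
  have zL: "z \<in> \<Lambda>" using z unfolding M_def by simp
  have cover: thesis if S: "supporting u v w \<alpha> \<beta> \<gamma>" and nn: "0 \<le> \<alpha> z" "0 \<le> \<beta> z" "0 \<le> \<gamma> z"
    and strip: "\<forall>y\<in>fundamental_box \<Lambda> \<alpha> \<beta> \<gamma> - {0}. \<alpha> y + \<beta> y = 1" for u v w \<alpha> \<beta> \<gamma>
  proof -
    have db: "dual_basis u v w \<alpha> \<beta> \<gamma>" using S unfolding supporting_def by simp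
    have "\<exists>u' v' w' \<alpha>' \<beta>' \<gamma>'. dual_basis u' v' w' \<alpha>' \<beta>' \<gamma>' \<and>
      {u', v', w'} \<subseteq> {u, v, w} \<union> (fundamental_box \<Lambda> \<alpha> \<beta> \<gamma> - {0}) \<and> \<alpha>' z \<in> \<nat> \<and> \<beta>' z \<in> \<nat> \<and> \<gamma>' z \<in> \<nat>"
      using strip by (intro strip_unimodular_cover db finite_supporting_box[OF S] supporting_mem[OF S] zL nn) auto
    then obtain u' v' w' and \<alpha>' \<beta>' \<gamma>' :: "'v \<Rightarrow> real" where 1: "dual_basis u' v' w' \<alpha>' \<beta>' \<gamma>'"
      and 2: "{u', v', w'} \<subseteq> {u, v, w} \<union> (fundamental_box \<Lambda> \<alpha> \<beta> \<gamma> - {0})"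
      and 3: "\<alpha>' z \<in> \<nat>" "\<beta>' z \<in> \<nat>" "\<gamma>' z \<in> \<nat>" by (elim exE conjE)
    have "indecomposable M t" if "t \<in> {u, v, w} \<union> (fundamental_box \<Lambda> \<alpha> \<beta> \<gamma> - {0})" for t
      using that supporting_vertex_indecomposable[OF S, of t] supporting_box_indecomposable[OF S, of t] by auto
    then have "indecomposable M u'" "indecomposable M v'" "indecomposable M w'" using 2 by auto
    then show thesis by (rule result[OF 1 _ _ _ 3])
  qed
  have rot: "fundamental_box \<Lambda> \<beta> \<gamma> \<alpha> = fundamental_box \<Lambda> \<alpha> \<beta> \<gamma>" "fundamental_box \<Lambda> \<gamma> \<alpha> \<beta> = fundamental_box \<Lambda> \<alpha> \<beta> \<gamma>"
    unfolding fundamental_box_def by auto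
  note S' = supporting_rotate[OF S]
  note S'' = supporting_rotate[OF S']
  from white_width_one[OF S] consider "\<forall>y\<in>fundamental_box \<Lambda> \<alpha> \<beta> \<gamma> - {0}. \<alpha> y + \<beta> y = 1"
    | "\<forall>y\<in>fundamental_box \<Lambda> \<alpha> \<beta> \<gamma> - {0}. \<beta> y + \<gamma> y = 1" | "\<forall>y\<in>fundamental_box \<Lambda> \<alpha> \<beta> \<gamma> - {0}. \<gamma> y + \<alpha> y = 1" by blast
  then show thesis
  proof cases
    case 1 then show thesis by (rule cover[OF S nn])
  next
    case 2 then show thesis using cover[OF S' nn(2,3,1)] by (simp add: rot)
  next
    case 3 then show thesis using cover[OF S'' nn(3,1,2)] by (simp add: rot)
  qed
qed

end

section \<open>Irreducible heights\<close>

definition ceil_div :: "int \<Rightarrow> int \<Rightarrow> int"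
  where "ceil_div N D = - ((- N) div D)"

lemma ceil_div_le_iff:
  assumes "0 < D"
  shows "ceil_div N D \<le> x \<longleftrightarrow> N \<le> D * x"
proof -
  have "ceil_div N D \<le> x \<longleftrightarrow> - x \<le> (- N) div D" unfolding ceil_div_def by auto
  also have "\<dots> \<longleftrightarrow> (- x) * D \<le> - N"
    by (rule int_le_div_iff[OF assms])
  finally show ?thesis by (auto simp: mult.commute)
qed

lemma ceil_div_ge: "0 < D \<Longrightarrow> N \<le> D * ceil_div N D"
  using ceil_div_le_iff[of D N "ceil_div N D"] by simp

lemma ceil_div_unique:
  assumes "0 < D" "N \<le> D * x" "D * x < N + D"
  shows "x = ceil_div N D"
proof (rule antisym)
  show "ceil_div N D \<le> x" using assms ceil_div_le_iff by simp
  have "\<not> ceil_div N D \<le> x - 1"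
    using assms unfolding ceil_div_le_iff[OF assms(1)] by (simp add: right_diff_distrib)
  then show "x \<le> ceil_div N D" by simp
qed

lemma ceil_div_mult_self: "0 < D \<Longrightarrow> ceil_div (D * x) D = x"
  by (rule ceil_div_unique[symmetric]) simp_all

lemma ceil_div_subadditive:
  assumes "0 < D"
  shows "ceil_div (N + N') D \<le> ceil_div N D + ceil_div N' D"
  using ceil_div_ge[OF assms, of N] ceil_div_ge[OF assms, of N']
  by (simp add: ceil_div_le_iff assms distrib_left)

text \<open>
  In the cone spanned by the unit vectors and \<open>(a\<^sub>1, \<dots>, a\<^sub>k, D)\<close>, where \<open>J = {a\<^sub>1, \<dots>, a\<^sub>k}\<close>, this says that the
  lowest lattice point of height \<open>s\<close> is not the sum of the lowest points of two smaller heights. Above height \<open>D\<close> the last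
  generator always splits off.
\<close>

definition irreducible_height :: "int \<Rightarrow> int set \<Rightarrow> int \<Rightarrow> bool"
  where "irreducible_height D J s \<longleftrightarrow> 0 < s \<and> s \<le> D \<and> (\<forall>p>0. \<forall>q>0. p + q = s \<longrightarrow>
    (\<exists>a\<in>J. ceil_div (s * a) D < ceil_div (p * a) D + ceil_div (q * a) D))"

text \<open>
  The three-dimensional cone spanned by \<open>e1\<close>, \<open>e2\<close>, \<open>(a, b, D)\<close> is treated with \<open>unimodular_hilbert_frame\<close>. The numbers \<open>k\<close> and \<open>l\<close>
  are the coefficients of \<open>e1\<close> and \<open>e2\<close>. If \<open>a = b\<close> and \<open>x = y\<close>, everything is symmetric and takes place in a plane, where one
  summand fewer suffices.
\<close>

lemma planar_heights:
  fixes D a b x y t :: int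
  assumes D: "0 < D" and t: "0 \<le> t" and x: "t * a \<le> D * x" and y: "t * b \<le> D * y"
  shows "\<exists>S m k l. finite S \<and> (\<forall>s\<in>S. irreducible_height D {a, b} s) \<and> t = (\<Sum>s\<in>S. int (m s) * s) \<and>
    x = int k + (\<Sum>s\<in>S. int (m s) * ceil_div (s * a) D) \<and>
    y = int l + (\<Sum>s\<in>S. int (m s) * ceil_div (s * b) D) \<and>
    card S + of_bool (0 < k) + of_bool (0 < l) \<le> 3 \<and>
    (a = b \<and> x = y \<longrightarrow> card S + of_bool (0 < k) \<le> 2)"
proof -
  define \<Lambda> :: "(real \<times> real \<times> real) set" where "\<Lambda> = \<int> \<times> \<int> \<times> \<int>"
  define e1 e2 e3 :: "real \<times> real \<times> real"
    where "e1 = (1, 0, 0)" and "e2 = (0, 1, 0)" and "e3 = (of_int a, of_int b, of_int D)"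
  note e_defs = this
  define a1 a2 a3 :: "real \<times> real \<times> real \<Rightarrow> real"
    where "a1 = (\<lambda>p. fst p - snd (snd p) * of_int a / of_int D)"
      and "a2 = (\<lambda>p. fst (snd p) - snd (snd p) * of_int b / of_int D)"
      and "a3 = (\<lambda>p. snd (snd p) / of_int D)"
  note a_defs = this
  define g :: "int \<Rightarrow> real \<times> real \<times> real"
    where "g = (\<lambda>s. (of_int (ceil_div (s * a) D), of_int (ceil_div (s * b) D), of_int s))"
  have db: "dual_basis e1 e2 e3 a1 a2 a3"
    unfolding dual_basis_def a_defs e_defs using D
    by (auto intro!: linearI simp: field_simps)
  have box_g: "\<exists>s. 0 \<le> s \<and> s < D \<and> p = g s" if p: "p \<in> fundamental_box \<Lambda> a1 a2 a3" for p
  proof -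
    obtain i j s where pe: "p = (of_int i, of_int j, of_int s)"
      using p unfolding fundamental_box_def \<Lambda>_def by (auto elim!: Ints_cases)
    have "0 \<le> real_of_int s" "real_of_int s < real_of_int D"
      "real_of_int (s * a) \<le> real_of_int (D * i)" "real_of_int (D * i) < real_of_int (s * a + D)"
      "real_of_int (s * b) \<le> real_of_int (D * j)" "real_of_int (D * j) < real_of_int (s * b + D)"
      using p D unfolding fundamental_box_def a_defs pe by (simp_all add: field_simps zero_le_divide_iff)
    then have "0 \<le> s" "s < D" "s * a \<le> D * i" "D * i < s * a + D" "s * b \<le> D * j" "D * j < s * b + D"
      by (simp_all only: of_int_less_iff of_int_le_iff of_int_0_le_iff)
    then show ?thesis using ceil_div_unique[OF D] unfolding pe g_def by auto
  qed
  interpret lattice_cone \<Lambda> e1 e2 e3 a1 a2 a3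
  proof
    show "0 \<in> \<Lambda>" unfolding \<Lambda>_def by (simp add: zero_prod_def)
    show "p - q \<in> \<Lambda>" if "p \<in> \<Lambda>" "q \<in> \<Lambda>" for p q using that unfolding \<Lambda>_def by auto
    show "e1 \<in> \<Lambda>" "e2 \<in> \<Lambda>" "e3 \<in> \<Lambda>" unfolding \<Lambda>_def e_defs by auto
    show "finite (fundamental_box \<Lambda> a1 a2 a3)"
      by (rule finite_subset[of _ "g ` {0..<D}"]) (use box_g in force)+
  qed (rule db)
  have M_iff: "p \<in> M \<longleftrightarrow> p \<in> \<Lambda> \<and> 0 \<le> a1 p \<and> 0 \<le> a2 p \<and> 0 \<le> a3 p" for p
    by (simp add: M_def)
  have g_M: "g s \<in> M" if "0 \<le> s" for s
  proof -
    have "real_of_int (s * a) \<le> real_of_int (D * ceil_div (s * a) D)"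
      "real_of_int (s * b) \<le> real_of_int (D * ceil_div (s * b) D)"
      using ceil_div_ge[OF D] by (simp_all only: of_int_le_iff)
    then show ?thesis using that D unfolding M_iff unfolding \<Lambda>_def a_defs g_def by (auto simp: field_simps)
  qed
  have g_zero: "g s = 0 \<longleftrightarrow> s = 0" for s
    unfolding g_def by (auto simp: zero_prod_def ceil_div_def)
  have g_D: "g D = e3" unfolding g_def e_defs using D by (simp add: ceil_div_mult_self)
  have g_add: "g (p + q) = g p + g q"
    if "\<not> (\<exists>c\<in>{a, b}. ceil_div ((p + q) * c) D < ceil_div (p * c) D + ceil_div (q * c) D)" for p q
    using that ceil_div_subadditive[OF D, of "p * a" "q * a"] ceil_div_subadditive[OF D, of "p * b" "q * b"]
    unfolding g_def by (simp add: distrib_right)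
  have ind: "h = e1 \<or> h = e2 \<or> (\<exists>s. h = g s \<and> irreducible_height D {a, b} s)"
    if h: "indecomposable M h" for h
  proof (cases "h = e1 \<or> h = e2")
    case False
    have "\<exists>s. 0 < s \<and> s \<le> D \<and> h = g s"
    proof (cases "h = e3")
      case True
      then show ?thesis using g_D D by auto
    next
      case F: False
      then have "h \<in> fundamental_box \<Lambda> a1 a2 a3" "h \<noteq> 0"
        using indecomposable_in_H[OF h] False unfolding H_def by auto
      then obtain s where "0 \<le> s" "s < D" "h = g s" using box_g by blast
      then show ?thesis using g_zero[of s] \<open>h \<noteq> 0\<close> by (intro exI[of _ s]) auto
    qed
    then obtain s where s: "0 < s" "s \<le> D" "h = g s" by auto
    have "irreducible_height D {a, b} s"
      unfolding irreducible_height_def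
    proof (intro conjI s allI impI, rule ccontr)
      fix p q :: int assume pq: "0 < p" "0 < q" "p + q = s"
        and no: "\<not> (\<exists>c\<in>{a, b}. ceil_div (s * c) D < ceil_div (p * c) D + ceil_div (q * c) D)"
      then have "h = g p + g q" using g_add[of p q] s(3) by simp
      then show False using h g_M[of p] g_M[of q] g_zero[of p] g_zero[of q] pq
        unfolding indecomposable_def by auto
    qed
    then show ?thesis using s by blast
  qed blast
  define z :: "real \<times> real \<times> real" where "z = (of_int x, of_int y, of_int t)"
  have z_M: "z \<in> M"
  proof -
    have "real_of_int (t * a) \<le> real_of_int (D * x)" "real_of_int (t * b) \<le> real_of_int (D * y)"
      using x y by (simp_all only: of_int_le_iff)
    then show ?thesis using t D unfolding M_iff unfolding \<Lambda>_def a_defs z_def by (auto simp: field_simps)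
  qed
  obtain u v w \<alpha> \<beta> \<gamma> where fr: "dual_basis u v w \<alpha> \<beta> \<gamma>"
    and uvw: "indecomposable M u" "indecomposable M v" "indecomposable M w"
    and nat: "\<alpha> z \<in> \<nat>" "\<beta> z \<in> \<nat>" "\<gamma> z \<in> \<nat>"
    by (rule unimodular_hilbert_frame[OF z_M])
  note vals = dual_basis_values[OF fr]
  have dist: "u \<noteq> v" "u \<noteq> w" "v \<noteq> w" using vals by auto
  obtain i j k where ijk: "\<alpha> z = real i" "\<beta> z = real j" "\<gamma> z = real k"
    using nat by (auto elim!: Nats_cases)
  define m where "m h = (if h = u then i else if h = v then j else if h = w then k else 0)" for h
  have m_uvw: "m u = i" "m v = j" "m w = k" unfolding m_def using dist by auto
  define S where "S = {s. 0 < s \<and> g s \<in> {u, v, w} \<and> 0 < m (g s)}"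
  have inj_g: "inj g" unfolding g_def by (auto intro!: injI)
  have g_e: "g s \<noteq> e1" "g s \<noteq> e2" if "0 < s" for s using that unfolding g_def e_defs by auto
  have e12: "e1 \<noteq> e2" unfolding e_defs by simp
  have fin_S: "finite S"
    by (rule finite_imageD[of g]) (auto intro: finite_subset[of _ "{u, v, w}"] inj_on_subset[OF inj_g] simp: S_def)
  define U where "U = {h \<in> {u, v, w}. 0 < m h}"
  have U_ind: "indecomposable M h" if "h \<in> U" for h using that uvw unfolding U_def by auto
  have U_eq: "U = g ` S \<union> {h \<in> {e1, e2}. 0 < m h}"
  proof (intro equalityI subsetI)
    fix h assume h: "h \<in> U"
    then consider "h = e1" | "h = e2" | s where "h = g s" "irreducible_height D {a, b} s"
      using ind[OF U_ind[OF h]] by blast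
    then show "h \<in> g ` S \<union> {h \<in> {e1, e2}. 0 < m h}"
      using h unfolding U_def S_def irreducible_height_def by cases auto
  next
    fix h assume "h \<in> g ` S \<union> {h \<in> {e1, e2}. 0 < m h}"
    then show "h \<in> U" unfolding U_def S_def m_def by (auto split: if_splits)
  qed
  have disj: "g ` S \<inter> {h \<in> {e1, e2}. 0 < m h} = {}"
  proof -
    have "g s \<notin> {e1, e2}" if "s \<in> S" for s using g_e[of s] that unfolding S_def by simp
    then show ?thesis by blast
  qed
  have z_sum: "z = (\<Sum>h\<in>U. real (m h) *\<^sub>R h)"
  proof -
    have "z = real (m u) *\<^sub>R u + real (m v) *\<^sub>R v + real (m w) *\<^sub>R w"
      using dual_basis_expand[OF fr, of z] ijk m_uvw by simp
    also have "\<dots> = (\<Sum>h\<in>{u, v, w}. real (m h) *\<^sub>R h)" using dist by (simp add: add.assoc)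
    also have "\<dots> = (\<Sum>h\<in>U. real (m h) *\<^sub>R h)"
      unfolding U_def by (intro sum.mono_neutral_right) auto
    finally show ?thesis .
  qed
  have "(\<Sum>h\<in>{h \<in> {e1, e2}. 0 < m h}. real (m h) *\<^sub>R h) = (\<Sum>h\<in>{e1, e2}. real (m h) *\<^sub>R h)"
    by (intro sum.mono_neutral_left) auto
  also have "\<dots> = real (m e1) *\<^sub>R e1 + real (m e2) *\<^sub>R e2" using e12 by simp
  finally have z_eq: "z = (\<Sum>s\<in>S. real (m (g s)) *\<^sub>R g s) + (real (m e1) *\<^sub>R e1 + real (m e2) *\<^sub>R e2)"
    unfolding z_sum U_eq using disj fin_S
    by (subst sum.union_disjoint) (auto simp: sum.reindex inj_on_subset[OF inj_g])
  have "fst z = real_of_int (int (m e1) + (\<Sum>s\<in>S. int (m (g s)) * ceil_div (s * a) D))"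
    unfolding z_eq by (simp add: fst_sum g_def e_defs)
  then have xe: "x = int (m e1) + (\<Sum>s\<in>S. int (m (g s)) * ceil_div (s * a) D)"
    unfolding z_def by (simp only: fst_conv of_int_eq_iff)
  have "fst (snd z) = real_of_int (int (m e2) + (\<Sum>s\<in>S. int (m (g s)) * ceil_div (s * b) D))"
    unfolding z_eq by (simp add: fst_sum snd_sum g_def e_defs)
  then have ye: "y = int (m e2) + (\<Sum>s\<in>S. int (m (g s)) * ceil_div (s * b) D)"
    unfolding z_def by (simp only: fst_conv snd_conv of_int_eq_iff)
  have "snd (snd z) = real_of_int (\<Sum>s\<in>S. int (m (g s)) * s)"
    unfolding z_eq by (simp add: snd_sum g_def e_defs)
  then have te: "t = (\<Sum>s\<in>S. int (m (g s)) * s)"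
    unfolding z_def by (simp only: snd_conv of_int_eq_iff)
  have "card {h \<in> {e1, e2}. 0 < m h} = of_bool (0 < m e1) + of_bool (0 < m e2)"
  proof -
    have "{h \<in> {e1, e2}. 0 < m h} = (if 0 < m e1 then {e1} else {}) \<union> (if 0 < m e2 then {e2} else {})" by auto
    then show ?thesis using e12 by auto
  qed
  then have card_U: "card U = card S + of_bool (0 < m e1) + of_bool (0 < m e2)"
    unfolding U_eq using fin_S disj
    by (subst card_Un_disjoint) (auto simp: card_image inj_on_subset[OF inj_g])
  have "card U \<le> card {u, v, w}" unfolding U_def by (intro card_mono) auto
  also have "\<dots> \<le> 3" by (simp add: card_insert_if)
  finally have c3: "card S + of_bool (0 < m e1) + of_bool (0 < m e2) \<le> 3" using card_U by simp
  have c2: "card S + of_bool (0 < m e1) \<le> 2" if ab: "a = b" "x = y"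
  proof (cases "0 < m e1")
    case True
    then show ?thesis using c3 xe ye ab by simp
  next
    case False
    then have no: "m e1 = 0" "m e2 = 0" using xe ye ab by auto
    \<comment> \<open>All points \<open>g s\<close> lie in the plane of equal first and second coordinate, and a basis does not.\<close>
    have "\<exists>h\<in>{u, v, w}. h = e1 \<or> h = e2"
    proof (rule ccontr)
      assume none: "\<not> ?thesis"
      define f :: "real \<times> real \<times> real \<Rightarrow> real" where "f p = fst p - fst (snd p)" for p
      have lf: "linear f" unfolding f_def by (intro linearI) (simp_all add: algebra_simps)
      have "f h = 0" if "h \<in> {u, v, w}" for h
        using ind[of h] that none uvw ab(1) unfolding f_def g_def by auto
      then have "f e1 = 0" using linear_dual_basis[OF fr lf, of e1] by simp
      then show False unfolding f_def e_defs by simp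
    qed
    then obtain h where "h \<in> {u, v, w}" "h = e1 \<or> h = e2" by (elim bexE)
    then have "m h = 0" using no by (elim disjE) simp_all
    then have "card U \<le> card ({u, v, w} - {h})" unfolding U_def by (intro card_mono) (simp, fastforce)
    also have "\<dots> = card {u, v, w} - 1" using \<open>h \<in> {u, v, w}\<close> by (subst card_Diff_singleton) auto
    also have "\<dots> \<le> 2" by (simp add: card_insert_if)
    finally show ?thesis using card_U no by simp
  qed
  have irr: "\<forall>s\<in>S. irreducible_height D {a, b} s"
  proof
    fix s assume s: "s \<in> S"
    then have "g s \<in> U" using U_eq by auto
    from ind[OF U_ind[OF this]] g_e[of s] s show "irreducible_height D {a, b} s"
      unfolding S_def using inj_g by (auto dest: injD)
  qed
  show ?thesis
    by (intro exI[of _ S] exI[of _ "\<lambda>s. m (g s)"] exI[of _ "m e1"] exI[of _ "m e2"]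
        conjI fin_S irr te xe ye c3 impI) (elim conjE, rule c2)
qed

text \<open>
  For a single value \<open>a\<close>, the three-dimensional result is used on the diagonal, with the value \<open>a\<close> taken twice.
\<close>

theorem few_irreducible_heights:
  fixes x :: "int \<Rightarrow> int"
  assumes D: "0 < D" and t: "0 \<le> t" and J: "finite J" "card J \<le> 2"
    and x: "\<forall>a\<in>J. t * a \<le> D * x a"
  shows "\<exists>S m. finite S \<and> (\<forall>s\<in>S. irreducible_height D J s) \<and> t = (\<Sum>s\<in>S. int (m s) * s) \<and>
    (\<forall>a\<in>J. (\<Sum>s\<in>S. int (m s) * ceil_div (s * a) D) \<le> x a) \<and>
    card S + card {a \<in> J. (\<Sum>s\<in>S. int (m s) * ceil_div (s * a) D) < x a} \<le> card J + 1"
proof -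
  consider "J = {}" | a where "J = {a}" | a b where "J = {a, b}" "a \<noteq> b"
  proof -
    have "card J = 0 \<or> card J = 1 \<or> card J = 2" using J(2) by auto
    then show thesis using that J(1) by (auto simp: card_1_singleton_iff card_2_iff)
  qed
  then show ?thesis
  proof cases
    case 1
    have "irreducible_height D J 1" using D unfolding irreducible_height_def by auto
    then show ?thesis using t 1 by (intro exI[of _ "{1}"] exI[of _ "\<lambda>_. nat t"]) simp
  next
    case (2 a)
    have xa: "t * a \<le> D * x a" using x 2 by simp
    obtain S m k l where S: "finite S" "\<forall>s\<in>S. irreducible_height D {a, a} s" "t = (\<Sum>s\<in>S. int (m s) * s)"
      and xk: "x a = int k + (\<Sum>s\<in>S. int (m s) * ceil_div (s * a) D)"
      and c: "card S + of_bool (0 < k) \<le> 2"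
      using planar_heights[OF D t xa xa] by auto
    have "{c \<in> J. (\<Sum>s\<in>S. int (m s) * ceil_div (s * c) D) < x c} = (if 0 < k then {a} else {})"
      using xk 2 by auto
    then show ?thesis using S xk c 2 by (intro exI[of _ S] exI[of _ m]) auto
  next
    case (3 a b)
    have xa: "t * a \<le> D * x a" and xb: "t * b \<le> D * x b" using x 3 by simp_all
    obtain S m k l where S: "finite S" "\<forall>s\<in>S. irreducible_height D {a, b} s" "t = (\<Sum>s\<in>S. int (m s) * s)"
      and xk: "x a = int k + (\<Sum>s\<in>S. int (m s) * ceil_div (s * a) D)"
        "x b = int l + (\<Sum>s\<in>S. int (m s) * ceil_div (s * b) D)"
      and c: "card S + of_bool (0 < k) + of_bool (0 < l) \<le> 3"
      using planar_heights[OF D t xa xb] by auto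
    have "{c \<in> J. (\<Sum>s\<in>S. int (m s) * ceil_div (s * c) D) < x c}
      = (if 0 < k then {a} else {}) \<union> (if 0 < l then {b} else {})"
      using xk 3 by auto
    then have "card {c \<in> J. (\<Sum>s\<in>S. int (m s) * ceil_div (s * c) D) < x c} = of_bool (0 < k) + of_bool (0 < l)"
      using 3(2) by auto
    then show ?thesis using S xk c 3 by (intro exI[of _ S] exI[of _ m]) auto
  qed
qed

section \<open>The lattice points of the cone and its Hilbert basis\<close>

text \<open>
  The last index is written \<open>n - 1\<close> throughout; this keeps the simplifier from rewriting it.
\<close>

declare One_nat_def [simp del]

text \<open>
  Working with coordinates replaces the finite sum of vectors by ordinary sums of integers.
\<close>

lemma nonneg_int_comb_iff:
  assumes "H \<subseteq> carrier_vec n"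
  shows "nonneg_int_comb n H k z \<longleftrightarrow> z \<in> carrier_vec n \<and> (\<exists>(c :: nat \<Rightarrow> nat) h.
    (\<forall>i\<in>{1..k}. h i \<in> H) \<and> (\<forall>j<n. z $ j = (\<Sum>i\<in>{1..k}. int (c i) * h i $ j)))"
proof -
  have sum: "finsum_vec TYPE(int) n (\<lambda>i. int (c i) \<cdot>\<^sub>v h i) {1..k} $ j = (\<Sum>i\<in>{1..k}. int (c i) * h i $ j)"
    if "\<forall>i\<in>{1..k}. h i \<in> H" "j < n" for c :: "nat \<Rightarrow> nat" and h :: "nat \<Rightarrow> int vec" and j
  proof -
    have cl: "h i \<in> carrier_vec n" if "i \<in> {1..k}" for i using assms that \<open>\<forall>i\<in>{1..k}. h i \<in> H\<close> by auto
    have "finsum_vec TYPE(int) n (\<lambda>i. int (c i) \<cdot>\<^sub>v h i) {1..k} $ j = (\<Sum>i\<in>{1..k}. (int (c i) \<cdot>\<^sub>v h i) $ j)"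
      using that(2) cl by (intro index_finsum_vec) auto
    also have "\<dots> = (\<Sum>i\<in>{1..k}. int (c i) * h i $ j)"
      using that(2) cl by (intro sum.cong refl) (simp add: carrier_vecD[OF cl])
    finally show "finsum_vec TYPE(int) n (\<lambda>i. int (c i) \<cdot>\<^sub>v h i) {1..k} $ j = (\<Sum>i\<in>{1..k}. int (c i) * h i $ j)" .
  qed
  have closed: "finsum_vec TYPE(int) n (\<lambda>i. int (c i) \<cdot>\<^sub>v h i) {1..k} \<in> carrier_vec n"
    if "\<forall>i\<in>{1..k}. h i \<in> H" for c :: "nat \<Rightarrow> nat" and h :: "nat \<Rightarrow> int vec"
    using assms that by (intro finsum_vec_closed) auto
  show ?thesis
    unfolding nonneg_int_comb_def
  proof (intro iffI conjI; (elim exE conjE)?)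
    fix c :: "nat \<Rightarrow> nat" and h
    assume h: "\<forall>i\<in>{1..k}. h i \<in> H" and z: "z = finsum_vec TYPE(int) n (\<lambda>i. int (c i) \<cdot>\<^sub>v h i) {1..k}"
    show "z \<in> carrier_vec n" unfolding z by (rule closed[OF h])
    show "\<exists>(c :: nat \<Rightarrow> nat) h. (\<forall>i\<in>{1..k}. h i \<in> H) \<and> (\<forall>j<n. z $ j = (\<Sum>i\<in>{1..k}. int (c i) * h i $ j))"
      using h sum[OF h] unfolding z by (intro exI[of _ c] exI[of _ h]) simp
  next
    fix c :: "nat \<Rightarrow> nat" and h
    assume zc: "z \<in> carrier_vec n" and h: "\<forall>i\<in>{1..k}. h i \<in> H"
      and z: "\<forall>j<n. z $ j = (\<Sum>i\<in>{1..k}. int (c i) * h i $ j)"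
    have "z = finsum_vec TYPE(int) n (\<lambda>i. int (c i) \<cdot>\<^sub>v h i) {1..k}"
    proof (rule eq_vecI)
      show "z $ j = finsum_vec TYPE(int) n (\<lambda>i. int (c i) \<cdot>\<^sub>v h i) {1..k} $ j"
        if "j < dim_vec (finsum_vec TYPE(int) n (\<lambda>i. int (c i) \<cdot>\<^sub>v h i) {1..k})" for j
        using that z sum[OF h] unfolding carrier_vecD[OF closed[OF h]] by simp
      show "dim_vec z = dim_vec (finsum_vec TYPE(int) n (\<lambda>i. int (c i) \<cdot>\<^sub>v h i) {1..k})"
        unfolding carrier_vecD[OF closed[OF h]] using zc by simp
    qed
    then show "\<exists>(c :: nat \<Rightarrow> nat) h. (\<forall>i\<in>{1..k}. h i \<in> H) \<and> z = finsum_vec TYPE(int) n (\<lambda>i. int (c i) \<cdot>\<^sub>v h i) {1..k}"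
      using h by (intro exI[of _ c] exI[of _ h]) simp
  qed
qed

lemma nonneg_int_comb_family:
  fixes m :: "'a \<Rightarrow> nat"
  assumes H: "H \<subseteq> carrier_vec n" and A: "finite A" and h: "\<And>a. a \<in> A \<Longrightarrow> h a \<in> H"
    and z: "z \<in> carrier_vec n" "\<And>j. j < n \<Longrightarrow> z $ j = (\<Sum>a\<in>A. int (m a) * h a $ j)"
  shows "nonneg_int_comb n H (card A) z"
proof -
  obtain f where f: "bij_betw f {1..card A} A" using ex_bij_betw_nat_finite_1[OF A] by auto
  have mem: "f i \<in> A" if "i \<in> {1..card A}" for i using f that by (rule bij_betw_apply)
  have "z $ j = (\<Sum>i\<in>{1..card A}. int (m (f i)) * h (f i) $ j)" if "j < n" for j
    using z(2)[OF that] sum.reindex_bij_betw[OF f, of "\<lambda>a. int (m a) * h a $ j"] by simp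
  then show ?thesis
    unfolding nonneg_int_comb_iff[OF H] using z(1) h mem
    by (intro conjI exI[of _ "\<lambda>i. m (f i)"] exI[of _ "\<lambda>i. h (f i)"]) auto
qed

locale unit_cone =
  fixes n :: nat and r :: "int vec" and D :: int
  assumes n: "1 \<le> n" and r: "r \<in> carrier_vec n" and last: "r $ (n - 1) = D" and D: "1 \<le> D"
    and range: "\<And>i. i < n - 1 \<Longrightarrow> 0 \<le> r $ i \<and> r $ i \<le> D - 1"
begin

definition L :: "int vec set"
  where "L = {z \<in> carrier_vec n. 0 \<le> z $ (n - 1) \<and> (\<forall>i<n - 1. z $ (n - 1) * r $ i \<le> D * z $ i)}"

lemma L_carrier: "L \<subseteq> carrier_vec n"
  unfolding L_def by auto

lemma lattice_points_eq_L:
  "lattice_points n (pos (map_mat real_of_int (mat_of_cols n (map (unit_vec n) [0..<n - 1] @ [r])))) = L"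
proof -
  let ?R = "map_mat real_of_int (mat_of_cols n (map (unit_vec n) [0..<n - 1] @ [r]))"
  have dim: "dim_col ?R = n" "dim_row ?R = n" using n by simp_all
  have entry: "?R $$ (i, j) = (if j < n - 1 then of_bool (i = j) else of_int (r $ i))" if "i < n" "j < n" for i j
    using that n by (auto simp: mat_of_cols_index nth_append)
  have mult: "(?R *\<^sub>v x) $ i = (if i < n - 1 then x $ i else 0) + of_int (r $ i) * x $ (n - 1)"
    if x: "x \<in> carrier_vec n" and i: "i < n" for x :: "real vec" and i
  proof -
    have "(?R *\<^sub>v x) $ i = (\<Sum>j\<in>{0..<n}. ?R $$ (i, j) * x $ j)"
      using x i dim by (simp add: mult_mat_vec_def scalar_prod_def)
    also have "\<dots> = (\<Sum>j\<in>{0..<n}. (if j < n - 1 then of_bool (i = j) else of_int (r $ i)) * x $ j)"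
      using i by (intro sum.cong refl) (simp only: entry atLeastLessThan_iff)
    also have "{0..<n} = insert (n - 1) {0..<n - 1}" using n by auto
    also have "(\<Sum>j\<in>insert (n - 1) {0..<n - 1}. (if j < n - 1 then of_bool (i = j) else of_int (r $ i)) * x $ j)
      = of_int (r $ i) * x $ (n - 1) + (\<Sum>j\<in>{0..<n - 1}. (if j < n - 1 then of_bool (i = j) else of_int (r $ i)) * x $ j)"
      by (subst sum.insert) auto
    also have "(\<Sum>j\<in>{0..<n - 1}. (if j < n - 1 then of_bool (i = j) else of_int (r $ i)) * x $ j)
      = (\<Sum>j\<in>{0..<n - 1}. if j = i then x $ j else 0)"
      by (intro sum.cong) auto
    also have "\<dots> = (if i < n - 1 then x $ i else 0)" by simp
    finally show ?thesis by simp
  qed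
  show ?thesis
  proof (intro equalityI subsetI)
    fix z assume "z \<in> lattice_points n (pos ?R)"
    then obtain x where zc: "z \<in> carrier_vec n" and zx: "map_vec real_of_int z = ?R *\<^sub>v x"
      and x: "x \<in> carrier_vec n" "\<And>i. i < n \<Longrightarrow> 0 \<le> x $ i"
      unfolding lattice_points_def pos_def dim by auto
    have zi: "real_of_int (z $ i) = (if i < n - 1 then x $ i else 0) + of_int (r $ i) * x $ (n - 1)" if "i < n" for i
      using mult[OF x(1) that] zc that arg_cong[OF zx, of "\<lambda>v. v $ i"] by simp
    have zn: "real_of_int (z $ (n - 1)) = of_int D * x $ (n - 1)" using zi[of "n - 1"] n last by simp
    have "0 \<le> real_of_int (z $ (n - 1))" unfolding zn using x(2)[of "n - 1"] n D by simp
    moreover have "z $ (n - 1) * r $ i \<le> D * z $ i" if i: "i < n - 1" for i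
    proof -
      have "real_of_int (D * z $ i - z $ (n - 1) * r $ i) = of_int D * x $ i"
        using zi[of i] zn i by (simp add: algebra_simps)
      then have "0 \<le> real_of_int (D * z $ i - z $ (n - 1) * r $ i)" using x(2)[of i] i D by simp
      then show ?thesis by (simp only: of_int_0_le_iff)
    qed
    ultimately show "z \<in> L" unfolding L_def using zc by auto
  next
    fix z assume z: "z \<in> L"
    define x where "x = vec n (\<lambda>i. if i < n - 1 then of_int (z $ i) - of_int (r $ i) * of_int (z $ (n - 1)) / of_int D
      else real_of_int (z $ (n - 1)) / of_int D)"
    have x: "x \<in> carrier_vec n" unfolding x_def by simp
    have "map_vec real_of_int z = ?R *\<^sub>v x"
    proof (rule eq_vecI)
      fix i assume "i < dim_vec (?R *\<^sub>v x)"
      then have i: "i < n" using dim by simp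
      then show "map_vec real_of_int z $ i = (?R *\<^sub>v x) $ i"
      proof (cases "i < n - 1")
        case True
        then show ?thesis using z n i unfolding mult[OF x i] unfolding L_def x_def by auto
      next
        case False
        then have "i = n - 1" using i by simp
        then show ?thesis using z n D last unfolding mult[OF x i] unfolding L_def x_def by auto
      qed
    qed (use z dim in \<open>auto simp: L_def\<close>)
    moreover have "0 \<le> x $ i" if i: "i < n" for i
    proof (cases "i < n - 1")
      case True
      then have "z $ (n - 1) * r $ i \<le> D * z $ i" using z unfolding L_def by simp
      then have "real_of_int (z $ (n - 1) * r $ i) \<le> of_int (D * z $ i)" by (simp only: of_int_le_iff)
      then show ?thesis using True D i unfolding x_def by (simp add: field_simps)
    next
      case False
      then show ?thesis using z D i unfolding x_def L_def by simp
    qed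
    ultimately show "z \<in> lattice_points n (pos ?R)"
      unfolding lattice_points_def pos_def dim using z x by (auto simp: L_def)
  qed
qed

text \<open>
  The indecomposable elements of the monoid \<open>L\<close>. Integer vectors carry no zero element that is common to all dimensions, so
  \<open>indecomposable\<close> does not apply here.
\<close>

definition irr :: "int vec set"
  where "irr = {z \<in> L. z \<noteq> 0\<^sub>v n \<and> (\<forall>p\<in>L. \<forall>q\<in>L. z = p + q \<longrightarrow> p = 0\<^sub>v n \<or> q = 0\<^sub>v n)}"

lemma irr_carrier: "irr \<subseteq> carrier_vec n"
  unfolding irr_def L_def by auto

lemma L_sum:
  fixes c :: "'a \<Rightarrow> nat"
  assumes "w \<in> carrier_vec n" "\<And>i. i \<in> A \<Longrightarrow> h i \<in> L"
    "\<And>j. j < n \<Longrightarrow> w $ j = (\<Sum>i\<in>A. int (c i) * h i $ j)"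
  shows "w \<in> L"
proof -
  have n1: "w $ (n - 1) = (\<Sum>i\<in>A. int (c i) * h i $ (n - 1))" using assms(3) n by simp
  have "0 \<le> w $ (n - 1)"
    unfolding n1 using assms(2) by (intro sum_nonneg) (auto simp: L_def)
  moreover have "w $ (n - 1) * r $ j \<le> D * w $ j" if j: "j < n - 1" for j
  proof -
    have "w $ (n - 1) * r $ j = (\<Sum>i\<in>A. int (c i) * (h i $ (n - 1) * r $ j))"
      unfolding n1 by (simp add: sum_distrib_right mult.assoc)
    also have "\<dots> \<le> (\<Sum>i\<in>A. int (c i) * (D * h i $ j))"
      using assms(2) j by (intro sum_mono mult_left_mono) (auto simp: L_def)
    also have "\<dots> = D * w $ j"
      using assms(3)[of j] j by (simp add: sum_distrib_left ac_simps)
    finally show ?thesis .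
  qed
  ultimately show ?thesis using assms(1) unfolding L_def by simp
qed

lemma irr_minus:
  assumes h: "h \<in> irr" and e: "e \<in> L" "e \<noteq> 0\<^sub>v n" "h - e \<in> L"
  shows "h = e"
proof -
  have c: "h \<in> carrier_vec n" "e \<in> carrier_vec n" using h e irr_carrier L_carrier by auto
  have "h = e + (h - e)" using c by (intro eq_vecI) auto
  then have "h - e = 0\<^sub>v n" using h e unfolding irr_def by blast
  then have "(h - e) $ i = 0" if "i < n" for i using that by simp
  then show ?thesis using c by (intro eq_vecI) auto
qed

text \<open>
  Some term of a representation of an indecomposable point is non-zero; splitting off one copy leaves a remainder in \<open>L\<close>, which must be zero.
\<close>

lemma irr_in_generating:
  assumes "generates_lattice_points n C H" "lattice_points n C = L"
  shows "irr \<subseteq> H"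
proof
  fix z assume z: "z \<in> irr"
  have H: "H \<subseteq> L" "H \<subseteq> carrier_vec n" using assms L_carrier unfolding generates_lattice_points_def by auto
  have zL: "z \<in> L" "z \<in> carrier_vec n" "z \<noteq> 0\<^sub>v n" using z L_carrier unfolding irr_def by auto
  then obtain k where "nonneg_int_comb n H k z"
    using assms unfolding generates_lattice_points_def by auto
  then obtain c :: "nat \<Rightarrow> nat" and h where "\<forall>i\<in>{1..k}. h i \<in> H"
    and "\<forall>j<n. z $ j = (\<Sum>i\<in>{1..k}. int (c i) * h i $ j)"
    unfolding nonneg_int_comb_iff[OF H(2)] by (elim exE conjE)
  then have h: "\<And>i. i \<in> {1..k} \<Longrightarrow> h i \<in> H"
    and zs: "\<And>j. j < n \<Longrightarrow> z $ j = (\<Sum>i\<in>{1..k}. int (c i) * h i $ j)" by simp_all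
  obtain j where j: "j < n" "z $ j \<noteq> 0" using zL eq_vecI[of z "0\<^sub>v n"] by auto
  have "\<exists>i\<in>{1..k}. int (c i) * h i $ j \<noteq> 0"
  proof (rule ccontr)
    assume "\<not> ?thesis"
    then have "(\<Sum>i\<in>{1..k}. int (c i) * h i $ j) = 0" by (intro sum.neutral) blast
    then show False using zs[OF j(1)] j(2) by simp
  qed
  then obtain i where i: "i \<in> {1..k}" "int (c i) * h i $ j \<noteq> 0" by (elim bexE)
  have hi: "h i \<in> L" "h i \<in> carrier_vec n" using h[OF i(1)] H by auto
  have "h i \<noteq> 0\<^sub>v n" using i(2) j by auto
  moreover have "z - h i \<in> L"
  proof (rule L_sum[where A = "{1..k}" and h = h and c = "c(i := c i - 1)"])
    show "z - h i \<in> carrier_vec n" using zL hi by simp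
    show "h i' \<in> L" if "i' \<in> {1..k}" for i' using h[OF that] H by auto
    fix j' assume j': "j' < n"
    have "0 < c i" using i(2) by (cases "c i") auto
    then obtain c' where "c i = Suc c'" using gr0_implies_Suc by blast
    then have ci: "int (c i) * h i $ j' = int (c i - 1) * h i $ j' + h i $ j'" by (simp add: distrib_right)
    have "(z - h i) $ j' = (\<Sum>i\<in>{1..k}. int (c i) * h i $ j') - h i $ j'"
      using zs[OF j'] zL hi j' by simp
    also have "(\<Sum>i\<in>{1..k}. int (c i) * h i $ j')
      = int (c i) * h i $ j' + (\<Sum>i\<in>{1..k} - {i}. int (c i) * h i $ j')"
      using i(1) by (intro sum.remove) auto
    also have "(\<Sum>i\<in>{1..k} - {i}. int (c i) * h i $ j') = (\<Sum>l\<in>{1..k} - {i}. int ((c(i := c i - 1)) l) * h l $ j')"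
      by (intro sum.cong) auto
    also have "int (c i) * h i $ j' + \<dots> - h i $ j'
      = int ((c(i := c i - 1)) i) * h i $ j' + (\<Sum>l\<in>{1..k} - {i}. int ((c(i := c i - 1)) l) * h l $ j')"
      using ci by simp
    also have "\<dots> = (\<Sum>l\<in>{1..k}. int ((c(i := c i - 1)) l) * h l $ j')"
      using i(1) by (intro sum.remove[symmetric]) auto
    finally show "(z - h i) $ j' = (\<Sum>l\<in>{1..k}. int ((c(i := c i - 1)) l) * h l $ j')" .
  qed
  ultimately have "z = h i" using irr_minus[OF z hi(1)] by simp
  then show "z \<in> H" using h[OF i(1)] by simp
qed

lemma hilbert_basis_eq_irr:
  assumes L: "lattice_points n C = L" and gen: "\<And>z. z \<in> L \<Longrightarrow> \<exists>k. nonneg_int_comb n irr k z"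
  shows "hilbert_basis n C = irr"
proof -
  have g: "generates_lattice_points n C irr"
    using gen unfolding generates_lattice_points_def L by (auto simp: irr_def)
  show ?thesis
    unfolding hilbert_basis_def
  proof (rule the_equality)
    show "generates_lattice_points n C irr \<and> (\<forall>H'. H' \<subset> irr \<longrightarrow> \<not> generates_lattice_points n C H')"
      using g irr_in_generating[OF _ L] by blast
    fix H assume H: "generates_lattice_points n C H \<and> (\<forall>H'. H' \<subset> H \<longrightarrow> \<not> generates_lattice_points n C H')"
    then have "irr \<subseteq> H" using irr_in_generating[OF _ L] by blast
    then show "H = irr" using H g by blast
  qed
qed

definition e :: "nat \<Rightarrow> int vec"
  where "e i = unit_vec n i"

text \<open>
  The lowest lattice point of height \<open>s\<close> in the cone.
\<close>

definition g :: "int \<Rightarrow> int vec"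
  where "g s = vec n (\<lambda>i. if i < n - 1 then ceil_div (s * r $ i) D else s)"

lemma e_L: "i < n - 1 \<Longrightarrow> e i \<in> L"
  unfolding L_def e_def using D by auto

lemma e_nonzero: "i < n \<Longrightarrow> e i \<noteq> 0\<^sub>v n"
  unfolding e_def by (auto dest: arg_cong[where f = "\<lambda>v. v $ i"])

lemma e_irr:
  assumes i: "i < n - 1"
  shows "e i \<in> irr"
  unfolding irr_def
proof (intro CollectI conjI ballI impI)
  show "e i \<in> L" "e i \<noteq> 0\<^sub>v n" using e_L[OF i] e_nonzero[of i] i by auto
  fix p q assume p: "p \<in> L" and q: "q \<in> L" and eq: "e i = p + q"
  have c: "p \<in> carrier_vec n" "q \<in> carrier_vec n" using p q L_carrier by auto
  have sum: "p $ j + q $ j = of_bool (i = j)" if "j < n" for j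
    using arg_cong[OF eq, of "\<lambda>v. v $ j"] that i c unfolding e_def by (auto split: if_splits)
  have last: "p $ (n - 1) = 0" "q $ (n - 1) = 0"
    using sum[of "n - 1"] i p q unfolding L_def by auto
  have nn: "0 \<le> p $ j" "0 \<le> q $ j" if "j < n" for j
  proof -
    have "0 \<le> D * p $ j" "0 \<le> D * q $ j"
    proof -
      have "p $ (n - 1) * r $ j \<le> D * p $ j" "q $ (n - 1) * r $ j \<le> D * q $ j" if "j < n - 1"
        using p q that unfolding L_def by blast+
      moreover have "j = n - 1" if "\<not> j < n - 1" using that \<open>j < n\<close> by simp
      ultimately show "0 \<le> D * p $ j" "0 \<le> D * q $ j" using last by (cases "j < n - 1"; simp)+
    qed
    then show "0 \<le> p $ j" "0 \<le> q $ j" using D by (simp_all add: zero_le_mult_iff)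
  qed
  have z: "j \<noteq> i \<Longrightarrow> p $ j = 0 \<and> q $ j = 0" if "j < n" for j using nn[OF that] sum[OF that] by auto
  have "i < n" using i by simp
  have "p $ i + q $ i = 1" using sum[OF \<open>i < n\<close>] by simp
  then have "p $ i = 0 \<or> q $ i = 0" using nn[OF \<open>i < n\<close>] by linarith
  then show "p = 0\<^sub>v n \<or> q = 0\<^sub>v n"
  proof
    assume "p $ i = 0"
    then have "p $ j = 0" if "j < n" for j using z[OF that] by (cases "j = i") simp_all
    then have "p = 0\<^sub>v n" using c by (intro eq_vecI) simp_all
    then show ?thesis ..
  next
    assume "q $ i = 0"
    then have "q $ j = 0" if "j < n" for j using z[OF that] by (cases "j = i") simp_all
    then have "q = 0\<^sub>v n" using c by (intro eq_vecI) simp_all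
    then show ?thesis ..
  qed
qed

lemma D0: "0 < D" using D by simp

lemma L_ceil:
  assumes "z \<in> L" "i < n - 1"
  shows "ceil_div (z $ (n - 1) * r $ i) D \<le> z $ i"
  using assms unfolding L_def by (simp add: ceil_div_le_iff D0)

lemma g_index: "i < n - 1 \<Longrightarrow> g s $ i = ceil_div (s * r $ i) D" "g s $ (n - 1) = s" "g s \<in> carrier_vec n"
  unfolding g_def using n by auto

lemma g_L: "0 \<le> s \<Longrightarrow> g s \<in> L"
  unfolding L_def using ceil_div_ge[OF D0] by (simp add: g_index)

lemma g_D: "g D = r"
proof (rule eq_vecI)
  fix i assume "i < dim_vec r"
  then have "i < n" using r by simp
  then show "g D $ i = r $ i"
    using last D0 g_index(2)[of D] by (cases "i = n - 1") (auto simp: g_def ceil_div_mult_self)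
qed (use r in \<open>simp add: g_def\<close>)

text \<open>
  A summand of height 0 is zero, because the other one is already at least as large as the lowest point \<open>g s\<close>.
\<close>

lemma g_irr:
  assumes s: "0 < s"
    and defect: "\<And>p q. 0 < p $ (n - 1) \<Longrightarrow> 0 < q $ (n - 1) \<Longrightarrow> p $ (n - 1) + q $ (n - 1) = s \<Longrightarrow>
      p \<in> L \<Longrightarrow> q \<in> L \<Longrightarrow> \<exists>i<n - 1. ceil_div (s * r $ i) D < p $ i + q $ i"
  shows "g s \<in> irr"
  unfolding irr_def
proof (intro CollectI conjI ballI impI)
  show "g s \<in> L" using g_L s by simp
  show "g s \<noteq> 0\<^sub>v n" using g_index(2)[of s] s n by auto
  fix p q assume p: "p \<in> L" and q: "q \<in> L" and eq: "g s = p + q"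
  have c: "p \<in> carrier_vec n" "q \<in> carrier_vec n" using p q L_carrier by auto
  have sum: "g s $ j = p $ j + q $ j" if "j < n" for j
    using arg_cong[OF eq, of "\<lambda>v. v $ j"] that c by auto
  have n1: "p $ (n - 1) + q $ (n - 1) = s" using sum[of "n - 1"] n g_index(2) by simp
  have zero: "p' = 0\<^sub>v n" if p': "p' \<in> L" "q' \<in> L" "p' $ (n - 1) = 0" "\<And>j. j < n \<Longrightarrow> g s $ j = p' $ j + q' $ j" for p' q'
  proof (rule eq_vecI)
    fix j assume "j < dim_vec (0\<^sub>v n :: int vec)"
    then have j: "j < n" by simp
    have qs: "q' $ (n - 1) = s" using p'(3) p'(4)[of "n - 1"] n g_index(2) by simp
    show "p' $ j = 0\<^sub>v n $ j"
    proof (cases "j < n - 1")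
      case True
      have "0 \<le> D * p' $ j" using p' True unfolding L_def by auto
      then have "0 \<le> p' $ j" using D0 by (simp add: zero_le_mult_iff)
      moreover have "g s $ j \<le> q' $ j" using L_ceil[OF p'(2) True] qs g_index(1)[OF True] by simp
      ultimately show ?thesis using p'(4)[OF j] j by simp
    next
      case False
      then have "j = n - 1" using j by simp
      then show ?thesis using p'(3) j by simp
    qed
  qed (use p' L_carrier in auto)
  show "p = 0\<^sub>v n \<or> q = 0\<^sub>v n"
  proof (rule ccontr)
    assume no: "\<not> ?thesis"
    have "p $ (n - 1) \<noteq> 0" using zero[OF p q _ sum] no by auto
    moreover have "q $ (n - 1) \<noteq> 0" using zero[OF q p] sum no by (auto simp: add.commute)
    ultimately have "0 < p $ (n - 1)" "0 < q $ (n - 1)" using p q unfolding L_def by auto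
    from defect[OF this n1 p q] obtain i where "i < n - 1" "ceil_div (s * r $ i) D < p $ i + q $ i" by auto
    moreover from this have "i < n" by simp
    ultimately show False using sum[of i] g_index(1)[of i s] by simp
  qed
qed

definition J :: "int set"
  where "J = (\<lambda>i. r $ i) ` {..<n - 1} - {0, D - 1}"

lemma g_irreducible_height:
  assumes s: "irreducible_height D J s"
  shows "g s \<in> irr"
proof (rule g_irr)
  show "0 < s" using s unfolding irreducible_height_def by simp
  fix p q assume pq: "0 < p $ (n - 1)" "0 < q $ (n - 1)" "p $ (n - 1) + q $ (n - 1) = s" "p \<in> L" "q \<in> L"
  then obtain a where "a \<in> J" "ceil_div (s * a) D < ceil_div (p $ (n - 1) * a) D + ceil_div (q $ (n - 1) * a) D"
    using s unfolding irreducible_height_def by blast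
  then obtain i where "i < n - 1"
    "ceil_div (s * r $ i) D < ceil_div (p $ (n - 1) * r $ i) D + ceil_div (q $ (n - 1) * r $ i) D"
    unfolding J_def by auto
  moreover from this have "ceil_div (p $ (n - 1) * r $ i) D \<le> p $ i" "ceil_div (q $ (n - 1) * r $ i) D \<le> q $ i"
    using L_ceil pq by auto
  ultimately show "\<exists>i<n - 1. ceil_div (s * r $ i) D < p $ i + q $ i"
    by (intro exI[of _ i]) linarith
qed

text \<open>
  Points of height less than \<open>D\<close> have coordinate \<open>i\<close> at least as large as their height, so two of them with heights
  adding up to \<open>D\<close> exceed the coordinate \<open>D - 1\<close> of \<open>g D\<close>.
\<close>

lemma g_D_irr:
  assumes i: "i < n - 1" "r $ i = D - 1"
  shows "g D \<in> irr"
proof (rule g_irr[OF D0])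
  fix p q assume pq: "0 < p $ (n - 1)" "0 < q $ (n - 1)" "p $ (n - 1) + q $ (n - 1) = D" "p \<in> L" "q \<in> L"
  have ge: "t $ (n - 1) \<le> t $ i" if t: "t \<in> L" "t $ (n - 1) < D" for t
  proof -
    have "t $ (n - 1) * (D - 1) \<le> D * t $ i" using t i unfolding L_def by auto
    then have "D * (t $ (n - 1)) < D * (t $ i + 1)" using t(2) by (simp add: algebra_simps)
    then show ?thesis using D0 by (simp add: mult_less_cancel_left_pos)
  qed
  have "D \<le> p $ i + q $ i" using ge[OF pq(4)] ge[OF pq(5)] pq by linarith
  moreover have "ceil_div (D * r $ i) D = D - 1" using i D0 by (simp add: ceil_div_mult_self)
  ultimately show "\<exists>i<n - 1. ceil_div (D * r $ i) D < p $ i + q $ i" using i by (intro exI[of _ i]) auto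
qed

end

section \<open>Counting summands\<close>

lemma sum_eq_one_int:
  fixes f :: "'a \<Rightarrow> int"
  assumes "finite A" "\<And>a. a \<in> A \<Longrightarrow> 0 \<le> f a" "(\<Sum>a\<in>A. f a) = 1"
  obtains b where "b \<in> A" "f b = 1" "\<And>a. a \<in> A \<Longrightarrow> a \<noteq> b \<Longrightarrow> f a = 0"
proof -
  have "\<exists>b\<in>A. f b \<noteq> 0" using assms(3) by (metis sum.neutral zero_neq_one)
  then obtain b where b: "b \<in> A" "f b \<noteq> 0" by (elim bexE)
  have split: "f b + (\<Sum>a\<in>A - {b}. f a) = 1" using assms(1,3) b(1) by (simp add: sum.remove[symmetric])
  have nn: "0 \<le> (\<Sum>a\<in>A - {b}. f a)" using assms(2) by (intro sum_nonneg) auto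
  have "0 < f b" using assms(2)[OF b(1)] b(2) by linarith
  then have one: "f b = 1" and zero: "(\<Sum>a\<in>A - {b}. f a) = 0" using split nn by linarith+
  have "\<forall>a\<in>A - {b}. f a = 0" using zero assms by (subst (asm) sum_nonneg_eq_0_iff) auto
  then show thesis using that[OF b(1) one] by blast
qed

lemma sum_merge_term:
  fixes m :: "int \<Rightarrow> nat" and f :: "int \<Rightarrow> int"
  assumes "finite S"
  shows "(\<Sum>s\<in>insert d S. int ((if s \<in> S then m s else 0) + (if s = d then p else 0)) * f s)
    = (\<Sum>s\<in>S. int (m s) * f s) + int p * f d"
proof -
  have "(\<Sum>s\<in>insert d S. int ((if s \<in> S then m s else 0) + (if s = d then p else 0)) * f s)
    = (\<Sum>s\<in>insert d S. (if s \<in> S then int (m s) * f s else 0)) + (\<Sum>s\<in>insert d S. if s = d then int p * f s else 0)"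
    unfolding sum.distrib[symmetric] by (intro sum.cong) (auto simp: distrib_right)
  also have "(\<Sum>s\<in>insert d S. (if s \<in> S then int (m s) * f s else 0)) = (\<Sum>s\<in>S. if s \<in> S then int (m s) * f s else 0)"
    using assms by (intro sum.mono_neutral_right) auto
  also have "\<dots> = (\<Sum>s\<in>S. int (m s) * f s)" by (intro sum.cong) auto
  also have "(\<Sum>s\<in>insert d S. if s = d then int p * f s else 0) = int p * f d"
    using assms by simp
  finally show ?thesis .
qed

context unit_cone
begin

text \<open>
  For each value in \<open>J\<close>, a coordinate where \<open>y\<close> is smallest represents all coordinates with that value of \<open>r\<close>.
  If \<open>few_irreducible_heights\<close> is exact for a value, its representative is tight, so a coordinate is saved for each unit vector
  saved there. The flag \<open>k\<close> announces one more generator \<open>g D\<close>; it costs nothing if \<open>D \<in> S\<close>, and otherwise a coordinate with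
  \<open>r $ i = D - 1\<close> and \<open>y i = t\<close> is tight as well.
\<close>

lemma lift_heights:
  assumes few: "card J \<le> 2"
    and t: "0 \<le> t" and ineq: "\<And>i. i < n - 1 \<Longrightarrow> t * r $ i \<le> D * y i"
    and top: "\<And>i. i < n - 1 \<Longrightarrow> r $ i = D - 1 \<Longrightarrow> r $ i \<noteq> 0 \<Longrightarrow> t \<le> y i"
    and k: "k \<Longrightarrow> \<exists>i<n - 1. r $ i = D - 1 \<and> r $ i \<noteq> 0 \<and> y i = t"
  shows "\<exists>S m. finite S \<and> (\<forall>s\<in>S. irreducible_height D J s) \<and> t = (\<Sum>s\<in>S. int (m s) * s) \<and>
    (\<forall>i<n - 1. (\<Sum>s\<in>S. int (m s) * ceil_div (s * r $ i) D) \<le> y i) \<and>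
    card S + of_bool (k \<and> D \<notin> S) + card {i. i < n - 1 \<and> (\<Sum>s\<in>S. int (m s) * ceil_div (s * r $ i) D) < y i} \<le> n"
proof -
  define x where "x a = Min (y ` {i. i < n - 1 \<and> r $ i = a})" for a
  have finJ: "finite J" unfolding J_def by simp
  have x_le: "x (r $ i) \<le> y i" if "i < n - 1" for i
    unfolding x_def using that by (intro Min_le) auto
  have x_attained: "\<exists>i<n - 1. r $ i = a \<and> y i = x a" if "a \<in> J" for a
  proof -
    have "x a \<in> y ` {i. i < n - 1 \<and> r $ i = a}"
      unfolding x_def using that by (intro Min_in) (auto simp: J_def)
    then show ?thesis by auto
  qed
  have "\<forall>a\<in>J. t * a \<le> D * x a"
  proof
    fix a assume "a \<in> J"
    then obtain i where "i < n - 1" "r $ i = a" "y i = x a" using x_attained by blast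
    then show "t * a \<le> D * x a" using ineq[of i] by simp
  qed
  from few_irreducible_heights[OF D0 t finJ few this] obtain S m where
    S: "finite S" "\<forall>s\<in>S. irreducible_height D J s" and tS: "t = (\<Sum>s\<in>S. int (m s) * s)"
    and le_x: "\<forall>a\<in>J. (\<Sum>s\<in>S. int (m s) * ceil_div (s * a) D) \<le> x a"
    and card_S: "card S + card {a \<in> J. (\<Sum>s\<in>S. int (m s) * ceil_div (s * a) D) < x a} \<le> card J + 1"
    by (elim exE conjE)
  have S_range: "0 < s" "s \<le> D" if "s \<in> S" for s using S(2) that unfolding irreducible_height_def by auto
  define q where "q a = (\<Sum>s\<in>S. int (m s) * ceil_div (s * a) D)" for a
  have top_ceil: "ceil_div (s * (D - 1)) D = s" if "0 < s" "s < D" for s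
    using that by (intro ceil_div_unique[symmetric] D0) (simp_all add: algebra_simps)
  have le_y: "q (r $ i) \<le> y i" if i: "i < n - 1" for i
  proof -
    consider "r $ i \<in> J" | "r $ i = 0" | "r $ i = D - 1" "r $ i \<noteq> 0" unfolding J_def using i by blast
    then show ?thesis
    proof cases
      case 1
      then show ?thesis using le_x x_le[OF i] unfolding q_def by force
    next
      case 2
      have "0 \<le> D * y i" using ineq[OF i] 2 by simp
      then have "0 \<le> y i" using D0 by (simp add: zero_le_mult_iff)
      then show ?thesis using 2 unfolding q_def by (simp add: ceil_div_def)
    next
      case 3
      have "q (r $ i) \<le> (\<Sum>s\<in>S. int (m s) * s)"
        unfolding q_def using S_range 3
        by (intro sum_mono mult_left_mono) (auto simp: ceil_div_le_iff D0 algebra_simps)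
      then show ?thesis using top[OF i 3] tS by simp
    qed
  qed
  obtain \<iota> where \<iota>: "\<And>a. a \<in> J \<Longrightarrow> \<iota> a < n - 1 \<and> r $ \<iota> a = a \<and> y (\<iota> a) = x a"
    using x_attained by metis
  define B where "B = {i. i < n - 1 \<and> q (r $ i) < y i}"
  define T where "T = {a \<in> J. \<not> q a < x a}"
  define E where "E = {i. i < n - 1 \<and> k \<and> D \<notin> S \<and> r $ i = D - 1 \<and> r $ i \<noteq> 0 \<and> y i = t}"
  have E_tight: "\<not> q (r $ i) < y i" if "i \<in> E" for i
  proof -
    have "q (r $ i) = (\<Sum>s\<in>S. int (m s) * s)"
      unfolding q_def
    proof (intro sum.cong refl)
      fix s assume s: "s \<in> S"
      then have "s < D" using S_range[OF s] that unfolding E_def by (cases "s = D") auto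
      then show "int (m s) * ceil_div (s * r $ i) D = int (m s) * s"
        using top_ceil[of s] S_range[OF s] that unfolding E_def by simp
    qed
    then show ?thesis using tS that unfolding E_def by simp
  qed
  have inj: "inj_on \<iota> J" using \<iota> by (metis inj_onI)
  have sub: "B \<union> \<iota> ` T \<union> E \<subseteq> {..<n - 1}" unfolding B_def T_def E_def using \<iota> by auto
  have tight: "i \<notin> B" if "i \<in> \<iota> ` T" for i
  proof -
    obtain a where "a \<in> J" "\<not> q a < x a" "i = \<iota> a" using \<open>i \<in> \<iota> ` T\<close> unfolding T_def by auto
    then show ?thesis using \<iota>[of a] unfolding B_def by simp
  qed
  have disj: "B \<inter> \<iota> ` T = {}" "(B \<union> \<iota> ` T) \<inter> E = {}"
  proof -
    show "B \<inter> \<iota> ` T = {}" using tight by blast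
    have "i \<notin> E" if "i \<in> \<iota> ` T" for i
    proof -
      obtain a where "a \<in> J" "i = \<iota> a" using \<open>i \<in> \<iota> ` T\<close> unfolding T_def by auto
      then have "r $ i \<in> J" using \<iota>[of a] by simp
      then show ?thesis unfolding E_def J_def by auto
    qed
    moreover have "i \<notin> E" if "i \<in> B" for i using E_tight[of i] that unfolding B_def by auto
    ultimately show "(B \<union> \<iota> ` T) \<inter> E = {}" by blast
  qed
  have fin: "finite B" "finite (\<iota> ` T)" "finite E" using sub by (auto intro: finite_subset)
  have "card B + card (\<iota> ` T) + card E = card (B \<union> \<iota> ` T \<union> E)"
    using fin disj by (simp add: card_Un_disjoint)
  also have "\<dots> \<le> n - 1" using card_mono[OF _ sub] by simp
  finally have c1: "card B + card (\<iota> ` T) + card E \<le> n - 1" .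
  have cT: "card (\<iota> ` T) = card T"
    by (intro card_image inj_on_subset[OF inj]) (auto simp: T_def)
  have cJ: "card J = card T + card {a \<in> J. q a < x a}"
  proof -
    have "J = T \<union> {a \<in> J. q a < x a}" "T \<inter> {a \<in> J. q a < x a} = {}" unfolding T_def by auto
    then show ?thesis using finJ card_Un_disjoint[of T "{a \<in> J. q a < x a}"] by (simp add: T_def)
  qed
  have cE: "of_bool (k \<and> D \<notin> S) \<le> card E"
  proof (cases "k \<and> D \<notin> S")
    case True
    then have "E \<noteq> {}" using k unfolding E_def by auto
    then have "0 < card E" using fin by (simp add: card_gt_0_iff)
    then show ?thesis by simp
  qed auto
  have "card S + card {a \<in> J. q a < x a} \<le> card J + 1" using card_S unfolding q_def .
  then have "card S + of_bool (k \<and> D \<notin> S) + card B \<le> n"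
    using c1 cT cJ cE n by linarith
  then show ?thesis
    using S tS le_y unfolding q_def B_def by (intro exI[of _ S] exI[of _ m]) simp
qed

text \<open>
  Let \<open>p\<close> be the largest amount by which a coordinate with \<open>r $ i = D - 1 \<noteq> 0\<close> falls short of the height. Subtracting \<open>p\<close> copies of
  \<open>r = g D\<close> removes the shortfall, since each copy lowers the height by \<open>D\<close> and such a coordinate by \<open>D - 1\<close>.
\<close>

lemma few_summands:
  assumes few: "card J \<le> 2" and z: "z \<in> L"
  shows "\<exists>S m. finite S \<and> (\<forall>s\<in>S. g s \<in> irr) \<and> z $ (n - 1) = (\<Sum>s\<in>S. int (m s) * s) \<and>
    (\<forall>i<n - 1. (\<Sum>s\<in>S. int (m s) * ceil_div (s * r $ i) D) \<le> z $ i) \<and>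
    card S + card {i. i < n - 1 \<and> (\<Sum>s\<in>S. int (m s) * ceil_div (s * r $ i) D) < z $ i} \<le> n"
proof -
  define t where "t = z $ (n - 1)"
  define W where "W = {i. i < n - 1 \<and> r $ i = D - 1 \<and> r $ i \<noteq> 0}"
  define p where "p = Max (insert 0 ((\<lambda>i. t - z $ i) ` W))"
  have finW: "finite W" unfolding W_def by simp
  have p_ge: "0 \<le> p" "\<And>i. i \<in> W \<Longrightarrow> t - z $ i \<le> p" unfolding p_def using finW by (auto intro: Max_ge)
  have "p \<in> insert 0 ((\<lambda>i. t - z $ i) ` W)" unfolding p_def using finW by (intro Max_in) auto
  then have p_attained: "\<exists>i\<in>W. p = t - z $ i" if "0 < p" using that by auto
  have t0: "0 \<le> t" and tz: "\<And>i. i < n - 1 \<Longrightarrow> t * r $ i \<le> D * z $ i" using z unfolding L_def t_def by auto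
  have pt: "D * p \<le> t"
  proof (cases "0 < p")
    case True
    then obtain i where i: "i \<in> W" "p = t - z $ i" using p_attained by auto
    then have "t * (D - 1) \<le> D * z $ i" using tz[of i] unfolding W_def by auto
    then show ?thesis unfolding i(2) by (simp add: algebra_simps)
  next
    case False
    then show ?thesis using p_ge(1) t0 by simp
  qed
  have ex: "\<exists>S m. finite S \<and> (\<forall>s\<in>S. irreducible_height D J s) \<and> t - D * p = (\<Sum>s\<in>S. int (m s) * s) \<and>
    (\<forall>i<n - 1. (\<Sum>s\<in>S. int (m s) * ceil_div (s * r $ i) D) \<le> z $ i - p * r $ i) \<and>
    card S + of_bool (0 < p \<and> D \<notin> S)
      + card {i. i < n - 1 \<and> (\<Sum>s\<in>S. int (m s) * ceil_div (s * r $ i) D) < z $ i - p * r $ i} \<le> n"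
  proof (rule lift_heights[OF few])
    show "0 \<le> t - D * p" using pt by simp
    show "(t - D * p) * r $ i \<le> D * (z $ i - p * r $ i)" if "i < n - 1" for i
      using tz[OF that] by (simp add: algebra_simps)
    show "t - D * p \<le> z $ i - p * r $ i" if "i < n - 1" "r $ i = D - 1" "r $ i \<noteq> 0" for i
    proof -
      have "t - z $ i \<le> p" using p_ge(2)[of i] that unfolding W_def by simp
      then show ?thesis unfolding that(2) by (simp add: algebra_simps)
    qed
    show "\<exists>i<n - 1. r $ i = D - 1 \<and> r $ i \<noteq> 0 \<and> z $ i - p * r $ i = t - D * p" if p: "0 < p"
    proof -
      obtain i where i: "i \<in> W" "p = t - z $ i" using p_attained[OF p] by auto
      then have "z $ i - p * (D - 1) = t - D * p" by (simp add: algebra_simps)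
      then show ?thesis using i(1) unfolding W_def by auto
    qed
  qed
  then obtain S m where S: "finite S" "\<forall>s\<in>S. irreducible_height D J s"
    and tS: "t - D * p = (\<Sum>s\<in>S. int (m s) * s)"
    and zS: "\<forall>i<n - 1. (\<Sum>s\<in>S. int (m s) * ceil_div (s * r $ i) D) \<le> z $ i - p * r $ i"
    and cS: "card S + of_bool (0 < p \<and> D \<notin> S)
      + card {i. i < n - 1 \<and> (\<Sum>s\<in>S. int (m s) * ceil_div (s * r $ i) D) < z $ i - p * r $ i} \<le> n"
    by (elim exE conjE)
  have gS: "g s \<in> irr" if "s \<in> S" for s using g_irreducible_height S(2) that by blast
  show ?thesis
  proof (cases "0 < p")
    case False
    then have "p = 0" using p_ge(1) by simp
    then show ?thesis
      using S(1) gS tS zS cS unfolding t_def by (intro exI[of _ S] exI[of _ m]) simp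
  next
    case True
    define m' where "m' s = (if s \<in> S then m s else 0) + (if s = D then nat p else 0)" for s
    have merge: "(\<Sum>s\<in>insert D S. int (m' s) * f s) = (\<Sum>s\<in>S. int (m s) * f s) + p * f D" for f
      unfolding m'_def sum_merge_term[OF S(1)] using True by simp
    have gD: "g D \<in> irr" using p_attained[OF True] g_D_irr unfolding W_def by auto
    have "card (insert D S) = card S + of_bool (0 < p \<and> D \<notin> S)" using S(1) True by (simp add: card_insert_if)
    moreover have t': "t = (\<Sum>s\<in>insert D S. int (m' s) * s)"
      using tS unfolding merge by (simp add: algebra_simps)
    moreover have "(\<Sum>s\<in>insert D S. int (m' s) * ceil_div (s * r $ i) D)
      = (\<Sum>s\<in>S. int (m s) * ceil_div (s * r $ i) D) + p * r $ i" for i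
      unfolding merge by (simp add: ceil_div_mult_self D0)
    ultimately show ?thesis
      using S(1) gS gD zS cS unfolding t_def
      by (intro exI[of _ "insert D S"] exI[of _ m']) (simp add: algebra_simps)
  qed
qed

text \<open>
  The gaps that remain in the first \<open>n - 1\<close> coordinates are filled with unit vectors.
\<close>

lemma irr_comb_upper:
  assumes few: "card J \<le> 2" and z: "z \<in> L"
  shows "\<exists>k\<le>n. nonneg_int_comb n irr k z"
proof -
  obtain S m where S: "finite S" "\<forall>s\<in>S. g s \<in> irr" and t: "z $ (n - 1) = (\<Sum>s\<in>S. int (m s) * s)"
    and le: "\<forall>i<n - 1. (\<Sum>s\<in>S. int (m s) * ceil_div (s * r $ i) D) \<le> z $ i"
    and c: "card S + card {i. i < n - 1 \<and> (\<Sum>s\<in>S. int (m s) * ceil_div (s * r $ i) D) < z $ i} \<le> n"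
    using few_summands[OF assms] by (elim exE conjE)
  define q where "q i = (\<Sum>s\<in>S. int (m s) * ceil_div (s * r $ i) D)" for i
  define B where "B = {i. i < n - 1 \<and> q i < z $ i}"
  have finB: "finite B" unfolding B_def by simp
  have "nonneg_int_comb n irr (card (S <+> B)) z"
  proof (rule nonneg_int_comb_family[OF irr_carrier, where m = "case_sum m (\<lambda>i. nat (z $ i - q i))" and h = "case_sum g e"])
    show "finite (S <+> B)" using S(1) finB by (rule finite_Plus)
    show "case_sum g e a \<in> irr" if "a \<in> S <+> B" for a
      using that S(2) e_irr unfolding B_def by auto
    show "z \<in> carrier_vec n" using z L_carrier by auto
    fix j assume j: "j < n"
    have "(\<Sum>a\<in>S <+> B. int (case_sum m (\<lambda>i. nat (z $ i - q i)) a) * case_sum g e a $ j)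
      = (\<Sum>s\<in>S. int (m s) * g s $ j) + (\<Sum>i\<in>B. int (nat (z $ i - q i)) * e i $ j)"
      using S(1) finB by (simp add: sum.Plus)
    also have "(\<Sum>i\<in>B. int (nat (z $ i - q i)) * e i $ j) = (\<Sum>i\<in>B. if i = j then z $ i - q i else 0)"
      using j by (intro sum.cong) (auto simp: e_def B_def)
    also have "\<dots> = (if j \<in> B then z $ j - q j else 0)" using finB by simp
    also have "(\<Sum>s\<in>S. int (m s) * g s $ j) + \<dots> = z $ j"
    proof (cases "j < n - 1")
      case True
      then have "(\<Sum>s\<in>S. int (m s) * g s $ j) = q j" unfolding q_def by (simp add: g_index(1))
      moreover have "q j \<le> z $ j" using le True unfolding q_def by simp
      ultimately show ?thesis using True unfolding B_def by auto
    next
      case False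
      then have "j = n - 1" using j by simp
      then show ?thesis using t unfolding B_def by (simp add: g_index(2))
    qed
    finally show "z $ j = (\<Sum>a\<in>S <+> B. int (case_sum m (\<lambda>i. nat (z $ i - q i)) a) * case_sum g e a $ j)" by simp
  qed
  moreover have "card (S <+> B) \<le> n" using c S(1) finB unfolding B_def q_def by (simp add: card_Plus)
  ultimately show ?thesis by blast
qed

text \<open>
  This is \<open>g 1\<close> plus all unit vectors except the last.
\<close>

definition hard_point :: "int vec"
  where "hard_point = vec n (\<lambda>i. if i < n - 1 then ceil_div (r $ i) D + 1 else 1)"

lemma hard_point_index: "i < n - 1 \<Longrightarrow> hard_point $ i = ceil_div (r $ i) D + 1" "hard_point $ (n - 1) = 1"
  unfolding hard_point_def using n by auto

lemma hard_point_L: "hard_point \<in> L"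
proof -
  have "r $ i \<le> D * (ceil_div (r $ i) D + 1)" for i
    using ceil_div_ge[OF D0, of "r $ i"] D0 by (simp add: distrib_left)
  then show ?thesis unfolding L_def by (simp add: hard_point_index) (simp add: hard_point_def)
qed

text \<open>
  Exactly one summand has positive height. Its height is 1, so it does not exceed \<open>g 1\<close> in any coordinate, and in each coordinate the
  missing unit has to come from a summand of height 0, which can only be a unit vector.
\<close>

lemma irr_comb_lower:
  assumes "nonneg_int_comb n irr k hard_point"
  shows "n \<le> k"
proof -
  obtain c :: "nat \<Rightarrow> nat" and h where "\<forall>i\<in>{1..k}. h i \<in> irr"
    and "\<forall>j<n. hard_point $ j = (\<Sum>i\<in>{1..k}. int (c i) * h i $ j)"
    using assms unfolding nonneg_int_comb_iff[OF irr_carrier] by (elim exE conjE)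
  then have h: "\<And>i. i \<in> {1..k} \<Longrightarrow> h i \<in> irr"
    and zs: "\<And>j. j < n \<Longrightarrow> hard_point $ j = (\<Sum>i\<in>{1..k}. int (c i) * h i $ j)" by simp_all
  have hL: "h i \<in> L" "h i \<in> carrier_vec n" if "i \<in> {1..k}" for i
    using h[OF that] L_carrier unfolding irr_def by auto
  have "(\<Sum>i\<in>{1..k}. int (c i) * h i $ (n - 1)) = 1"
    using zs[of "n - 1"] n hard_point_index(2) by simp
  then obtain i0 where i0: "i0 \<in> {1..k}" "int (c i0) * h i0 $ (n - 1) = 1"
    and others: "\<And>i. i \<in> {1..k} \<Longrightarrow> i \<noteq> i0 \<Longrightarrow> int (c i) * h i $ (n - 1) = 0"
    using sum_eq_one_int[of "{1..k}" "\<lambda>i. int (c i) * h i $ (n - 1)"] hL unfolding L_def by auto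
  have "h i0 $ (n - 1) = 1" "int (c i0) = 1"
    using i0(2) hL(1)[OF i0(1)] zmult_eq_1_iff[of "int (c i0)" "h i0 $ (n - 1)"] unfolding L_def by auto
  have minus_e: "h i = e j" if i: "i \<in> {1..k}" and j: "j < n - 1"
    and ge: "h i $ (n - 1) * r $ j \<le> D * (h i $ j - 1)" for i j
  proof (rule irr_minus[OF h[OF i] e_L[OF j] e_nonzero])
    show "h i - e j \<in> L"
      using hL[OF i] j ge unfolding L_def e_def by auto
  qed (use j in simp)
  have i0_small: "h i0 $ j \<le> ceil_div (r $ j) D" if j: "j < n - 1" for j
  proof (rule ccontr)
    assume "\<not> ?thesis"
    then have "ceil_div (r $ j) D \<le> h i0 $ j - 1" by simp
    then have "h i0 $ (n - 1) * r $ j \<le> D * (h i0 $ j - 1)"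
      using \<open>h i0 $ (n - 1) = 1\<close> ceil_div_le_iff[OF D0, of "r $ j" "h i0 $ j - 1"] by simp
    then have "h i0 = e j" by (rule minus_e[OF i0(1) j])
    then show False using \<open>h i0 $ (n - 1) = 1\<close> j unfolding e_def by simp
  qed
  have "\<exists>i\<in>{1..k}. i \<noteq> i0 \<and> h i = e j" if j: "j < n - 1" for j
  proof (rule ccontr)
    assume none: "\<not> ?thesis"
    have "(\<Sum>i\<in>{1..k} - {i0}. int (c i) * h i $ j) \<le> 0"
    proof (intro sum_nonpos)
      fix i assume i: "i \<in> {1..k} - {i0}"
      show "int (c i) * h i $ j \<le> 0"
      proof (cases "c i = 0")
        case False
        then have last: "h i $ (n - 1) = 0" using others[of i] i by simp
        have "h i $ j \<le> 0"
        proof (rule ccontr)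
          assume "\<not> ?thesis"
          then have "h i = e j" using minus_e[of i j] i j last D0 by simp
          then show False using none i by blast
        qed
        then show ?thesis by (simp add: mult_nonneg_nonpos)
      qed simp
    qed
    moreover have "hard_point $ j = h i0 $ j + (\<Sum>i\<in>{1..k} - {i0}. int (c i) * h i $ j)"
      using zs[of j] j i0(1) \<open>int (c i0) = 1\<close> by (simp add: sum.remove[of "{1..k}" i0])
    ultimately show False using i0_small[OF j] hard_point_index(1)[OF j] by simp
  qed
  then have "\<forall>j\<in>{..<n - 1}. \<exists>i. i \<in> {1..k} \<and> i \<noteq> i0 \<and> h i = e j" by blast
  from bchoice[OF this] obtain f where "\<forall>j\<in>{..<n - 1}. f j \<in> {1..k} \<and> f j \<noteq> i0 \<and> h (f j) = e j"
    by (elim exE)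
  then have f: "f j \<in> {1..k} \<and> f j \<noteq> i0 \<and> h (f j) = e j" if "j < n - 1" for j using that by simp
  have inj: "inj_on f {..<n - 1}"
  proof (rule inj_onI)
    fix i j assume ij: "i \<in> {..<n - 1}" "j \<in> {..<n - 1}" "f i = f j"
    then have "e i = e j" using f[of i] f[of j] by simp
    then show "i = j" using ij arg_cong[of "e i" "e j" "\<lambda>v. v $ i"] unfolding e_def by (auto split: if_splits)
  qed
  have "f ` {..<n - 1} \<subseteq> {1..k} - {i0}"
  proof (rule image_subsetI)
    fix j assume "j \<in> {..<n - 1}"
    then show "f j \<in> {1..k} - {i0}" using f[of j] by simp
  qed
  then have "insert i0 (f ` {..<n - 1}) \<subseteq> {1..k}" "i0 \<notin> f ` {..<n - 1}" using i0(1) by blast+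
  then have "card (insert i0 (f ` {..<n - 1})) \<le> card {1..k}" by (intro card_mono) simp_all
  then have "card (insert i0 (f ` {..<n - 1})) \<le> k" by simp
  moreover have "card (insert i0 (f ` {..<n - 1})) = n"
    using \<open>i0 \<notin> f ` {..<n - 1}\<close> inj n by (simp add: card_image)
  ultimately show ?thesis by simp
qed

theorem ICR_eq:
  assumes few: "card J \<le> 2" and C: "lattice_points n C = L"
  shows "ICR n C = n"
proof -
  have hb: "hilbert_basis n C = irr"
    using irr_comb_upper[OF few] by (intro hilbert_basis_eq_irr[OF C]) blast
  define \<rho> where "\<rho> z = (LEAST k. nonneg_int_comb n irr k z)" for z
  have upper: "\<rho> z \<le> n" if z: "z \<in> L" for z
  proof -
    obtain k where "k \<le> n" "nonneg_int_comb n irr k z" using irr_comb_upper[OF few z] by auto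
    then show ?thesis unfolding \<rho>_def using Least_le[of "\<lambda>k. nonneg_int_comb n irr k z" k] by simp
  qed
  have "n \<le> \<rho> hard_point"
  proof -
    obtain k where "nonneg_int_comb n irr k hard_point" using irr_comb_upper[OF few hard_point_L] by auto
    then have "nonneg_int_comb n irr (\<rho> hard_point) hard_point" unfolding \<rho>_def by (rule LeastI)
    then show ?thesis by (rule irr_comb_lower)
  qed
  then have "\<rho> hard_point = n" using upper[OF hard_point_L] by simp
  then have "n \<in> \<rho> ` L" using hard_point_L by force
  moreover have "finite (\<rho> ` L)" by (rule finite_subset[of _ "{..n}"]) (use upper in auto)
  ultimately have "Max (\<rho> ` L) = n" using upper by (intro Max_eqI) auto
  then show ?thesis unfolding ICR_def hb C \<rho>_def .
qed

end

theorem proposition5p1: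
  fixes n :: nat and r :: "int vec" and R :: "int mat" and \<Delta> :: int and I :: "int set"
  assumes "n \<ge> 1"
    and "r \<in> carrier_vec n"
    and "R = mat_of_cols n (map (unit_vec n) [0..<n - 1] @ [r])"
    and "r $ (n - 1) = \<Delta>"
    and "\<Delta> \<ge> 1"
    and "I \<subseteq> {0..\<Delta> - 1}"
    and "\<forall>i<n - 1. r $ i \<in> I"
    and "card (I - {0, \<Delta> - 1}) \<le> 2"
  shows "ICR n (pos (map_mat real_of_int R)) = n"
proof -
  interpret unit_cone n r \<Delta>
  proof
    show "0 \<le> r $ i \<and> r $ i \<le> \<Delta> - 1" if "i < n - 1" for i
    proof -
      have "r $ i \<in> {0..\<Delta> - 1}" using assms(6,7) that by blast
      then show ?thesis by simp
    qed
  qed (fact assms)+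
  have "J \<subseteq> I - {0, \<Delta> - 1}"
  proof
    fix a assume "a \<in> J"
    then obtain i where "i < n - 1" "a = r $ i" "a \<notin> {0, \<Delta> - 1}" unfolding J_def by blast
    then show "a \<in> I - {0, \<Delta> - 1}" using assms(7) by simp
  qed
  moreover have "finite (I - {0, \<Delta> - 1})"
    by (intro finite_Diff finite_subset[OF assms(6)] finite_atLeastAtMost_int)
  ultimately have "card J \<le> card (I - {0, \<Delta> - 1})" by (intro card_mono)
  then have "card J \<le> 2" using assms(8) by linarith
  then show ?thesis unfolding assms(3) by (rule ICR_eq[OF _ lattice_points_eq_L])
qed

end
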